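(* Let $p:E\to B$ be a continuous map admitting a path-lifting map which is sequentially homotopy unital. Then $p$ is a universal homology fibration.
   Context: A path-lifting map for $p:E\to B$ is a continuous map $\ell:E\times_B\mathrm{map}(I,B)\to E$, where $\mathrm{map}(I,B)$ is a space over $B$ via evaluation at $0$, such that $\ell(-,\gamma)$ maps $p^{-1}(\gamma(0))$ to $p^{-1}(\gamma(1))$ for each path $\gamma$. Its unit map is $u:E\to E$, $u(e)=\ell(e,\underline{p(e)})$, where $\underline{p(e)}$ is the constant path at $p(e)$. A nested sequence $E_k$ ($E_k\subseteq E_{k+1}$) of subspaces of $E$ is a fibrewise filtration of $E$ if for any map $K\to E$ from a finite simplicial complex $K$ there is some $k$ and a fibrewise homotopy (i.e. one whose composition with $p$ is constant in the homotopy parameter) from this map to a map with image in $E_k$. A path-lifting map $\ell$ for $p$ is sequentially homotopy unital if there exist a fibrewise filtration $E_k$ of $E$, a family of open covers $\mathcal U_k$ of $B$ (one for each $k$) and, for each $k$ and each $U\in\mathcal U_k$, a fibrewise homotopy $$h_U:(E_k\cap p^{-1}(U))\times I\to E$$ from $\mathrm{id}$ (the inclusion) to (the restriction of) the unit map $u$. For $b\in B$, $\mathrm{fib}_b\,p=p^{-1}(b)$ and $\mathrm{hofib}_b\,p=E\times_B\mathrm{map}_*(I,B)$ is the homotopy fibre (pairs of $e\in E$ and a path in $B$ connecting $b$ with $p(e)$). A map $p$ is a homology fibration if for every $b\in B$ the canonical inclusion $\mathrm{fib}_b\,p\to\mathrm{hofib}_b\,p$ induces an isomorphism in integral homology. It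 is a universal homology fibration if for every $n\ge0$ and every map $\sigma:D^n\to B$ the pullback $\sigma^*E\to D^n$ is a homology fibration. *)

theory Defs
  imports "HOL-Homology.Homology"
begin

text \<open>The set of continuous maps with the compact-open topology. Maps are normalised to be
  \<open>undefined\<close> outside \<^term>\<open>topspace X\<close>, so that each map is represented by exactly one function.\<close>

definition mapping_space :: "'a topology \<Rightarrow> 'b topology \<Rightarrow> ('a \<Rightarrow> 'b) topology" where
  "mapping_space X Y =
    topology_generated_by
      {{f \<in> extensional (topspace X). continuous_map X Y f \<and> f ` C \<subseteq> U} | C U.
         compactin X C \<and> openin Y U}"

lemma topspace_mapping_space [simp]:
  "topspace (mapping_space X Y) = {f \<in> extensional (topspace X). continuous_map X Y f}"
proof -
  have "compactin X {}" "openin Y {}"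
    by auto
  then have "\<exists>C U. {f \<in> extensional (topspace X). continuous_map X Y f} =
      {f \<in> extensional (topspace X). continuous_map X Y f \<and> f ` C \<subseteq> U} \<and>
      compactin X C \<and> openin Y U"
    by (intro exI[of _ "{}"]) auto
  then show ?thesis
    unfolding mapping_space_def topology_generated_by_topspace by blast
qed

abbreviation unit_interval :: "real topology" where
  "unit_interval \<equiv> top_of_set {0..1}"

abbreviation path_space :: "'b topology \<Rightarrow> (real \<Rightarrow> 'b) topology" where
  "path_space B \<equiv> mapping_space unit_interval B"

definition const_path :: "'b \<Rightarrow> real \<Rightarrow> 'b" where
  "const_path b = (\<lambda>t\<in>{0..1}. b)"

definition fibre_product ::
  "'a topology \<Rightarrow> 'c topology \<Rightarrow> ('a \<Rightarrow> 'b) \<Rightarrow> ('c \<Rightarrow> 'b) \<Rightarrow> ('a \<times> 'c) topology" where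
  "fibre_product X Y f g = subtopology (prod_topology X Y) {(x, y). f x = g y}"

definition path_lifting_map ::
  "'e topology \<Rightarrow> 'b topology \<Rightarrow> ('e \<Rightarrow> 'b) \<Rightarrow> ('e \<times> (real \<Rightarrow> 'b) \<Rightarrow> 'e) \<Rightarrow> bool" where
  "path_lifting_map E B p l \<longleftrightarrow>
     continuous_map (fibre_product E (path_space B) p (\<lambda>\<gamma>. \<gamma> 0)) E l \<and>
     (\<forall>\<gamma> \<in> topspace (path_space B). \<forall>e \<in> topspace E. p e = \<gamma> 0 \<longrightarrow> p (l (e, \<gamma>)) = \<gamma> 1)"

definition unit_map :: "('e \<Rightarrow> 'b) \<Rightarrow> ('e \<times> (real \<Rightarrow> 'b) \<Rightarrow> 'e) \<Rightarrow> 'e \<Rightarrow> 'e" where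
  "unit_map p l e = l (e, const_path (p e))"

definition fibrewise_homotopic ::
  "('e \<Rightarrow> 'b) \<Rightarrow> 'a topology \<Rightarrow> 'e topology \<Rightarrow> ('a \<Rightarrow> 'e) \<Rightarrow> ('a \<Rightarrow> 'e) \<Rightarrow> bool" where
  "fibrewise_homotopic p X E f g \<longleftrightarrow>
     homotopic_with (\<lambda>h. \<forall>x \<in> topspace X. p (h x) = p (f x)) X E f g"

text \<open>The library's \<open>simplicial_complex\<close> (theory Polytope) lives in one fixed Euclidean space, so it cannot be used to
  quantify over complexes of all dimensions. Every finite simplicial complex is isomorphic to an
  abstract one whose vertices are natural numbers.\<close>

definition finite_simplicial_complex :: "nat set set \<Rightarrow> bool" where
  "finite_simplicial_complex K \<longleftrightarrow>
     finite K \<and> (\<forall>S \<in> K. finite S \<and> S \<noteq> {}) \<and>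
     (\<forall>S \<in> K. \<forall>T. T \<subseteq> S \<and> T \<noteq> {} \<longrightarrow> T \<in> K)"

text \<open>Geometric realization in barycentric coordinates.\<close>

definition realization :: "nat set set \<Rightarrow> (nat \<Rightarrow> real) topology" where
  "realization K =
     subtopology (powertop_real UNIV)
       {x. (\<forall>i. 0 \<le> x i) \<and> {i. x i \<noteq> 0} \<in> K \<and> (\<Sum>i | x i \<noteq> 0. x i) = 1}"

definition fibrewise_filtration ::
  "'e topology \<Rightarrow> ('e \<Rightarrow> 'b) \<Rightarrow> (nat \<Rightarrow> 'e set) \<Rightarrow> bool" where
  "fibrewise_filtration E p F \<longleftrightarrow>
     (\<forall>k. F k \<subseteq> topspace E) \<and> (\<forall>k. F k \<subseteq> F (Suc k)) \<and>
     (\<forall>K f. finite_simplicial_complex K \<and> continuous_map (realization K) E f \<longrightarrow>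
        (\<exists>k g. fibrewise_homotopic p (realization K) E f g \<and>
               g ` topspace (realization K) \<subseteq> F k))"

definition sequentially_homotopy_unital ::
  "'e topology \<Rightarrow> 'b topology \<Rightarrow> ('e \<Rightarrow> 'b) \<Rightarrow> ('e \<times> (real \<Rightarrow> 'b) \<Rightarrow> 'e) \<Rightarrow> bool" where
  "sequentially_homotopy_unital E B p l \<longleftrightarrow>
     (\<exists>F \<U>. fibrewise_filtration E p F \<and>
        (\<forall>k. (\<forall>U \<in> \<U> k. openin B U) \<and> \<Union>(\<U> k) = topspace B) \<and>
        (\<forall>k. \<forall>U \<in> \<U> k.
           fibrewise_homotopic p (subtopology E (F k \<inter> p -` U)) E id (unit_map p l)))"

definition fib :: "'e topology \<Rightarrow> ('e \<Rightarrow> 'b) \<Rightarrow> 'b \<Rightarrow> 'e topology" where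
  "fib E p b = subtopology E (p -` {b})"

definition hofib ::
  "'e topology \<Rightarrow> 'b topology \<Rightarrow> ('e \<Rightarrow> 'b) \<Rightarrow> 'b \<Rightarrow> ('e \<times> (real \<Rightarrow> 'b)) topology" where
  "hofib E B p b =
     fibre_product E (subtopology (path_space B) {\<gamma>. \<gamma> 0 = b}) p (\<lambda>\<gamma>. \<gamma> 1)"

definition homology_fibration :: "'e topology \<Rightarrow> 'b topology \<Rightarrow> ('e \<Rightarrow> 'b) \<Rightarrow> bool" where
  "homology_fibration E B p \<longleftrightarrow>
     continuous_map E B p \<and>
     (\<forall>b \<in> topspace B. \<forall>n.
        hom_induced n (fib E p b) {} (hofib E B p b) {} (\<lambda>e. (e, const_path b))
          \<in> iso (homology_group n (fib E p b)) (homology_group n (hofib E B p b)))"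

definition ndisc :: "nat \<Rightarrow> (nat \<Rightarrow> real) topology" where
  "ndisc n = subtopology (Euclidean_space n) {x. (\<Sum>i<n. (x i)\<^sup>2) \<le> 1}"

definition universal_homology_fibration ::
  "'e topology \<Rightarrow> 'b topology \<Rightarrow> ('e \<Rightarrow> 'b) \<Rightarrow> bool" where
  "universal_homology_fibration E B p \<longleftrightarrow>
     continuous_map E B p \<and>
     (\<forall>n \<sigma>. continuous_map (ndisc n) B \<sigma> \<longrightarrow>
        homology_fibration (fibre_product (ndisc n) E \<sigma> p) (ndisc n) fst)"

end

theory Submission
  imports Defs "HOL-Analysis.Abstract_Topological_Spaces"
begin

text \<open>Write \<open>u\<close> for the unit map. Lifting paths backwards gives a map \<open>R\<close> from the homotopy fibre to the
  fibre which, composed with the inclusion \<open>j\<close> on either side, is \<open>u\<close> up to homotopy. Fibre and homotopy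
  fibre are both pullbacks of \<open>p\<close>, so it suffices to show that for every pullback \<open>1 - u\<close> is locally
  nilpotent on homology; then \<open>u\<close>, and hence \<open>j\<close>, is bijective on homology.

  For nilpotence, consider \<open>n\<close>-chains of \<open>q\<close>-cubes in the fibres, all of whose cube faces cancel; such a
  cycle has a total class in degree \<open>n + q\<close> of the total space. The cubes over a given \<open>n\<close>-simplex of the base are glued
  along equal faces to a finite complex, which is deformed fibrewise into some stage of
  the filtration. After subdividing the simplex, every piece lies in a member of the cover and the
  homotopy from the identity to \<open>u\<close> exists there; it has one more cube coordinate. The homotopies
  of neighbouring pieces need not match, but the mismatch is a cycle of \<open>(q + 1)\<close>-cubes over
  \<open>(n - 1)\<close>-simplices. Hence \<open>1 - u\<close> lowers \<open>n\<close> and \<open>n + 1\<close> applications kill the class.\<close>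

section \<open>Mapping spaces and fibrewise homotopies\<close>

text \<open>The pair (\<open>n\<close>, \<open>q\<close>) acts as base and fibre degree in the Serre
  spectral sequence, handled on chains. A cycle of degree \<open>m\<close> starts as a family of
  0-cubes with \<open>n = m\<close>; as \<open>n + q\<close> stays equal to \<open>m\<close>, the
  process ends at \<open>n = 0\<close>, where homotopies have no boundary that could mismatch. Cubes
  serve in the fibre direction because a homotopy of \<open>q\<close>-cubes is already a
  \<open>(q + 1)\<close>-cube; simplices serve in the base direction because they can be subdivided
  until they are small for a cover. The gluing answers an obstacle: homotopies chosen for each cube
  separately would differ on common faces, so faces that cancel in the cycle would no longer cancel
  after the step. A homotopy on the glued complex has one value on a common face. It suffices to
  glue over one base simplex at a time: each cube lies in a single fibre, so families of cubes with
  a common face lie over the same simplex. One complex, rather than single cubes, must be deformed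
  also because the cover, and with it the subdivision, depends on the stage reached.\<close>

lemma continuous_map_curry:
  assumes h: "continuous_map (prod_topology Z X) Y h"
  shows "continuous_map Z (mapping_space X Y) (\<lambda>z. \<lambda>x\<in>topspace X. h (z, x))"
  unfolding mapping_space_def
proof (rule continuous_on_generated_topo)
  have cz: "continuous_map X Y (\<lambda>x\<in>topspace X. h (z, x))" if "z \<in> topspace Z" for z
  proof -
    have "continuous_map X Y (h \<circ> (\<lambda>x. (z, x)))"
      by (rule continuous_map_compose[OF _ h]) (simp add: continuous_map_pairwise o_def that)
    then show ?thesis
      by (rule continuous_map_eq) auto
  qed
  fix W assume "W \<in> {{f \<in> extensional (topspace X). continuous_map X Y f \<and> f ` C \<subseteq> U} | C U.
         compactin X C \<and> openin Y U}"
  then obtain C U where W: "W = {f \<in> extensional (topspace X). continuous_map X Y f \<and> f ` C \<subseteq> U}"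
    and C: "compactin X C" and U: "openin Y U"
    by blast
  let ?g = "\<lambda>z. \<lambda>x\<in>topspace X. h (z, x)"
  have CX: "C \<subseteq> topspace X"
    using C compactin_subset_topspace by blast
  have eq: "?g -` W \<inter> topspace Z = {z \<in> topspace Z. \<forall>x\<in>C. h (z, x) \<in> U}"
    using cz CX by (auto simp: W image_subset_iff subset_iff)
  have opn: "openin (prod_topology Z X) {w \<in> topspace (prod_topology Z X). h w \<in> U}"
    using h U openin_continuous_map_preimage by blast
  have "\<exists>V. openin Z V \<and> z \<in> V \<and> V \<subseteq> {z \<in> topspace Z. \<forall>x\<in>C. h (z, x) \<in> U}"
    if z: "z \<in> topspace Z" "\<forall>x\<in>C. h (z, x) \<in> U" for z
  proof -
    have "{z} \<times> C \<subseteq> {w \<in> topspace (prod_topology Z X). h w \<in> U}"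
      using z CX by auto
    \<comment> \<open>This is the tube lemma: compactness of \<open>C\<close> widens the single
      parameter \<open>z\<close> to an open set \<open>V\<close> of parameters.\<close>
    then obtain V V' where "openin Z V" "openin X V'" "{z} \<subseteq> V" "C \<subseteq> V'"
      "V \<times> V' \<subseteq> {w \<in> topspace (prod_topology Z X). h w \<in> U}"
      using Wallace_theorem_prod_topology[OF _ C opn, of "{z}"] z(1) by (auto simp: compactin_sing)
    then show ?thesis
      by (intro exI[of _ V]) (auto dest: openin_subset)
  qed
  then show "openin Z (?g -` W \<inter> topspace Z)"
    unfolding eq by (subst openin_subopen) auto
next
  have "(\<lambda>x\<in>topspace X. h (z, x)) \<in> topspace (mapping_space X Y)" if "z \<in> topspace Z" for z
  proof -
    have "continuous_map X Y (h \<circ> (\<lambda>x. (z, x)))"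
      by (rule continuous_map_compose[OF _ h]) (simp add: continuous_map_pairwise o_def that)
    then have "continuous_map X Y (\<lambda>x\<in>topspace X. h (z, x))"
      by (rule continuous_map_eq) auto
    then show ?thesis by simp
  qed
  then show "(\<lambda>z. \<lambda>x\<in>topspace X. h (z, x)) ` topspace Z \<subseteq>
    \<Union> {{f \<in> extensional (topspace X). continuous_map X Y f \<and> f ` C \<subseteq> U} | C U.
         compactin X C \<and> openin Y U}"
    unfolding mapping_space_def topology_generated_by_topspace by blast
qed

lemma openin_mapping_space_subbasis:
  assumes "compactin X C" "openin Y U"
  shows "openin (mapping_space X Y) {f \<in> topspace (mapping_space X Y). f ` C \<subseteq> U}"
proof -
  have eq: "{f \<in> topspace (mapping_space X Y). f ` C \<subseteq> U}
      = {f \<in> extensional (topspace X). continuous_map X Y f \<and> f ` C \<subseteq> U}"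
    by auto
  show ?thesis
    unfolding eq unfolding mapping_space_def
    by (rule topology_generated_by_Basis) (use assms in blast)
qed

text \<open>In a compact Hausdorff space, open sets contain compact neighbourhoods of their points.
  If \<open>f x\<close> lies in \<open>U\<close>, choose one inside the preimage of
  \<open>U\<close>, say \<open>C\<close> with open part \<open>V\<close>: any map sending
  \<open>C\<close> into \<open>U\<close> then sends all of \<open>V\<close> into
  \<open>U\<close>.\<close>

lemma continuous_map_eval:
  assumes "compact_space X" "Hausdorff_space X"
  shows "continuous_map (prod_topology (mapping_space X Y) X) Y (\<lambda>(f, x). f x)"
proof -
  have nb: "neighbourhood_base_of (compactin X) X"
    by (intro locally_compact_imp_neighbourhood_base compact_imp_locally_compact_space
        compact_Hausdorff_imp_regular_space assms)
  let ?ev = "\<lambda>(f, x). f x"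
  have "openin (prod_topology (mapping_space X Y) X)
      {w \<in> topspace (prod_topology (mapping_space X Y) X). ?ev w \<in> U}" (is "openin ?T ?W")
    if U: "openin Y U" for U
  proof (subst openin_subopen, clarify)
    fix f x assume fx: "(f, x) \<in> topspace ?T" "f x \<in> U"
    then have f: "f \<in> topspace (mapping_space X Y)" and x: "x \<in> topspace X"
      by auto
    then have "openin X {y \<in> topspace X. f y \<in> U}"
      using U openin_continuous_map_preimage by auto
    then obtain V C where VC: "openin X V" "compactin X C" "x \<in> V" "V \<subseteq> C" "C \<subseteq> {y \<in> topspace X. f y \<in> U}"
      using nb x fx(2) unfolding neighbourhood_base_of by (metis (mono_tags, lifting) mem_Collect_eq)
    let ?N = "{g \<in> topspace (mapping_space X Y). g ` C \<subseteq> U} \<times> V"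
    have "openin ?T ?N"
      using openin_mapping_space_subbasis[OF VC(2) U] VC(1) unfolding openin_prod_Times_iff by blast
    moreover have "(f, x) \<in> ?N" "?N \<subseteq> ?W"
      using VC f openin_subset[OF VC(1)] by (auto simp: image_subset_iff)
    ultimately show "\<exists>T. openin ?T T \<and> (f, x) \<in> T \<and> T \<subseteq> ?W"
      by blast
  qed
  then show ?thesis
    by (auto simp: continuous_map continuous_map_def Pi_iff)
qed

lemma continuous_map_uncurry:
  assumes "continuous_map Z (mapping_space X Y) g" "compact_space X" "Hausdorff_space X"
  shows "continuous_map (prod_topology Z X) Y (\<lambda>(z, x). g z x)"
proof -
  have "continuous_map (prod_topology Z X) (prod_topology (mapping_space X Y) X) (\<lambda>(z, x). (g z, x))"
    using assms(1) by (auto simp: continuous_map_pairwise o_def case_prod_unfold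
        intro: continuous_map_compose[OF continuous_map_fst, unfolded o_def] continuous_map_snd)
  from continuous_map_compose[OF this continuous_map_eval[OF assms(2,3)]]
  show ?thesis by (simp add: o_def case_prod_unfold)
qed

section \<open>Calculus of fibrewise homotopies\<close>

lemma fibrewise_homotopic_iff:
  "fibrewise_homotopic p X E f g \<longleftrightarrow>
    (\<exists>h. continuous_map (prod_topology unit_interval X) E h \<and>
      (\<forall>x\<in>topspace X. h (0, x) = f x \<and> h (1, x) = g x \<and> (\<forall>t\<in>{0..1}. p (h (t, x)) = p (f x))))"
  unfolding fibrewise_homotopic_def
  by (subst homotopic_with) (auto simp: Ball_def)

lemma fibrewise_homotopic_trans:
  assumes "fibrewise_homotopic p X E f g" "fibrewise_homotopic p X E g h"
  shows "fibrewise_homotopic p X E f h"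
proof -
  have "p (g x) = p (f x)" if "x \<in> topspace X" for x
    using assms(1) that unfolding fibrewise_homotopic_iff by (metis atLeastAtMost_iff order_refl zero_le_one)
  then have "homotopic_with (\<lambda>h. \<forall>x \<in> topspace X. p (h x) = p (f x)) X E g h"
    using assms(2) unfolding fibrewise_homotopic_def by (elim homotopic_with_mono) auto
  then show ?thesis
    using assms(1) unfolding fibrewise_homotopic_def by (rule homotopic_with_trans[rotated])
qed

lemma fibrewise_homotopic_sym:
  assumes "fibrewise_homotopic p X E f g"
  shows "fibrewise_homotopic p X E g f"
proof -
  have "p (g x) = p (f x)" if "x \<in> topspace X" for x
    using assms(1) that unfolding fibrewise_homotopic_iff by (metis atLeastAtMost_iff order_refl zero_le_one)
  then have "homotopic_with (\<lambda>h. \<forall>x \<in> topspace X. p (h x) = p (g x)) X E f g"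
    using assms unfolding fibrewise_homotopic_def by (elim homotopic_with_mono) auto
  then show ?thesis
    unfolding fibrewise_homotopic_def by (simp add: homotopic_with_sym)
qed

lemma fibrewise_homotopic_compose_right:
  assumes "fibrewise_homotopic p X E f g" "continuous_map Z X k"
  shows "fibrewise_homotopic p Z E (f \<circ> k) (g \<circ> k)"
proof -
  have "homotopic_with (\<lambda>h. \<forall>x \<in> topspace Z. p (h x) = p ((f \<circ> k) x)) Z E (f \<circ> k) (g \<circ> k)"
    using assms(1) unfolding fibrewise_homotopic_def
    by (rule homotopic_with_compose_continuous_map_right[OF _ assms(2)])
       (use continuous_map_funspace[OF assms(2)] in auto)
  then show ?thesis unfolding fibrewise_homotopic_def .
qed

lemma fibrewise_homotopic_compose_left:
  assumes "fibrewise_homotopic p X E f g" "continuous_map E E u"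
    and "\<And>e. e \<in> topspace E \<Longrightarrow> p (u e) = p e"
  shows "fibrewise_homotopic p X E (u \<circ> f) (u \<circ> g)"
proof -
  obtain h where h: "continuous_map (prod_topology unit_interval X) E h"
    "\<And>x. x\<in>topspace X \<Longrightarrow> h (0, x) = f x \<and> h (1, x) = g x \<and> (\<forall>t\<in>{0..1}. p (h (t, x)) = p (f x))"
    using assms(1) unfolding fibrewise_homotopic_iff by blast
  have hE: "h (t, x) \<in> topspace E" if "t \<in> {0..1}" "x \<in> topspace X" for t x
    using continuous_map_funspace[OF h(1)] that by auto
  then have fE: "f x \<in> topspace E" if "x \<in> topspace X" for x
    using h(2)[OF that] that by (metis atLeastAtMost_iff order_refl zero_le_one)
  show ?thesis
    unfolding fibrewise_homotopic_iff
    by (intro exI[of _ "u \<circ> h"] conjI continuous_map_compose[OF h(1) assms(2)])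
       (use h(2) hE fE assms(3) in auto)
qed

lemma fibrewise_homotopic_imp_continuous_maps:
  assumes "fibrewise_homotopic p X E f g"
  shows "continuous_map X E f" "continuous_map X E g"
  using assms homotopic_with_imp_continuous_maps unfolding fibrewise_homotopic_def by blast+

section \<open>A natural prism operator\<close>

abbreviation simplex_space :: "nat \<Rightarrow> (nat \<Rightarrow> real) topology" where
  "simplex_space p \<equiv> subtopology (powertop_real UNIV) (standard_simplex p)"

text \<open>The universal simplex of the method of acyclic models: every singular simplex
  \<open>f\<close> is its image under \<open>f\<close>. The restriction gives the normal form of
  singular simplices outside \<open>standard_simplex p\<close>.\<close>

definition id_simplex :: "nat \<Rightarrow> (nat \<Rightarrow> real) chain" where
  "id_simplex p = frag_of (restrict id (standard_simplex p))"

abbreviation iterated_subdivision :: "nat \<Rightarrow> nat \<Rightarrow> 'a chain \<Rightarrow> 'a chain" where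
  "iterated_subdivision r p \<equiv> singular_subdivision p ^^ r"

lemma singular_chain_iterated_subdivision:
  "singular_chain p X c \<Longrightarrow> singular_chain p X (iterated_subdivision r p c)"
  by (induction r) (auto intro: singular_chain_singular_subdivision)

lemma chain_boundary_iterated_subdivision:
  "singular_chain p X c \<Longrightarrow>
    chain_boundary p (iterated_subdivision r p c) = iterated_subdivision r (p - Suc 0) (chain_boundary p c)"
proof (induction r)
  case (Suc r)
  then show ?case
    using chain_boundary_singular_subdivision[OF singular_chain_iterated_subdivision[OF Suc.prems, of r]]
    by simp
qed simp

lemma iterated_subdivision_chain_map:
  "singular_chain p X c \<Longrightarrow>
    iterated_subdivision r p (chain_map p g c) = chain_map p g (iterated_subdivision r p c)"
proof (induction r)
  case (Suc r)
  then show ?case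
    using naturality_singular_subdivision[OF singular_chain_iterated_subdivision[OF Suc.prems, of r]]
    by simp
qed simp

lemma iterated_subdivision_zero:
  "singular_chain 0 X c \<Longrightarrow> iterated_subdivision r 0 c = c"
  by (induction r) (auto simp: singular_subdivision_zero)

lemma singular_chain_id_simplex: "singular_chain p (simplex_space p) (id_simplex p)"
  using simplicial_imp_singular_chain[of p "standard_simplex p" "id_simplex p"]
  by (simp add: id_simplex_def)

lemma chain_map_id_simplex:
  "singular_simplex p X f \<Longrightarrow> chain_map p f (id_simplex p) = frag_of f"
  unfolding id_simplex_def by (rule singular_simplex_chain_map_id)

lemma contractible_simplex_space: "contractible_space (simplex_space p)"
proof -
  define b :: "nat \<Rightarrow> real" where "b = (\<lambda>i. if i = 0 then 1 else 0)"
  have b: "b \<in> standard_simplex p"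
    by (simp add: b_def)
  have "homotopic_with (\<lambda>x. True) (simplex_space p) (simplex_space p) id (\<lambda>x. b)"
    unfolding homotopic_with_def
  proof (intro exI conjI)
    let ?h = "\<lambda>(s, x). \<lambda>i. (1 - s) * x i + s * b i"
    have "continuous_map (prod_topology unit_interval (simplex_space p)) euclideanreal
      (\<lambda>z. (1 - fst z) * snd z i + fst z * b i)" for i
    proof -
      have 1: "continuous_map (prod_topology unit_interval (simplex_space p)) euclideanreal fst"
        by (metis continuous_map_fst continuous_map_into_fulltopology)
      have 2: "continuous_map (prod_topology unit_interval (simplex_space p)) euclideanreal (\<lambda>z. snd z i)"
        by (rule continuous_map_compose[OF continuous_map_snd, unfolded o_def])
           (auto intro: continuous_map_from_subtopology continuous_map_product_projection)
      show ?thesis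
        by (intro continuous_intros 1 2) auto
    qed
    then show "continuous_map (prod_topology unit_interval (simplex_space p)) (simplex_space p) ?h"
      using b by (auto simp: continuous_map_in_subtopology continuous_map_componentwise_UNIV
          case_prod_unfold convex_standard_simplex)
  qed auto
  then show ?thesis
    unfolding contractible_space_def by blast
qed

text \<open>Contracting \<open>M\<close> to \<open>a\<close> makes \<open>z\<close> homologous to a
  cycle in a one-point space, and there every cycle of positive degree bounds.\<close>

lemma cycle_in_contractible_space:
  assumes M: "contractible_space M" and z: "singular_relcycle p M {} z" and p: "1 \<le> p"
  shows "singular_relboundary p M {} z"
proof (cases "topspace M = {}")
  case True
  then have "z = 0"
    using z by (auto simp: singular_cycle singular_chain_empty)
  then show ?thesis by simp
next
  case False
  then obtain a where a: "homotopic_with (\<lambda>x. True) M M id (\<lambda>x. a)"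
    using M unfolding contractible_space_def by blast
  with False have aM: "a \<in> topspace M"
    using homotopic_with_imp_continuous_maps[OF a] by (auto simp: continuous_map_const)
  have "homotopic_with (\<lambda>h. h \<in> {} \<rightarrow> {}) M M id (\<lambda>x. a)"
    using a by (rule homotopic_with_mono) auto
  from homotopic_imp_homologous_rel_chain_maps[OF this z]
  have 1: "homologous_rel p M {} (chain_map p id z) (chain_map p (\<lambda>x. a) z)" .
  have "continuous_map M (subtopology M {a}) (\<lambda>x. a)"
    using aM by (simp add: continuous_map_in_subtopology)
  then have "singular_relcycle p (subtopology M {a}) {} (chain_map p (\<lambda>x. a) z)"
    by (intro singular_relcycle_chain_map[OF z]) auto
  then have "singular_relboundary p (subtopology M {a}) {} (chain_map p (\<lambda>x. a) z)"
    using singular_boundary_eq_cycle_singleton[of "subtopology M {a}" a p] aM p by simp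
  then have "singular_relboundary p M {} (chain_map p (\<lambda>x. a) z)"
    using singular_boundary_mono[where T = "{a}" and S = "topspace M" and X = M] by (simp add: aM)
  moreover have "chain_map p id z = z"
    using z by (auto simp: singular_cycle intro: chain_map_ident)
  ultimately show ?thesis
    using 1 unfolding homologous_rel_def by (metis diff_add_cancel singular_relboundary_add)
qed

text \<open>Natural in \<open>c\<close> by construction, since \<open>U\<close> is a fixed chain of the prism over the model simplex.\<close>

definition prism_op ::
  "nat \<Rightarrow> ('y \<times> real \<Rightarrow> 'z) \<Rightarrow> ((nat \<Rightarrow> real) \<times> real) chain \<Rightarrow> 'y chain \<Rightarrow> 'z chain" where
  "prism_op p e U c = frag_extend (\<lambda>f. chain_map (Suc p) (\<lambda>(t, s). e (f t, s)) U) c"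

abbreviation prism_space :: "nat \<Rightarrow> ((nat \<Rightarrow> real) \<times> real) topology" where
  "prism_space p \<equiv> prod_topology (simplex_space p) unit_interval"

lemma prism_op_0 [simp]: "prism_op p e U 0 = 0"
  by (simp add: prism_op_def)

lemma prism_op_diff: "prism_op p e U (a - b) = prism_op p e U a - prism_op p e U b"
  by (simp add: prism_op_def frag_extend_diff)

lemma prism_op_of: "prism_op p e U (frag_of f) = chain_map (Suc p) (\<lambda>(t, s). e (f t, s)) U"
  by (simp add: prism_op_def)

lemma continuous_map_prism:
  assumes f: "singular_simplex p Y f" and e: "continuous_map (prod_topology Y unit_interval) Z e"
  shows "continuous_map (prism_space p) Z (\<lambda>(t, s). e (f t, s))"
proof -
  have "continuous_map (prism_space p) (prod_topology Y unit_interval) (\<lambda>z. (f (fst z), snd z))"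
    using f unfolding singular_simplex_def
    by (auto simp: continuous_map_pairwise o_def
        intro: continuous_map_compose[OF continuous_map_fst, unfolded o_def] continuous_map_snd)
  from continuous_map_compose[OF this e] show ?thesis
    by (simp add: o_def case_prod_unfold)
qed

lemma singular_chain_prism_op:
  assumes "singular_chain p Y c" "continuous_map (prod_topology Y unit_interval) Z e"
    "singular_chain (Suc p) (prism_space p) U"
  shows "singular_chain (Suc p) Z (prism_op p e U c)"
  unfolding prism_op_def
proof (rule singular_chain_extend)
  fix f assume "f \<in> Poly_Mapping.keys c"
  then have "singular_simplex p Y f"
    using assms(1) by (auto simp: singular_chain_def)
  then show "singular_chain (Suc p) Z (chain_map (Suc p) (\<lambda>(t, s). e (f t, s)) U)"
    by (intro singular_chain_chain_map[OF assms(3)] continuous_map_prism[OF _ assms(2)])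
qed

text \<open>Both sides transport the same chain \<open>U\<close> along maps that agree on the prism.
  Compatibility is asked only pointwise, so the lemma also covers a \<open>g'\<close> that restricts
  functions to a face of the cube, for which no topology on the target is chosen.\<close>

lemma chain_map_prism_op:
  assumes c: "singular_chain p Y c" and U: "singular_chain (Suc p) (prism_space p) U"
    and eq: "\<And>y s. y \<in> topspace Y \<Longrightarrow> s \<in> {0..1} \<Longrightarrow> g (e (y, s)) = e' (g' y, s)"
  shows "chain_map (Suc p) g (prism_op p e U c) = prism_op p e' U (chain_map p g' c)"
  using c unfolding singular_chain_def
proof (induction rule: frag_induction)
  case (one f)
  then have f: "f t \<in> topspace Y" if "t \<in> standard_simplex p" for t
    using that by (auto simp: singular_simplex_def dest!: continuous_map_funspace)
  have "chain_map (Suc p) g (chain_map (Suc p) (\<lambda>(t, s). e (f t, s)) U)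
      = chain_map (Suc p) (g \<circ> (\<lambda>(t, s). e (f t, s))) U"
    by (simp add: chain_map_compose)
  also have "\<dots> = chain_map (Suc p) (\<lambda>(t, s). e' (simplex_map p g' f t, s)) U"
    by (rule chain_map_eq[OF U]) (auto simp: simplex_map_def eq f)
  finally show ?case
    by (simp add: prism_op_of)
next
  case (diff a b)
  then show ?case
    by (simp add: prism_op_diff chain_map_diff)
qed simp

text \<open>The chains \<open>U\<close> and \<open>V\<close> are consecutive terms of the acyclic-model recursion for a natural
  homotopy between the bottom inclusion precomposed with \<open>r\<close>-fold subdivision and the top inclusion.\<close>

definition prism_step ::
  "nat \<Rightarrow> nat \<Rightarrow> ((nat \<Rightarrow> real) \<times> real) chain \<Rightarrow> ((nat \<Rightarrow> real) \<times> real) chain \<Rightarrow> bool" where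
  "prism_step r p V U \<longleftrightarrow>
    chain_boundary (Suc p) U = chain_map p (\<lambda>t. (t, 1)) (id_simplex p)
      - chain_map p (\<lambda>t. (t, 0)) (iterated_subdivision r p (id_simplex p))
      - prism_op (p - Suc 0) id V (chain_boundary p (id_simplex p))"

text \<open>By linearity \<open>c\<close> is a single simplex \<open>f\<close>. The identity
  \<open>prism_step\<close> on the model is pushed forward along the map sending
  \<open>(t, s)\<close> to \<open>e (f t, s)\<close>, and naturality rewrites each of its three
  terms.\<close>

lemma chain_boundary_prism_op:
  assumes U: "singular_chain (Suc p) (prism_space p) U"
    and V: "singular_chain (Suc (p - Suc 0)) (prism_space (p - Suc 0)) V"
    and UV: "prism_step r p V U"
    and e: "continuous_map (prod_topology Y unit_interval) Z e"
    and c: "singular_chain p Y c"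
  shows "chain_boundary (Suc p) (prism_op p e U c)
    = chain_map p (\<lambda>y. e (y, 1)) c - chain_map p (\<lambda>y. e (y, 0)) (iterated_subdivision r p c)
      - prism_op (p - Suc 0) e V (chain_boundary p c)"
  using c unfolding singular_chain_def
proof (induction rule: frag_induction)
  case (one f)
  then have f: "singular_simplex p Y f" by simp
  let ?E = "\<lambda>(t, s). e (f t, s)"
  let ?i = "id_simplex p"
  note si = singular_chain_id_simplex[of p]
  have "chain_boundary (Suc p) (prism_op p e U (frag_of f)) = chain_map p ?E (chain_boundary (Suc p) U)"
    using chain_boundary_chain_map[OF U] by (simp add: prism_op_of)
  also have "\<dots> = chain_map p ?E (chain_map p (\<lambda>t. (t, 1)) ?i)
      - chain_map p ?E (chain_map p (\<lambda>t. (t, 0)) (iterated_subdivision r p ?i))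
      - chain_map p ?E (prism_op (p - Suc 0) id V (chain_boundary p ?i))"
    using UV by (simp add: prism_step_def chain_map_diff)
  also have "chain_map p ?E (chain_map p (\<lambda>t. (t, 1)) ?i) = chain_map p (\<lambda>y. e (y, 1)) (chain_map p f ?i)"
    by (simp add: o_def flip: chain_map_compose[unfolded o_def, THEN fun_cong])
  also have "\<dots> = chain_map p (\<lambda>y. e (y, 1)) (frag_of f)"
    by (simp only: chain_map_id_simplex[OF f])
  also have "chain_map p ?E (chain_map p (\<lambda>t. (t, 0)) (iterated_subdivision r p ?i))
      = chain_map p (\<lambda>y. e (y, 0)) (chain_map p f (iterated_subdivision r p ?i))"
    by (simp add: o_def flip: chain_map_compose[unfolded o_def, THEN fun_cong])
  also have "chain_map p f (iterated_subdivision r p ?i) = iterated_subdivision r p (frag_of f)"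
    by (simp only: chain_map_id_simplex[OF f] iterated_subdivision_chain_map[OF si, symmetric])
  also have "chain_map p ?E (prism_op (p - Suc 0) id V (chain_boundary p ?i))
      = prism_op (p - Suc 0) e V (chain_boundary p (frag_of f))"
  \<comment> \<open>For \<open>p = 0\<close> the truncated \<open>p - Suc 0\<close> is again 0 and
    \<open>chain_boundary 0\<close> is zero by definition, so both sides vanish.\<close>
  proof (cases "p = 0")
    case False
    have "chain_map (Suc (p - Suc 0)) ?E (prism_op (p - Suc 0) id V (chain_boundary p ?i))
        = prism_op (p - Suc 0) e V (chain_map (p - Suc 0) f (chain_boundary p ?i))"
      by (rule chain_map_prism_op[OF singular_chain_boundary[OF si] V]) auto
    also have "chain_map (p - Suc 0) f (chain_boundary p ?i) = chain_boundary p (frag_of f)"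
      by (simp only: chain_map_id_simplex[OF f] chain_boundary_chain_map[OF si, symmetric])
    finally show ?thesis using False by (simp add: id_def)
  qed (simp add: chain_boundary_def)
  finally show ?case .
next
  case (diff a b)
  have sub: "iterated_subdivision r p (a - b) = iterated_subdivision r p a - iterated_subdivision r p b"
    by (rule singular_subdivision_power_diff)
  show ?case
    by (simp only: prism_op_diff chain_map_diff chain_boundary_diff sub diff) (simp add: algebra_simps)
qed simp

section \<open>Acyclic models: existence of the prism chains\<close>

lemma continuous_map_prism_end:
  "s \<in> {0..1} \<Longrightarrow> continuous_map (simplex_space p) (prism_space p) (\<lambda>t. (t, s))"
  by (auto simp: continuous_map_pairwise o_def)

text \<open>By \<open>Vb\<close>, applied to the boundary of the model simplex, the prescribed
  boundary of \<open>U\<close> is a cycle; it bounds because the prism is contractible. In degree 0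
  contractibility gives no such conclusion for arbitrary cycles, and there the sliding homotopy
  between the two ends of the prism supplies \<open>U\<close>.\<close>

lemma prism_step_exists:
  assumes V: "p > 0 \<Longrightarrow> singular_chain p (prism_space (p - Suc 0)) V"
    and Vb: "\<And>c. p > 0 \<Longrightarrow> singular_relcycle (p - Suc 0) (simplex_space p) {} c \<Longrightarrow>
      chain_boundary p (prism_op (p - Suc 0) id V c)
        = chain_map (p - Suc 0) (\<lambda>t. (t, 1)) c
          - chain_map (p - Suc 0) (\<lambda>t. (t, 0)) (iterated_subdivision r (p - Suc 0) c)"
  shows "\<exists>U. singular_chain (Suc p) (prism_space p) U \<and> prism_step r p V U"
proof -
  let ?i = "id_simplex p"
  note si = singular_chain_id_simplex[of p]
  note sdi = singular_chain_iterated_subdivision[OF si, of r]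
  have c: "continuous_map (simplex_space p) (prism_space p) (\<lambda>t. (t, 1))"
    "continuous_map (simplex_space p) (prism_space p) (\<lambda>t. (t, 0))"
    by (rule continuous_map_prism_end, simp)+
  let ?z = "chain_map p (\<lambda>t. (t, 1)) ?i
      - chain_map p (\<lambda>t. (t, 0)) (iterated_subdivision r p ?i)
      - prism_op (p - Suc 0) id V (chain_boundary p ?i)"
  have "singular_relboundary p (prism_space p) {} ?z"
  proof (cases "p = 0")
    case True
    have "homotopic_with (\<lambda>h. h \<in> {} \<rightarrow> {}) (simplex_space p) (prism_space p) (\<lambda>t. (t, 1)) (\<lambda>t. (t, 0))"
      unfolding homotopic_with_def
    proof (intro exI[of _ "\<lambda>(s, t). (t, 1 - s)"] conjI)
      have "continuous_map (prod_topology unit_interval (simplex_space p)) unit_interval (\<lambda>z. 1 - fst z)"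
        by (rule continuous_map_compose[OF continuous_map_fst, unfolded o_def])
           (auto simp: continuous_map_in_subtopology intro!: continuous_on_op_minus continuous_intros)
      then show "continuous_map (prod_topology unit_interval (simplex_space p)) (prism_space p) (\<lambda>(s, t). (t, 1 - s))"
        by (auto simp: continuous_map_pairwise o_def case_prod_unfold intro: continuous_map_snd)
    qed auto
    moreover have "singular_relcycle p (simplex_space p) {} ?i"
      using si True by (simp add: singular_cycle chain_boundary_def)
    ultimately have "homologous_rel p (prism_space p) {} (chain_map p (\<lambda>t. (t, 1)) ?i) (chain_map p (\<lambda>t. (t, 0)) ?i)"
      by (rule homotopic_imp_homologous_rel_chain_maps)
    then show ?thesis
      using True si iterated_subdivision_zero[of _ ?i r] by (auto simp: chain_boundary_def homologous_rel_def)
  next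
    case False
    let ?b = "chain_boundary p ?i"
    have b: "singular_chain (p - Suc 0) (simplex_space p) ?b"
      by (rule singular_chain_boundary[OF si])
    have bc: "singular_relcycle (p - Suc 0) (simplex_space p) {} ?b"
      using b chain_boundary_boundary[OF si] by (simp add: singular_cycle)
    have id: "continuous_map (prod_topology (simplex_space p) unit_interval) (prism_space p) id"
      by simp
    have V': "singular_chain (Suc (p - Suc 0)) (prism_space (p - Suc 0)) V"
      using V False by simp
    have ch: "singular_chain p (prism_space p) (prism_op (p - Suc 0) id V ?b)"
      using singular_chain_prism_op[OF b id V'] False by simp
    have bi: "chain_boundary p (iterated_subdivision r p ?i) = iterated_subdivision r (p - Suc 0) ?b"
      by (rule chain_boundary_iterated_subdivision[OF si])
    have "chain_boundary p ?z = 0"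
      using False Vb[OF _ bc]
      by (simp add: chain_boundary_diff chain_boundary_chain_map[OF si] chain_boundary_chain_map[OF sdi] bi)
    then have "singular_relcycle p (prism_space p) {} ?z"
      unfolding singular_cycle
      by (intro conjI singular_chain_diff ch singular_chain_chain_map[OF si] singular_chain_chain_map[OF sdi] c)
    then show ?thesis
      using False contractible_simplex_space
      by (intro cycle_in_contractible_space)
         (auto simp: contractible_space_prod_topology convex_imp_contractible)
  qed
  then show ?thesis
    unfolding prism_step_def singular_boundary by blast
qed

text \<open>The hypothesis \<open>Vb\<close> for the next degree is the boundary formula for the
  current \<open>U\<close>, and that formula refers to the chain before it. Hence the invariant
  \<open>P\<close> of the dependent choice remembers that some predecessor \<open>V\<close>
  exists.\<close>

lemma prism_chain_exists:
  "\<exists>U. \<forall>p. singular_chain (Suc p) (prism_space p) (U p) \<and> prism_step r p (U (p - Suc 0)) (U p)"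
proof -
  define P where "P p U \<longleftrightarrow> singular_chain (Suc p) (prism_space p) U \<and>
    (\<exists>V. singular_chain (Suc (p - Suc 0)) (prism_space (p - Suc 0)) V \<and> prism_step r p V U)" for p U
  have "\<exists>U. \<forall>p. P p (U p) \<and> prism_step r (Suc p) (U p) (U (Suc p))"
  proof (rule dependent_nat_choice)
    obtain U where "singular_chain (Suc 0) (prism_space 0) U" "prism_step r 0 0 U"
      using prism_step_exists[of 0 0 r] by auto
    then show "\<exists>U. P 0 U"
      unfolding P_def by (metis diff_0_eq_0 singular_chain_0)
  next
    fix U p assume "P p U"
    then obtain V where U: "singular_chain (Suc p) (prism_space p) U"
      and V: "singular_chain (Suc (p - Suc 0)) (prism_space (p - Suc 0)) V" and UV: "prism_step r p V U"
      unfolding P_def by blast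
    have "\<exists>U'. singular_chain (Suc (Suc p)) (prism_space (Suc p)) U' \<and> prism_step r (Suc p) U U'"
    proof (rule prism_step_exists)
      fix c :: "(nat \<Rightarrow> real) chain"
      assume "singular_relcycle (Suc p - Suc 0) (simplex_space (Suc p)) {} c"
      then have c: "singular_chain p (simplex_space (Suc p)) c" "chain_boundary p c = 0"
        by (auto simp: singular_cycle)
      show "chain_boundary (Suc p) (prism_op (Suc p - Suc 0) id U c)
        = chain_map (Suc p - Suc 0) (\<lambda>t. (t, 1)) c
          - chain_map (Suc p - Suc 0) (\<lambda>t. (t, 0)) (iterated_subdivision r (Suc p - Suc 0) c)"
        using chain_boundary_prism_op[OF U V UV _ c(1), of "prism_space (Suc p)" id] c(2) by simp
    qed (use U in auto)
    then show "\<exists>U'. P (Suc p) U' \<and> prism_step r (Suc p) U U'"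
      unfolding P_def using U by auto
  qed
  then obtain U where U: "\<And>p. P p (U p)" "\<And>p. prism_step r (Suc p) (U p) (U (Suc p))"
    by blast
  have "prism_step r p (U (p - Suc 0)) (U p)" for p
  proof (cases p)
    case 0
    \<comment> \<open>At \<open>p = 0\<close> truncation makes \<open>U 0\<close> its own
      predecessor. This is harmless, because the side term there is a prism over the zero
      boundary.\<close>
    have "prism_step r 0 V (U 0) \<longleftrightarrow> prism_step r 0 W (U 0)" for V W
      by (simp add: prism_step_def chain_boundary_def)
    then show ?thesis
      using U(1)[of 0] unfolding P_def 0 by blast
  qed (use U(2) in simp)
  then show ?thesis
    using U(1) unfolding P_def by blast
qed

text \<open>The parameter \<open>r\<close> is kept for two later uses: \<open>r = 0\<close> with
  \<open>cube_slice\<close> integrates out one cube coordinate, and general \<open>r\<close> with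
  \<open>fst\<close> is a chain homotopy between a chain and its \<open>r\<close>-fold
  subdivision.\<close>

definition prism_chain :: "nat \<Rightarrow> nat \<Rightarrow> ((nat \<Rightarrow> real) \<times> real) chain" where
  "prism_chain r = (SOME U. \<forall>p. singular_chain (Suc p) (prism_space p) (U p) \<and> prism_step r p (U (p - Suc 0)) (U p))"

lemma prism_chain:
  shows singular_chain_prism_chain: "singular_chain (Suc p) (prism_space p) (prism_chain r p)"
    and prism_step_prism_chain: "prism_step r p (prism_chain r (p - Suc 0)) (prism_chain r p)"
  using someI_ex[OF prism_chain_exists[of r]] unfolding prism_chain_def[symmetric] by auto

definition prism :: "nat \<Rightarrow> nat \<Rightarrow> ('y \<times> real \<Rightarrow> 'z) \<Rightarrow> 'y chain \<Rightarrow> 'z chain" where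
  "prism r p e c = prism_op p e (prism_chain r p) c"

lemma prism_0 [simp]: "prism r p e 0 = 0"
  by (simp add: prism_def)

lemma singular_chain_prism:
  assumes "continuous_map (prod_topology Y unit_interval) Z e" "singular_chain p Y c"
  shows "singular_chain (Suc p) Z (prism r p e c)"
  unfolding prism_def by (rule singular_chain_prism_op[OF assms(2,1) singular_chain_prism_chain])

lemma chain_map_prism:
  assumes "singular_chain p Y c"
    and "\<And>y s. y \<in> topspace Y \<Longrightarrow> s \<in> {0..1} \<Longrightarrow> g (e (y, s)) = e' (g' y, s)"
  shows "chain_map (Suc p) g (prism r p e c) = prism r p e' (chain_map p g' c)"
  unfolding prism_def by (rule chain_map_prism_op[OF assms(1) singular_chain_prism_chain]) (rule assms(2))

lemma chain_boundary_prism: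
  assumes "continuous_map (prod_topology Y unit_interval) Z e" "singular_chain p Y c"
  shows "chain_boundary (Suc p) (prism r p e c)
    = chain_map p (\<lambda>y. e (y, 1)) c - chain_map p (\<lambda>y. e (y, 0)) (iterated_subdivision r p c)
      - prism r (p - Suc 0) e (chain_boundary p c)"
  unfolding prism_def
  by (rule chain_boundary_prism_op[OF singular_chain_prism_chain singular_chain_prism_chain
        prism_step_prism_chain assms])

section \<open>Families of cubes in the fibres\<close>

text \<open>Padding by zeros puts cubes of all dimensions into one type: \<open>x(q := s)\<close>
  appends a coordinate and \<open>x(q := 0)\<close> drops it.\<close>

definition cube :: "nat \<Rightarrow> (nat \<Rightarrow> real) set" where
  "cube q = {x. (\<forall>i<q. 0 \<le> x i \<and> x i \<le> 1) \<and> (\<forall>i\<ge>q. x i = 0)}"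

abbreviation cube_space :: "nat \<Rightarrow> (nat \<Rightarrow> real) topology" where
  "cube_space q \<equiv> subtopology (powertop_real UNIV) (cube q)"

lemma Hausdorff_cube_space: "Hausdorff_space (cube_space q)"
  by (intro Hausdorff_space_subtopology) (simp add: Hausdorff_space_product_topology)

lemma compact_cube_space: "compact_space (cube_space q)"
proof -
  have eq: "cube q = (\<Pi>\<^sub>E i\<in>UNIV. if i < q then {0..1} else {0})"
    proof (rule Set.set_eqI)
    fix x :: "nat \<Rightarrow> real"
    have "x \<in> cube q \<longleftrightarrow> (\<forall>i. x i \<in> (if i < q then {0..1} else {0}))"
      unfolding cube_def mem_Collect_eq by (metis atLeastAtMost_iff not_less singletonD singletonI)
    then show "x \<in> cube q \<longleftrightarrow> x \<in> (\<Pi>\<^sub>E i\<in>UNIV. if i < q then {0..1} else {0})"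
      by (simp add: PiE_UNIV_domain Pi_iff)
  qed
  have "compactin (powertop_real UNIV) (cube q)"
    unfolding eq by (subst compactin_PiE) auto
  then show ?thesis
    by (rule compact_space_subtopology)
qed

lemma cube_upd: "x \<in> cube q \<Longrightarrow> s \<in> {0..1} \<Longrightarrow> x(q := s) \<in> cube (Suc q)"
  by (auto simp: cube_def)

lemma zero_in_cube: "(\<lambda>_. 0) \<in> cube q"
  by (simp add: cube_def)

text \<open>An \<open>n\<close>-simplex of this space amounts to a map on simplex times cube whose
  image in the base depends on the simplex parameter alone. This separates the base degree
  \<open>n\<close> from the fibre degree \<open>q\<close>.\<close>

definition cube_maps :: "'e topology \<Rightarrow> ('e \<Rightarrow> 'b) \<Rightarrow> nat \<Rightarrow> ((nat \<Rightarrow> real) \<Rightarrow> 'e) topology" where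
  "cube_maps E p q = subtopology (mapping_space (cube_space q) E)
    {\<phi>. \<forall>x\<in>cube q. \<forall>y\<in>cube q. p (\<phi> x) = p (\<phi> y)}"

lemma topspace_cube_maps:
  "topspace (cube_maps E p q) = {\<phi> \<in> extensional (cube q). continuous_map (cube_space q) E \<phi>
    \<and> (\<forall>x\<in>cube q. \<forall>y\<in>cube q. p (\<phi> x) = p (\<phi> y))}"
  unfolding cube_maps_def topspace_subtopology topspace_mapping_space
  by (simp add: Int_def conj_assoc)

lemma cube_maps_fibrewise:
  "\<phi> \<in> topspace (cube_maps E p q) \<Longrightarrow> x \<in> cube q \<Longrightarrow> y \<in> cube q \<Longrightarrow> p (\<phi> x) = p (\<phi> y)"
  unfolding topspace_cube_maps by blast

lemma continuous_map_into_cube_maps: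
  assumes "continuous_map (prod_topology Z (cube_space q)) E h"
    and "\<And>z x y. z \<in> topspace Z \<Longrightarrow> x \<in> cube q \<Longrightarrow> y \<in> cube q \<Longrightarrow> p (h (z, x)) = p (h (z, y))"
  shows "continuous_map Z (cube_maps E p q) (\<lambda>z. \<lambda>x\<in>cube q. h (z, x))"
  unfolding cube_maps_def continuous_map_in_subtopology
proof (rule conjI)
  have eq: "topspace (cube_space q) = cube q" by simp
  show "continuous_map Z (mapping_space (cube_space q) E) (\<lambda>z. \<lambda>x\<in>cube q. h (z, x))"
    using continuous_map_curry[OF assms(1)] unfolding eq .
  show "(\<lambda>z. \<lambda>x\<in>cube q. h (z, x)) \<in> topspace Z \<rightarrow> {\<phi>. \<forall>x\<in>cube q. \<forall>y\<in>cube q. p (\<phi> x) = p (\<phi> y)}"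
  proof (rule Pi_I, rule CollectI, intro ballI)
    fix z x y assume "z \<in> topspace Z" "x \<in> cube q" "y \<in> cube q"
    then show "p ((\<lambda>x\<in>cube q. h (z, x)) x) = p ((\<lambda>x\<in>cube q. h (z, x)) y)"
      using assms(2)[of z x y] by (simp only: restrict_apply if_True simp_thms)
  qed
qed

lemma continuous_map_from_cube_maps:
  assumes "continuous_map Z (cube_maps E p q) g"
  shows "continuous_map (prod_topology Z (cube_space q)) E (\<lambda>(z, x). g z x)"
  using assms unfolding cube_maps_def continuous_map_in_subtopology
  by (intro continuous_map_uncurry compact_cube_space Hausdorff_cube_space) (rule conjunct1)

definition cube_slice :: "nat \<Rightarrow> ((nat \<Rightarrow> real) \<Rightarrow> 'e) \<times> real \<Rightarrow> (nat \<Rightarrow> real) \<Rightarrow> 'e" where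
  "cube_slice q = (\<lambda>(\<phi>, s). \<lambda>x\<in>cube q. \<phi> (x(q := s)))"

text \<open>A face is kept as a restriction to a subset of the cube instead of being reparametrized
  as a lower cube. Thus no coordinates are renumbered, and the index \<open>j\<close> keeps its
  meaning when the last coordinate is sliced off or appended.\<close>

definition cube_face :: "nat \<Rightarrow> nat \<Rightarrow> real \<Rightarrow> ((nat \<Rightarrow> real) \<Rightarrow> 'e) \<Rightarrow> (nat \<Rightarrow> real) \<Rightarrow> 'e" where
  "cube_face q j \<epsilon> \<phi> = restrict \<phi> {x \<in> cube q. x j = \<epsilon>}"

definition cube_act :: "nat \<Rightarrow> ('e \<Rightarrow> 'e) \<Rightarrow> ((nat \<Rightarrow> real) \<Rightarrow> 'e) \<Rightarrow> (nat \<Rightarrow> real) \<Rightarrow> 'e" where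
  "cube_act q u \<phi> = (\<lambda>x\<in>cube q. u (\<phi> x))"

lemma continuous_map_coordinate:
  "continuous_map (subtopology (powertop_real UNIV) S) euclideanreal (\<lambda>x. x i)"
  by (intro continuous_map_from_subtopology continuous_map_product_projection) auto

lemma continuous_map_cube_upd:
  "continuous_map (prod_topology unit_interval (cube_space q)) (cube_space (Suc q)) (\<lambda>(s, x). x(q := s))"
proof -
  have 1: "continuous_map (prod_topology unit_interval (cube_space q)) euclideanreal fst"
    by (metis continuous_map_fst continuous_map_into_fulltopology)
  have 2: "continuous_map (prod_topology unit_interval (cube_space q)) euclideanreal (\<lambda>z. snd z i)" for i
    by (rule continuous_map_compose[OF continuous_map_snd continuous_map_coordinate, unfolded o_def])
  have 3: "continuous_map (prod_topology unit_interval (cube_space q)) euclideanreal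
      (\<lambda>z. ((snd z)(q := fst z)) i)" for i
    by (cases "i = q") (simp_all add: 1 2)
  have "continuous_map (prod_topology unit_interval (cube_space q)) (cube_space (Suc q)) (\<lambda>z. (snd z)(q := fst z))"
    unfolding continuous_map_in_subtopology continuous_map_componentwise_UNIV
    by (intro conjI allI 3) (auto intro: cube_upd)
  then show ?thesis
    by (simp only: case_prod_unfold)
qed

lemma continuous_map_cube_slice:
  "continuous_map (prod_topology (cube_maps E p (Suc q)) unit_interval) (cube_maps E p q) (cube_slice q)"
proof -
  let ?X = "cube_maps E p (Suc q)"
  let ?P = "prod_topology (prod_topology ?X unit_interval) (cube_space q)"
  have "continuous_map ?P unit_interval (snd \<circ> fst)"
    by (intro continuous_map_compose[OF continuous_map_fst continuous_map_snd])
  moreover have "continuous_map ?P ?X (fst \<circ> fst)"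
    by (intro continuous_map_compose[OF continuous_map_fst continuous_map_fst])
  moreover have "continuous_map ?P (cube_space q) snd"
    by (rule continuous_map_snd)
  ultimately have X: "continuous_map ?P ?X (fst \<circ> fst)"
    and I: "continuous_map ?P (prod_topology unit_interval (cube_space q)) (\<lambda>z. (snd (fst z), snd z))"
    by (simp_all add: continuous_map_pairwise o_def)
  have "continuous_map ?P (cube_space (Suc q)) (\<lambda>z. (snd z)(q := snd (fst z)))"
    using continuous_map_compose[OF I continuous_map_cube_upd] by (simp add: o_def)
  then have "continuous_map ?P (prod_topology ?X (cube_space (Suc q)))
      (\<lambda>z. (fst (fst z), (snd z)(q := snd (fst z))))"
    using X by (simp add: continuous_map_pairwise o_def)
  from continuous_map_compose[OF this continuous_map_from_cube_maps[OF continuous_map_id]]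
  have "continuous_map ?P E (\<lambda>z. fst (fst z) ((snd z)(q := snd (fst z))))"
    by (simp add: o_def)
  then have h: "continuous_map ?P E (\<lambda>(z, x). fst z (x(q := snd z)))"
    by (simp only: case_prod_unfold)
  have "continuous_map (prod_topology ?X unit_interval) (cube_maps E p q)
      (\<lambda>z. \<lambda>x\<in>cube q. (\<lambda>(z, x). fst z (x(q := snd z))) (z, x))"
  proof (rule continuous_map_into_cube_maps[OF h])
    fix z x y
    assume z: "z \<in> topspace (prod_topology ?X unit_interval)" and xy: "x \<in> cube q" "y \<in> cube q"
    then have "snd z \<in> {0..1}" and \<phi>: "fst z \<in> topspace ?X"
      by (simp_all add: mem_Times_iff)
    then have "x(q := snd z) \<in> cube (Suc q)" "y(q := snd z) \<in> cube (Suc q)"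
      using xy by (simp_all only: cube_upd)
    then show "p (case (z, x) of (z, x) \<Rightarrow> fst z (x(q := snd z))) = p (case (z, y) of (z, x) \<Rightarrow> fst z (x(q := snd z)))"
      unfolding prod.case using \<phi> by (intro cube_maps_fibrewise)
  qed
  then show ?thesis
    by (simp add: cube_slice_def case_prod_unfold)
qed

text \<open>Each face must vanish by itself, not merely in an alternating sum. The last coordinate
  can then be integrated out alone: both ends of the prism vanish and the remaining faces stay
  zero.\<close>

definition cube_normalized :: "nat \<Rightarrow> nat \<Rightarrow> ((nat \<Rightarrow> real) \<Rightarrow> 'e) chain \<Rightarrow> bool" where
  "cube_normalized q n w \<longleftrightarrow> (\<forall>j<q. \<forall>\<epsilon>\<in>{0, 1}. chain_map n (cube_face q j \<epsilon>) w = 0)"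

lemma cube_normalizedD:
  "cube_normalized q n w \<Longrightarrow> j < q \<Longrightarrow> \<epsilon> \<in> {0, 1} \<Longrightarrow> chain_map n (cube_face q j \<epsilon>) w = 0"
  unfolding cube_normalized_def by blast

text \<open>Taking faces in the first \<open>q\<close> directions commutes with slicing the last
  one, so naturality of the prism applies. Direction \<open>q\<close> is left unconstrained in order
  to cover chains of homotopies, whose two ends are nonzero in general.\<close>

lemma cube_normalized_prism_slice:
  assumes w: "singular_chain n (cube_maps E p (Suc q)) w"
    and N: "\<And>j \<epsilon>. j < q \<Longrightarrow> \<epsilon> \<in> {0, 1} \<Longrightarrow> chain_map n (cube_face (Suc q) j \<epsilon>) w = 0"
  shows "cube_normalized q (Suc n) (prism r n (cube_slice q) w)"
  unfolding cube_normalized_def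
proof (intro allI impI ballI)
  fix j and \<epsilon> :: real assume j: "j < q" and \<epsilon>: "\<epsilon> \<in> {0, 1}"
  let ?e = "\<lambda>(\<psi>, s). \<lambda>x\<in>{x \<in> cube q. x j = \<epsilon>}. \<psi> (x(q := s))"
  have "chain_map (Suc n) (cube_face q j \<epsilon>) (prism r n (cube_slice q) w)
      = prism r n ?e (chain_map n (cube_face (Suc q) j \<epsilon>) w)"
  proof (rule chain_map_prism[OF w])
    fix \<phi> and s :: real assume "s \<in> {0..1}"
    then show "cube_face q j \<epsilon> (cube_slice q (\<phi>, s)) = ?e (cube_face (Suc q) j \<epsilon> \<phi>, s)"
      using j by (auto simp: cube_face_def cube_slice_def fun_eq_iff cube_upd)
  qed
  also have "\<dots> = 0"
    by (simp add: N[OF j \<epsilon>])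
  finally show "chain_map (Suc n) (cube_face q j \<epsilon>) (prism r n (cube_slice q) w) = 0" .
qed

lemma chain_map_comp: "chain_map n g (chain_map n f c) = chain_map n (g \<circ> f) c"
  by (simp add: chain_map_compose)

lemma cube_normalized_end:
  assumes N: "cube_normalized (Suc q) n w" and \<epsilon>: "\<epsilon> \<in> {0, 1}"
  shows "chain_map n (\<lambda>\<phi>. cube_slice q (\<phi>, \<epsilon>)) w = 0"
proof -
  have eq: "(\<lambda>\<phi>. cube_slice q (\<phi>, \<epsilon>)) = (\<lambda>\<psi>. \<lambda>x\<in>cube q. \<psi> (x(q := \<epsilon>))) \<circ> cube_face (Suc q) q \<epsilon>"
    using \<epsilon> by (auto simp: cube_face_def cube_slice_def fun_eq_iff cube_upd)
  then show ?thesis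
    by (simp only: eq chain_map_comp[symmetric] cube_normalizedD[OF N lessI \<epsilon>] chain_map_0)
qed

text \<open>In direction \<open>q\<close> a face and the corresponding end slice carry the same
  information: the face at \<open>x\<close> is the slice at \<open>x(q := 0)\<close>.\<close>

lemma cube_normalized_endI:
  assumes "\<And>j \<epsilon>. j < q \<Longrightarrow> \<epsilon> \<in> {0, 1} \<Longrightarrow> chain_map n (cube_face (Suc q) j \<epsilon>) w = 0"
    and "\<And>\<epsilon>. \<epsilon> \<in> {0, 1} \<Longrightarrow> chain_map n (\<lambda>\<phi>. cube_slice q (\<phi>, \<epsilon>)) w = 0"
  shows "cube_normalized (Suc q) n w"
  unfolding cube_normalized_def
proof (intro allI impI ballI)
  fix j and \<epsilon> :: real assume j: "j < Suc q" and \<epsilon>: "\<epsilon> \<in> {0, 1}"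
  show "chain_map n (cube_face (Suc q) j \<epsilon>) w = 0"
  proof (cases "j = q")
    case True
    have "x(q := 0) \<in> cube q" if "x \<in> cube (Suc q)" for x
      using that by (auto simp: cube_def)
    then have eq: "cube_face (Suc q) q \<epsilon>
        = (\<lambda>\<psi>. \<lambda>x\<in>{x \<in> cube (Suc q). x q = \<epsilon>}. \<psi> (x(q := 0))) \<circ> (\<lambda>\<phi>. cube_slice q (\<phi>, \<epsilon>))"
      by (auto simp: cube_face_def cube_slice_def fun_eq_iff)
    then show ?thesis
      by (simp only: True eq chain_map_comp[symmetric] assms(2)[OF \<epsilon>] chain_map_0)
  qed (use assms(1) j \<epsilon> in auto)
qed

text \<open>An Eilenberg-Zilber map to the total space, one coordinate at a time: each prism trades
  the last cube coordinate for a simplex dimension, until the cube is a point.\<close>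

primrec cube_total :: "nat \<Rightarrow> nat \<Rightarrow> ((nat \<Rightarrow> real) \<Rightarrow> 'e) chain \<Rightarrow> 'e chain" where
  "cube_total 0 = (\<lambda>n. chain_map n (\<lambda>\<phi>. \<phi> (\<lambda>_. 0)))"
| "cube_total (Suc q) = (\<lambda>n w. cube_total q (Suc n) (prism 0 n (cube_slice q) w))"

lemma frag_cmul_uminus: "frag_cmul k (- a) = frag_cmul (- k) a"
  using frag_cmul_cmul[of k "-1" a] by simp

lemma prism_diff: "prism r n e (a - b) = prism r n e a - prism r n e b"
  by (simp add: prism_def prism_op_diff)

lemma cube_total_diff: "cube_total q n (a - b) = cube_total q n a - cube_total q n b"
  by (induction q arbitrary: n a b) (simp_all add: chain_map_diff prism_diff)

lemma cube_total_0 [simp]: "cube_total q n 0 = 0"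
  using cube_total_diff[of q n 0 0] by simp

lemma cube_total_minus: "cube_total q n (- a) = - cube_total q n a"
  using cube_total_diff[of q n 0 a] by simp

lemma singular_chain_cube_total:
  "singular_chain n (cube_maps E p q) w \<Longrightarrow> singular_chain (n + q) E (cube_total q n w)"
proof (induction q arbitrary: n w)
  case 0
  have "continuous_map (cube_maps E p 0) (prod_topology (cube_maps E p 0) (cube_space 0)) (\<lambda>\<phi>. (\<phi>, \<lambda>_. 0))"
    by (auto simp: continuous_map_pairwise o_def zero_in_cube)
  from continuous_map_compose[OF this continuous_map_from_cube_maps[OF continuous_map_id]]
  have "continuous_map (cube_maps E p 0) E (\<lambda>\<phi>. \<phi> (\<lambda>_. 0))"
    by (simp add: o_def)
  then show ?case
    using 0 by (simp add: singular_chain_chain_map)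
next
  case (Suc q)
  then show ?case
    using Suc.IH[OF singular_chain_prism[OF continuous_map_cube_slice Suc.prems]] by simp
qed

text \<open>Normalization kills both ends of each prism, so what survives is minus the prism over
  the boundary. The \<open>q\<close> prisms together give the sign \<open>(-1) ^ q\<close>.\<close>

lemma chain_boundary_cube_total:
  assumes "singular_chain n (cube_maps E p q) w" "cube_normalized q n w"
  shows "chain_boundary (n + q) (cube_total q n w)
    = (if n = 0 then 0 else frag_cmul ((-1) ^ q) (cube_total q (n - Suc 0) (chain_boundary n w)))"
  using assms
proof (induction q arbitrary: n w)
  case 0
  then show ?case
    using chain_boundary_chain_map[OF 0(1)] by (auto simp: chain_boundary_def[of 0])
next
  case (Suc q)
  let ?D = "prism 0 n (cube_slice q) w"
  have bD: "chain_boundary (Suc n) ?D = - prism 0 (n - Suc 0) (cube_slice q) (chain_boundary n w)"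
    using chain_boundary_prism[OF continuous_map_cube_slice Suc.prems(1), of 0]
      cube_normalized_end[OF Suc.prems(2)] by simp
  have "chain_boundary (Suc n + q) (cube_total q (Suc n) ?D) = frag_cmul ((-1) ^ q) (cube_total q n (chain_boundary (Suc n) ?D))"
    using Suc.IH[OF singular_chain_prism[OF continuous_map_cube_slice Suc.prems(1)]
        cube_normalized_prism_slice[OF Suc.prems(1)]] cube_normalizedD[OF Suc.prems(2)] by simp
  also have "\<dots> = (if n = 0 then 0 else frag_cmul ((-1) ^ Suc q) (cube_total (Suc q) (n - Suc 0) (chain_boundary n w)))"
    unfolding bD by (cases n) (auto simp: cube_total_minus chain_boundary_def[of 0] frag_cmul_uminus)
  finally show ?case by simp
qed

lemma chain_map_cube_total:
  "singular_chain n (cube_maps E p q) w \<Longrightarrow>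
    chain_map (n + q) u (cube_total q n w) = cube_total q n (chain_map n (cube_act q u) w)"
proof (induction q arbitrary: n w)
  case 0
  have "u \<circ> (\<lambda>\<phi>. \<phi> (\<lambda>_. 0)) = (\<lambda>\<phi>. \<phi> (\<lambda>_. 0)) \<circ> cube_act 0 u"
    by (auto simp: cube_act_def zero_in_cube)
  then show ?case by (simp add: chain_map_comp)
next
  case (Suc q)
  have "chain_map (Suc n) (cube_act q u) (prism 0 n (cube_slice q) w)
      = prism 0 n (cube_slice q) (chain_map n (cube_act (Suc q) u) w)"
    by (rule chain_map_prism[OF Suc.prems]) (auto simp: cube_act_def cube_slice_def cube_upd)
  then show ?case
    using Suc.IH[OF singular_chain_prism[OF continuous_map_cube_slice Suc.prems], of 0] by simp
qed

section \<open>Endomorphisms acting unipotently on homology, and the step lowering the base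
  degree\<close>

text \<open>Some power of \<open>1 - u\<close> annihilates the homology class of \<open>z\<close>.\<close>

inductive unipotent_cycle :: "'e topology \<Rightarrow> ('e \<Rightarrow> 'e) \<Rightarrow> nat \<Rightarrow> 'e chain \<Rightarrow> bool"
  for E u m where
  boundary: "singular_relboundary m E {} z \<Longrightarrow> unipotent_cycle E u m z"
| step: "unipotent_cycle E u m z' \<Longrightarrow> singular_relcycle m E {} z \<Longrightarrow>
    homologous_rel m E {} (z - chain_map m u z) z' \<Longrightarrow> unipotent_cycle E u m z"

lemma unipotent_cycle_minus:
  "unipotent_cycle E u m z \<Longrightarrow> unipotent_cycle E u m (- z)"
proof (induction rule: unipotent_cycle.induct)
  case (boundary z)
  then show ?case
    by (intro unipotent_cycle.boundary) (simp add: singular_relboundary_minus)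
next
  case (step z' z)
  have "homologous_rel m E {} (0 - (z - chain_map m u z)) (0 - z')"
    by (intro homologous_rel_diff step) simp
  then have "homologous_rel m E {} (- z - chain_map m u (- z)) (- z')"
    by (simp add: chain_map_minus)
  then show ?case
    using step by (intro unipotent_cycle.step[OF step.IH]) (simp_all add: singular_relcycle_minus)
qed

text \<open>If the image of \<open>z\<close> under \<open>u\<close> bounds, then \<open>z\<close> is
  homologous to \<open>z'\<close>. Hence the image of \<open>z'\<close> bounds too, and the
  induction hypothesis shows that \<open>z'\<close>, and so \<open>z\<close>, bounds.\<close>

lemma unipotent_cycle_injective:
  assumes "unipotent_cycle E u m z" "continuous_map E E u" "singular_relboundary m E {} (chain_map m u z)"
  shows "singular_relboundary m E {} z"
  using assms(1,3)
proof (induction rule: unipotent_cycle.induct)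
  case (step z' z)
  have z': "homologous_rel m E {} z z'"
    using homologous_rel_add[OF step.hyps(3), of "chain_map m u z" 0] step.prems
    by (simp add: homologous_rel_def)
  then have "singular_relboundary m E {} (chain_map m u (z - z'))"
    using assms(2) unfolding homologous_rel_def by (intro singular_relboundary_chain_map) auto
  then have "singular_relboundary m E {} (chain_map m u z')"
    using singular_relboundary_diff[OF step.prems, of "chain_map m u (z - z')"] by (simp add: chain_map_diff)
  then have "singular_relboundary m E {} z'"
    by (rule step.IH)
  then show ?case
    using z' unfolding homologous_rel_def by (metis diff_add_cancel singular_relboundary_add)
qed auto

text \<open>The preimage is the finite geometric series inverting \<open>u = 1 - (1 - u)\<close>: if
  \<open>y\<close> serves for \<open>z'\<close>, then \<open>y + z\<close> serves for
  \<open>z\<close>.\<close>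

lemma unipotent_cycle_surjective:
  assumes "unipotent_cycle E u m z" "continuous_map E E u"
  shows "\<exists>y. singular_relcycle m E {} y \<and> homologous_rel m E {} z (chain_map m u y)"
  using assms(1)
proof (induction rule: unipotent_cycle.induct)
  case (boundary z)
  then show ?case
    by (intro exI[of _ 0]) (simp add: homologous_rel_def)
next
  case (step z' z)
  then obtain y where y: "singular_relcycle m E {} y" "homologous_rel m E {} z' (chain_map m u y)"
    by blast
  have "homologous_rel m E {} (z - chain_map m u z) (chain_map m u y)"
    by (rule homologous_rel_trans[OF y(2) step.hyps(3)])
  from homologous_rel_add[OF this homologous_rel_refl, of "chain_map m u z"]
  have "homologous_rel m E {} z (chain_map m u (y + z))"
    by (simp add: chain_map_add)
  then show ?case
    using y(1) step.hyps(2) singular_relcycle_add by blast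
qed

text \<open>\<open>W\<close> is a homotopy from the subdivided \<open>w\<close> to its image under
  \<open>u\<close>, built simplex by simplex and so usually with a boundary of its own. Up to a
  boundary, the total class of \<open>w\<close> minus its image under \<open>u\<close> is therefore
  minus the total class of \<open>chain_boundary n W\<close>, a cycle of \<open>Suc q\<close>-cubes
  in base degree \<open>n - 1\<close>, to which \<open>IH\<close> applies.\<close>

lemma unipotent_cycle_cube_total_step:
  assumes w: "singular_chain n (cube_maps E p q) w" "chain_boundary n w = 0" and N: "cube_normalized q n w"
    and W: "singular_chain n (cube_maps E p (Suc q)) W"
    and Wf: "\<And>j \<epsilon>. j < q \<Longrightarrow> \<epsilon> \<in> {0, 1} \<Longrightarrow> chain_map n (cube_face (Suc q) j \<epsilon>) W = 0"
    and W0: "chain_map n (\<lambda>\<phi>. cube_slice q (\<phi>, 0)) W = iterated_subdivision r n w"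
    and W1: "chain_map n (\<lambda>\<phi>. cube_slice q (\<phi>, 1)) W = chain_map n (cube_act q u) (iterated_subdivision r n w)"
    and u: "continuous_map E E u"
    and IH: "\<And>w'. n > 0 \<Longrightarrow> singular_chain (n - Suc 0) (cube_maps E p (Suc q)) w' \<Longrightarrow>
      chain_boundary (n - Suc 0) w' = 0 \<Longrightarrow> cube_normalized (Suc q) (n - Suc 0) w' \<Longrightarrow>
      unipotent_cycle E u (n + q) (cube_total (Suc q) (n - Suc 0) w')"
  shows "unipotent_cycle E u (n + q) (cube_total q n w)"
proof -
  define S where "S = iterated_subdivision r n w"
  define \<Theta> where "\<Theta> = prism r n fst w"
  define D where "D = prism 0 n (cube_slice q) W"
  let ?X = "cube_maps E p q"
  have S: "singular_chain n ?X S"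
    unfolding S_def by (rule singular_chain_iterated_subdivision[OF w(1)])
  have \<Theta>: "singular_chain (Suc n) ?X \<Theta>"
    unfolding \<Theta>_def by (rule singular_chain_prism[OF continuous_map_fst w(1)])
  have N\<Theta>: "cube_normalized q (Suc n) \<Theta>"
    unfolding cube_normalized_def
  proof (intro allI impI ballI)
    fix j and \<epsilon> :: real assume "j < q" "\<epsilon> \<in> {0, 1}"
    moreover have "chain_map (Suc n) (cube_face q j \<epsilon>) \<Theta> = prism r n fst (chain_map n (cube_face q j \<epsilon>) w)"
      unfolding \<Theta>_def by (rule chain_map_prism[OF w(1)]) simp
    ultimately show "chain_map (Suc n) (cube_face q j \<epsilon>) \<Theta> = 0"
      using cube_normalizedD[OF N] by simp
  qed
  have b\<Theta>: "chain_boundary (Suc n) \<Theta> = w - S"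
    unfolding \<Theta>_def S_def
    using chain_boundary_prism[OF continuous_map_fst w(1), of r] w
      chain_map_id_gen[OF w(1), of "\<lambda>y. y"]
      chain_map_id_gen[OF singular_chain_iterated_subdivision[OF w(1), of r], of "\<lambda>y. y"] by simp
  \<comment> \<open>The sign \<open>(-1) ^ q\<close> in the boundary formula is its own inverse, so
    scaling the total chain by it removes it.\<close>
  have boundary_total: "singular_relboundary (n + q) E {} (cube_total q n (chain_boundary (Suc n) v))"
    if v: "singular_chain (Suc n) ?X v" "cube_normalized q (Suc n) v" for v
  proof -
    have "frag_cmul ((-1) ^ q) (chain_boundary (Suc n + q) (cube_total q (Suc n) v))
        = cube_total q n (chain_boundary (Suc n) v)"
      using chain_boundary_cube_total[OF v] by (simp flip: power_mult_distrib)
    then show ?thesis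
      using singular_chain_cube_total[OF v(1)]
      unfolding singular_boundary by (metis add_Suc chain_boundary_cmul singular_chain_cmul)
  qed
  have wS: "homologous_rel (n + q) E {} (cube_total q n w) (cube_total q n S)"
    using boundary_total[OF \<Theta> N\<Theta>] unfolding b\<Theta> homologous_rel_def by (simp add: cube_total_diff)
  have cw: "singular_relcycle (n + q) E {} (cube_total q n w)"
    using singular_chain_cube_total[OF w(1)] chain_boundary_cube_total[OF w(1) N] w(2) by (simp add: singular_cycle)
  have "homologous_rel (n + q) E {} (chain_map (n + q) u (cube_total q n w)) (chain_map (n + q) u (cube_total q n S))"
    using singular_relboundary_chain_map[OF wS[unfolded homologous_rel_def] u]
    by (simp add: homologous_rel_def chain_map_diff)
  with wS have 1: "homologous_rel (n + q) E {} (cube_total q n w - chain_map (n + q) u (cube_total q n w))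
      (cube_total q n S - chain_map (n + q) u (cube_total q n S))"
    by (rule homologous_rel_diff)
  have ND: "cube_normalized q (Suc n) D"
    unfolding D_def by (rule cube_normalized_prism_slice[OF W Wf])
  have "chain_boundary (Suc n) D = chain_map n (cube_act q u) S - S
      - prism 0 (n - Suc 0) (cube_slice q) (chain_boundary n W)"
    unfolding D_def S_def using chain_boundary_prism[OF continuous_map_cube_slice W, of 0] W0 W1 by simp
  then have "singular_relboundary (n + q) E {} (chain_map (n + q) u (cube_total q n S) - cube_total q n S
      - cube_total q n (prism 0 (n - Suc 0) (cube_slice q) (chain_boundary n W)))"
    using boundary_total[OF singular_chain_prism[OF continuous_map_cube_slice W] ND[unfolded D_def]]
    by (simp add: D_def cube_total_diff chain_map_cube_total[OF S])
  then have 2: "homologous_rel (n + q) E {} (cube_total q n S - chain_map (n + q) u (cube_total q n S))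
      (- cube_total q n (prism 0 (n - Suc 0) (cube_slice q) (chain_boundary n W)))"
    unfolding homologous_rel_def
    by (subst singular_relboundary_minus[symmetric]) (simp add: algebra_simps)
  have "unipotent_cycle E u (n + q) (- cube_total q n (prism 0 (n - Suc 0) (cube_slice q) (chain_boundary n W)))"
  proof (cases "n = 0")
    \<comment> \<open>Here the descent ends: \<open>W\<close> consists of 0-simplices and has no
      boundary, so the remaining class is zero.\<close>
    case True
    then show ?thesis
      by (intro unipotent_cycle.boundary) (simp add: chain_boundary_def)
  next
    case False
    have "unipotent_cycle E u (n + q) (cube_total (Suc q) (n - Suc 0) (chain_boundary n W))"
    proof (rule IH)
      have bm: "chain_map (n - Suc 0) g (chain_boundary n W) = chain_boundary n (chain_map n g W)" for g :: "((nat \<Rightarrow> real) \<Rightarrow> 'a) \<Rightarrow> (nat \<Rightarrow> real) \<Rightarrow> 'a"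
        by (simp only: chain_boundary_chain_map[OF W])
      have bS: "chain_boundary n S = 0"
        using chain_boundary_iterated_subdivision[OF w(1), of r] w(2)
        by (simp add: S_def)
      \<comment> \<open>The end slices of the mismatch are the boundary of \<open>S\<close> and the
        image of that boundary under \<open>u\<close>; both vanish because \<open>w\<close> is a
        cycle.\<close>
      show "cube_normalized (Suc q) (n - Suc 0) (chain_boundary n W)"
      proof (rule cube_normalized_endI)
        fix \<epsilon> :: real assume "\<epsilon> \<in> {0, 1}"
        then show "chain_map (n - Suc 0) (\<lambda>\<phi>. cube_slice q (\<phi>, \<epsilon>)) (chain_boundary n W) = 0"
          using W0 W1 bS chain_boundary_chain_map[OF S, of "cube_act q u"]
          unfolding bm S_def by auto
      qed (simp add: bm Wf)
    qed (use False chain_boundary_boundary[OF W] singular_chain_boundary[OF W] in auto)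
    then show ?thesis
      using False by (intro unipotent_cycle_minus) simp
  qed
  then show ?thesis
    by (rule unipotent_cycle.step[OF _ cw homologous_rel_trans[OF 2 1]])
qed

section \<open>Realizations of finite complexes\<close>

text \<open>The vertex type is left open because the gluing uses pairs of a face and a set of
  indices as vertices. Numbering by naturals happens only where the filtration is invoked.\<close>

definition finite_complex :: "'v set set \<Rightarrow> bool" where
  "finite_complex K \<longleftrightarrow> finite K \<and> (\<forall>S \<in> K. finite S \<and> S \<noteq> {}) \<and>
     (\<forall>S \<in> K. \<forall>T. T \<subseteq> S \<and> T \<noteq> {} \<longrightarrow> T \<in> K)"

definition complex_realization :: "'v set set \<Rightarrow> ('v \<Rightarrow> real) topology" where
  "complex_realization K = subtopology (powertop_real UNIV)
    {x. (\<forall>v. 0 \<le> x v) \<and> {v. x v \<noteq> 0} \<in> K \<and> (\<Sum>v | x v \<noteq> 0. x v) = 1}"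

lemma topspace_complex_realization:
  assumes "finite W" "\<Union>K \<subseteq> W"
  shows "topspace (complex_realization K)
    = {x. (\<forall>v. 0 \<le> x v) \<and> {v. x v \<noteq> 0} \<in> K \<and> (\<Sum>v\<in>W. x v) = 1}"
proof -
  have "(\<Sum>v | x v \<noteq> 0. x v) = (\<Sum>v\<in>W. x v)" if "{v. x v \<noteq> 0} \<in> K" for x :: "'a \<Rightarrow> real"
    by (rule sum.mono_neutral_left) (use that assms in auto)
  then show ?thesis
    by (auto simp: complex_realization_def)
qed

lemma realization_eq: "realization = complex_realization"
  by (simp add: fun_eq_iff realization_def complex_realization_def)

lemma finite_simplicial_complex_eq: "finite_simplicial_complex = finite_complex"
  by (simp add: fun_eq_iff finite_simplicial_complex_def finite_complex_def)

lemma continuous_map_into_realization: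
  assumes "\<And>v. continuous_map Z euclideanreal (\<lambda>z. f z v)"
    and "\<And>z. z \<in> topspace Z \<Longrightarrow> f z \<in> topspace (complex_realization K)"
  shows "continuous_map Z (complex_realization K) f"
  using assms unfolding complex_realization_def
  by (auto simp: continuous_map_in_subtopology continuous_map_componentwise_UNIV)

lemma continuous_map_realization_coordinate:
  "continuous_map (complex_realization K) euclideanreal (\<lambda>x. x v)"
  unfolding complex_realization_def
  by (intro continuous_map_from_subtopology continuous_map_product_projection) auto

definition deformable :: "'e topology \<Rightarrow> ('e \<Rightarrow> 'b) \<Rightarrow> (nat \<Rightarrow> 'e set) \<Rightarrow> 'z topology \<Rightarrow> bool" where
  "deformable E p F Z \<longleftrightarrow> (\<forall>f. continuous_map Z E f \<longrightarrow>
     (\<exists>k g. fibrewise_homotopic p Z E f g \<and> g ` topspace Z \<subseteq> F k))"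

lemma fibrewise_homotopic_cong:
  assumes "fibrewise_homotopic p X E f g"
    and "\<And>x. x \<in> topspace X \<Longrightarrow> f' x = f x" "\<And>x. x \<in> topspace X \<Longrightarrow> g' x = g x"
  shows "fibrewise_homotopic p X E f' g'"
  using assms unfolding fibrewise_homotopic_iff by simp

text \<open>Extend the map over \<open>M\<close> by precomposing with the retraction
  \<open>\<pi>\<close>, deform it there, and restrict along \<open>j\<close>.\<close>

lemma deformable_retract:
  assumes M: "deformable E p F M" and j: "continuous_map Z M j" and \<pi>: "continuous_map M Z \<pi>"
    and \<pi>j: "\<And>z. z \<in> topspace Z \<Longrightarrow> \<pi> (j z) = z"
  shows "deformable E p F Z"
  unfolding deformable_def
proof (intro allI impI)
  fix f assume "continuous_map Z E f"
  then have "continuous_map M E (f \<circ> \<pi>)"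
    by (rule continuous_map_compose[OF \<pi>])
  then obtain k g where g: "fibrewise_homotopic p M E (f \<circ> \<pi>) g" "g ` topspace M \<subseteq> F k"
    using M unfolding deformable_def by blast
  have "fibrewise_homotopic p Z E f (g \<circ> j)"
    by (rule fibrewise_homotopic_cong[OF fibrewise_homotopic_compose_right[OF g(1) j]]) (simp_all add: \<pi>j)
  moreover have "(g \<circ> j) ` topspace Z \<subseteq> F k"
    using g(2) continuous_map_funspace[OF j] by auto
  ultimately show "\<exists>k g. fibrewise_homotopic p Z E f g \<and> g ` topspace Z \<subseteq> F k"
    by blast
qed

text \<open>The product of a simplex with a realization is a retract of the realization of the complex on
  all pairs of vertices: the product coupling is a section of the map taking both marginals.\<close>

lemma deformable_simplex_times_realization:
  fixes K :: "'v set set"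
  assumes F: "fibrewise_filtration E p F" and K: "finite_complex K"
  shows "deformable E p F (prod_topology (simplex_space n) (complex_realization K))"
proof -
  define V where "V = \<Union>K"
  have V: "finite V"
    using K by (auto simp: V_def finite_complex_def)
  define P where "P = {..n} \<times> V"
  have P: "finite P"
    using V by (simp add: P_def)
  obtain e :: "nat \<times> 'v \<Rightarrow> nat" where e: "inj_on e P"
    using finite_imp_inj_to_nat_seg[OF P] by blast
  define d where "d = inv_into P e"
  have de: "d (e a) = a" if "a \<in> P" for a
    using that e by (simp add: d_def)
  \<comment> \<open>The first components may form any nonempty set of vertices, since all of
    \<open>{..n}\<close> spans the simplex; only the second components must span a simplex of
    \<open>K\<close>.\<close>
  define M where "M = (`) e ` {S. S \<subseteq> P \<and> S \<noteq> {} \<and> snd ` S \<in> K}"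
  have M: "finite_complex M"
    unfolding finite_complex_def
  proof (intro conjI ballI allI impI)
    show "finite M"
      unfolding M_def
      by (rule finite_imageI, rule finite_subset[of _ "Pow P"]) (use P in auto)
    fix S assume "S \<in> M"
    then obtain S' where S': "S = e ` S'" "S' \<subseteq> P" "S' \<noteq> {}" "snd ` S' \<in> K"
      by (auto simp: M_def)
    show "finite S" "S \<noteq> {}"
      using S'(3) finite_subset[OF S'(2) P] by (simp_all add: S'(1))
    fix T assume T: "T \<subseteq> S \<and> T \<noteq> {}"
    then obtain T' where T': "T' \<subseteq> S'" "T = e ` T'"
      unfolding S' by (meson subset_imageE)
    have "snd ` T' \<in> K"
      using K S'(4) T T' unfolding finite_complex_def by (metis image_is_empty image_mono)
    then show "T \<in> M"
      using T T' S' by (auto simp: M_def)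
  qed
  have tM: "topspace (complex_realization M)
    = {x. (\<forall>m. 0 \<le> x m) \<and> {m. x m \<noteq> 0} \<in> M \<and> (\<Sum>m\<in>e ` P. x m) = 1}"
    by (rule topspace_complex_realization) (use P in \<open>auto simp: M_def\<close>)
  have tK: "topspace (complex_realization K)
    = {x. (\<forall>v. 0 \<le> x v) \<and> {v. x v \<noteq> 0} \<in> K \<and> (\<Sum>v\<in>V. x v) = 1}"
    by (rule topspace_complex_realization[OF V]) (simp add: V_def)
  define j where "j = (\<lambda>(t, x). \<lambda>m. if m \<in> e ` P then t (fst (d m)) * x (snd (d m)) else 0 :: real)"
  define \<pi> where "\<pi> y = (\<lambda>i. if i \<le> n then \<Sum>v\<in>V. y (e (i, v)) else 0 :: real,
      \<lambda>v. if v \<in> V then \<Sum>i\<le>n. y (e (i, v)) else 0 :: real)" for y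
  let ?Z = "prod_topology (simplex_space n) (complex_realization K)"
  have sumP: "(\<Sum>m\<in>e ` P. y m) = (\<Sum>i\<le>n. \<Sum>v\<in>V. y (e (i, v)))" for y :: "nat \<Rightarrow> real"
    unfolding sum.reindex[OF e] by (simp add: P_def sum.cartesian_product case_prod_unfold)
  have je: "j (t, x) (e (i, v)) = t i * x v" if "i \<le> n" "v \<in> V" for t x i v
    using that de[of "(i, v)"] by (auto simp: j_def P_def)
  have jZ: "j (t, x) \<in> topspace (complex_realization M)"
    if t: "t \<in> standard_simplex n" and x: "x \<in> topspace (complex_realization K)" for t x
  proof -
    have x0: "0 \<le> x v" and xK: "{v. x v \<noteq> 0} \<in> K" and x1: "(\<Sum>v\<in>V. x v) = 1" for v
      using x by (auto simp: tK)
    have t0: "0 \<le> t i" and tn: "i > n \<Longrightarrow> t i = 0" and t1: "(\<Sum>i\<le>n. t i) = 1" for i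
      using t by (auto simp: standard_simplex_def)
    define S where "S = {i. t i \<noteq> 0} \<times> {v. x v \<noteq> 0}"
    have "\<exists>i. t i \<noteq> 0"
      using t1 by (metis (no_types, lifting) sum.neutral zero_neq_one)
    then obtain i0 where i0: "t i0 \<noteq> 0" ..
    have S3: "snd ` S = {v. x v \<noteq> 0}"
      unfolding S_def using i0 by (auto simp: image_iff)
    have "{v. x v \<noteq> 0} \<noteq> {}"
      using xK K unfolding finite_complex_def by blast
    then have S2: "S \<noteq> {}"
      unfolding S_def using i0 by blast
    have "{i. t i \<noteq> 0} \<subseteq> {..n}"
      using tn by (auto simp: not_less[symmetric])
    moreover have "{v. x v \<noteq> 0} \<subseteq> V"
      unfolding V_def using xK by (rule Union_upper)
    ultimately have S1: "S \<subseteq> P"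
      unfolding S_def P_def by (rule Sigma_mono)
    note S = S1 S2 S3
    have "{m. j (t, x) m \<noteq> 0} = e ` S"
    proof (intro Set.set_eqI iffI)
      fix m assume "m \<in> {m. j (t, x) m \<noteq> 0}"
      then obtain a where a: "a \<in> P" "m = e a" "t (fst a) * x (snd a) \<noteq> 0"
        by (auto simp: j_def de split: if_splits)
      then show "m \<in> e ` S"
        by (auto simp: S_def mem_Times_iff)
    next
      fix m assume "m \<in> e ` S"
      then obtain a where a: "a \<in> S" "m = e a" by blast
      then have "a \<in> P" "t (fst a) * x (snd a) \<noteq> 0"
        using S(1) by (auto simp: S_def)
      then show "m \<in> {m. j (t, x) m \<noteq> 0}"
        by (simp add: j_def de a(2))
    qed
    moreover have "(\<Sum>m\<in>e ` P. j (t, x) m) = 1"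
      by (simp add: sumP je t1 x1 flip: sum_distrib_left)
    moreover have "0 \<le> j (t, x) m" for m
      by (simp add: j_def t0 x0)
    ultimately show ?thesis
      unfolding tM using S xK by (auto simp: M_def)
  qed
  have j: "continuous_map ?Z (complex_realization M) j"
  proof (rule continuous_map_into_realization)
    fix m
    have 1: "continuous_map ?Z euclideanreal (\<lambda>z. fst z i)" for i
      by (intro continuous_map_compose[OF continuous_map_fst, unfolded o_def] continuous_map_from_subtopology
          continuous_map_product_projection) auto
    have 2: "continuous_map ?Z euclideanreal (\<lambda>z. snd z v)" for v
      by (rule continuous_map_compose[OF continuous_map_snd continuous_map_realization_coordinate, unfolded o_def])
    show "continuous_map ?Z euclideanreal (\<lambda>z. j z m)"
      by (cases "m \<in> e ` P") (simp_all add: j_def case_prod_unfold continuous_map_real_mult 1 2)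
  next
    fix z assume "z \<in> topspace ?Z"
    then show "j z \<in> topspace (complex_realization M)"
      using jZ[of "fst z" "snd z"] by (simp add: mem_Times_iff)
  qed
  have \<pi>Z: "\<pi> y \<in> topspace ?Z" if y: "y \<in> topspace (complex_realization M)" for y
  proof -
    have y0: "0 \<le> y m" and y1: "(\<Sum>i\<le>n. \<Sum>v\<in>V. y (e (i, v))) = 1" for m
      using y by (auto simp: tM sumP)
    have "{m. y m \<noteq> 0} \<in> M"
      using y by (simp add: tM)
    then obtain S where S: "S \<subseteq> P" "S \<noteq> {}" "snd ` S \<in> K" "{m. y m \<noteq> 0} = e ` S"
      by (auto simp: M_def)
    have "(\<Sum>v\<in>V. y (e (i, v))) \<le> 1" if "i \<le> n" for i
      unfolding y1[symmetric] using that y0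
      by (intro member_le_sum[of i "{..n}" "\<lambda>i. \<Sum>v\<in>V. y (e (i, v))"]) (auto intro: sum_nonneg)
    then have 1: "fst (\<pi> y) \<in> standard_simplex n"
      using y1 by (auto simp: standard_simplex_def \<pi>_def y0 sum_nonneg)
    have "(\<Sum>v\<in>V. snd (\<pi> y) v) = 1"
      using y1 by (simp add: \<pi>_def sum.swap[of _ V])
    \<comment> \<open>Nonnegative weights cannot cancel, so the marginal is nonzero exactly on the
      projection of the support.\<close>
    moreover have "{v. snd (\<pi> y) v \<noteq> 0} = snd ` S"
    proof (intro Set.set_eqI iffI)
      fix v assume "v \<in> {v. snd (\<pi> y) v \<noteq> 0}"
      then have v: "v \<in> V" "(\<Sum>i\<le>n. y (e (i, v))) \<noteq> 0"
        by (auto simp: \<pi>_def split: if_splits)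
      then obtain i where i: "i \<le> n" "y (e (i, v)) \<noteq> 0"
        by (metis (no_types, lifting) atMost_iff sum.neutral)
      then obtain a where a: "a \<in> S" "e (i, v) = e a"
        using S(4) by blast
      have "(i, v) = a"
        by (rule inj_onD[OF e a(2)]) (use i v a S(1) in \<open>auto simp: P_def\<close>)
      then show "v \<in> snd ` S"
        using a(1) by force
    next
      fix v assume "v \<in> snd ` S"
      then obtain i where iv: "(i, v) \<in> S" by force
      then have "y (e (i, v)) \<noteq> 0"
        using S(4) by blast
      moreover have "i \<le> n" "v \<in> V"
        using iv S(1) by (auto simp: P_def)
      ultimately show "v \<in> {v. snd (\<pi> y) v \<noteq> 0}"
        using y0 by (auto simp: \<pi>_def sum_nonneg_eq_0_iff)
    qed
    moreover have "0 \<le> snd (\<pi> y) v" for v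
      by (simp add: \<pi>_def y0 sum_nonneg)
    ultimately have "snd (\<pi> y) \<in> topspace (complex_realization K)"
      using S(3) by (simp add: tK)
    then show ?thesis
      using 1 by (simp add: mem_Times_iff)
  qed
  have \<pi>: "continuous_map (complex_realization M) ?Z \<pi>"
  proof -
    have "continuous_map (complex_realization M) euclideanreal (\<lambda>y. fst (\<pi> y) i)" for i
      by (cases "i \<le> n") (auto simp: \<pi>_def intro!: continuous_map_sum continuous_map_realization_coordinate V)
    then have 1: "continuous_map (complex_realization M) (simplex_space n) (fst \<circ> \<pi>)"
      using \<pi>Z by (auto simp: continuous_map_in_subtopology continuous_map_componentwise_UNIV mem_Times_iff)
    have "continuous_map (complex_realization M) euclideanreal (\<lambda>y. snd (\<pi> y) v)" for v
      by (cases "v \<in> V") (auto simp: \<pi>_def intro!: continuous_map_sum continuous_map_realization_coordinate)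
    then have "continuous_map (complex_realization M) (complex_realization K) (snd \<circ> \<pi>)"
      using \<pi>Z by (intro continuous_map_into_realization) (auto simp: mem_Times_iff)
    with 1 show ?thesis
      by (simp add: continuous_map_pairwise)
  qed
  show ?thesis
  proof (rule deformable_retract[OF _ j \<pi>])
    show "deformable E p F (complex_realization M)"
      using F M unfolding fibrewise_filtration_def deformable_def realization_eq finite_simplicial_complex_eq
      by blast
    fix z assume z: "z \<in> topspace ?Z"
    obtain t x where tx: "z = (t, x)" by (cases z)
    have x: "\<And>v. v \<notin> V \<Longrightarrow> x v = 0" "(\<Sum>v\<in>V. x v) = 1"
      using z by (auto simp: tx tK V_def)
    have t: "i > n \<Longrightarrow> t i = 0" "(\<Sum>i\<le>n. t i) = 1" for i
      using z by (auto simp: tx standard_simplex_def)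
    show "\<pi> (j z) = z"
      using x t by (auto simp: tx \<pi>_def je fun_eq_iff not_le simp flip: sum_distrib_left sum_distrib_right)
  qed
qed

section \<open>Layer functions and the barycentric subdivision of the cube\<close>

text \<open>The length of the set of levels \<open>\<theta>\<close> in \<open>[0, 1)\<close> whose strict superlevel set \<open>{a \<in> L. \<theta> < s a}\<close>
  is \<open>A\<close>; the identities below are the layer cake formula.\<close>

definition layer :: "'a set \<Rightarrow> ('a \<Rightarrow> real) \<Rightarrow> 'a set \<Rightarrow> real" where
  "layer L s A = max 0 (Min (insert 1 (s ` A)) - Max (insert 0 (s ` (L - A))))"

lemma layer_nonneg: "0 \<le> layer L s A"
  by (simp add: layer_def)

lemma Max_insert_image:
  fixes s :: "'a \<Rightarrow> real"
  assumes "finite S"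
  shows "Max (insert c (s ` insert a S)) = max (s a) (Max (insert c (s ` S)))"
  unfolding image_insert by (subst insert_commute, rule Max_insert) (use assms in auto)

lemma Min_insert_image:
  fixes s :: "'a \<Rightarrow> real"
  assumes "finite S"
  shows "Min (insert c (s ` insert a S)) = min (s a) (Min (insert c (s ` S)))"
  unfolding image_insert by (subst insert_commute, rule Min_insert) (use assms in auto)

text \<open>The level \<open>s a\<close> cuts the interval of levels belonging to \<open>A\<close>
  in two: below it the superlevel set contains \<open>a\<close>, from it upwards it does
  not.\<close>

lemma layer_insert:
  assumes L: "finite L" "a \<notin> L" and A: "A \<subseteq> L"
  shows "layer (insert a L) s A + layer (insert a L) s (insert a A) = layer L s A"
proof -
  have fin: "finite A" "finite (L - A)"
    using finite_subset[OF A L(1)] L(1) by simp_all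
  have 1: "insert a L - A = insert a (L - A)" "insert a L - insert a A = L - A"
    using assms by auto
  have 2: "Max (insert 0 (s ` insert a (L - A))) = max (s a) (Max (insert 0 (s ` (L - A))))"
    by (rule Max_insert_image[OF fin(2)])
  have 3: "Min (insert 1 (s ` insert a A)) = min (s a) (Min (insert 1 (s ` A)))"
    by (rule Min_insert_image[OF fin(1)])
  show ?thesis
    unfolding layer_def 1 2 3 by (simp add: max_def min_def)
qed

lemma sum_Pow_insert:
  assumes "finite L" "a \<notin> L"
  shows "(\<Sum>A\<in>Pow (insert a L). f A) = (\<Sum>A\<in>Pow L. f A + f (insert a A) :: real)"
proof -
  have inj: "inj_on (insert a) (Pow L)"
    using assms(2) by (auto simp: inj_on_def)
  have "(\<Sum>A\<in>Pow (insert a L). f A) = (\<Sum>A\<in>Pow L. f A) + (\<Sum>A\<in>insert a ` Pow L. f A)"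
    unfolding Pow_insert using assms by (intro sum.union_disjoint) auto
  then show ?thesis
    by (simp add: sum.reindex[OF inj] sum.distrib)
qed

lemma sum_layer:
  assumes "finite L"
  shows "(\<Sum>A\<in>Pow L. layer L s A) = 1"
  using assms
proof (induction rule: finite_induct)
  case empty
  then show ?case by (simp add: layer_def)
next
  case (insert a L)
  have "(\<Sum>A\<in>Pow (insert a L). layer (insert a L) s A) = (\<Sum>A\<in>Pow L. layer L s A)"
    unfolding sum_Pow_insert[OF insert.hyps]
    by (rule sum.cong) (use layer_insert insert.hyps in auto)
  then show ?case
    using insert.IH by simp
qed

text \<open>The superlevel set contains \<open>l\<close> exactly at the levels in
  \<open>[0, s l)\<close>. The proof discards the elements other than \<open>l\<close> one at a time
  by \<open>layer_insert\<close>.\<close>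

lemma sum_layer_mem:
  assumes "finite L" "l \<in> L" "0 \<le> s l" "s l \<le> 1"
  shows "(\<Sum>A\<in>Pow L. if l \<in> A then layer L s A else 0) = s l"
proof -
  have "(\<Sum>A\<in>Pow L'. layer (insert l L') s (insert l A)) = s l" if "finite L'" "l \<notin> L'" for L'
    using that
  proof (induction rule: finite_induct)
    case empty
    then show ?case using assms by (simp add: layer_def)
  next
    case (insert a L')
    have "layer (insert l (insert a L')) s (insert l A) + layer (insert l (insert a L')) s (insert l (insert a A))
        = layer (insert l L') s (insert l A)" if "A \<in> Pow L'" for A
    proof -
      have "a \<noteq> l" "insert l A \<subseteq> insert l L'"
        using insert.prems that by auto
      then have "layer (insert a (insert l L')) s (insert l A) + layer (insert a (insert l L')) s (insert a (insert l A))
          = layer (insert l L') s (insert l A)"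
        using insert.hyps by (intro layer_insert) auto
      then show ?thesis
        by (simp only: insert_commute[of a l])
    qed
    then have "(\<Sum>A\<in>Pow (insert a L'). layer (insert l (insert a L')) s (insert l A))
        = (\<Sum>A\<in>Pow L'. layer (insert l L') s (insert l A))"
      unfolding sum_Pow_insert[OF insert.hyps] by (intro sum.cong) auto
    then show ?case
      using insert by simp
  qed
  from this[of "L - {l}"] have 1: "(\<Sum>A\<in>Pow (L - {l}). layer L s (insert l A)) = s l"
    using assms by (simp add: insert_absorb)
  have 2: "(\<Sum>A\<in>Pow (insert l (L - {l})). if l \<in> A then layer L s A else 0)
      = (\<Sum>A\<in>Pow (L - {l}). layer L s (insert l A))"
  proof (subst sum_Pow_insert)
    show "(\<Sum>A\<in>Pow (L - {l}). (if l \<in> A then layer L s A else 0)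
        + (if l \<in> insert l A then layer L s (insert l A) else 0)) = (\<Sum>A\<in>Pow (L - {l}). layer L s (insert l A))"
    proof (rule sum.cong[OF refl])
      fix A assume "A \<in> Pow (L - {l})"
      then have "l \<notin> A" by blast
      then show "(if l \<in> A then layer L s A else 0) + (if l \<in> insert l A then layer L s (insert l A) else 0)
          = layer L s (insert l A)"
        by simp
    qed
  qed (use assms(1) in simp_all)
  have 3: "insert l (L - {l}) = L"
    using assms by blast
  show ?thesis
    using 2 unfolding 1 3 .
qed

lemma layer_nonzeroD:
  assumes "finite L" "A \<subseteq> L" "layer L s A \<noteq> 0"
  shows "a \<in> A \<Longrightarrow> 0 < s a"
    and "b \<in> L - A \<Longrightarrow> s b < 1"
    and "a \<in> A \<Longrightarrow> b \<in> L - A \<Longrightarrow> s b < s a"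
proof -
  have fin: "finite A" "finite (L - A)"
    using finite_subset[OF assms(2,1)] assms(1) by simp_all
  have less: "Max (insert 0 (s ` (L - A))) < Min (insert 1 (s ` A))"
  proof (rule ccontr)
    assume "\<not> Max (insert 0 (s ` (L - A))) < Min (insert 1 (s ` A))"
    then have "layer L s A = 0"
      unfolding layer_def by (intro max_absorb1) linarith
    with assms(3) show False ..
  qed
  have "x < y" if "x \<in> insert 0 (s ` (L - A))" "y \<in> insert 1 (s ` A)" for x y
  proof -
    have "x \<le> Max (insert 0 (s ` (L - A)))"
      using that fin by (intro Max_ge) auto
    moreover have "Min (insert 1 (s ` A)) \<le> y"
      using that fin by (intro Min_le) auto
    ultimately show ?thesis
      using less by linarith
  qed
  then show "a \<in> A \<Longrightarrow> 0 < s a" "b \<in> L - A \<Longrightarrow> s b < 1" "a \<in> A \<Longrightarrow> b \<in> L - A \<Longrightarrow> s b < s a"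
    by blast+
qed

lemma continuous_map_layer:
  assumes L: "finite L" "A \<subseteq> L" and s: "\<And>a. a \<in> L \<Longrightarrow> continuous_map X euclideanreal (\<lambda>x. s x a)"
  shows "continuous_map X euclideanreal (\<lambda>x. layer L (s x) A)"
proof -
  have mn: "continuous_map X euclideanreal (\<lambda>x. Min (insert c (s x ` S)))"
    and mx: "continuous_map X euclideanreal (\<lambda>x. Max (insert c (s x ` S)))"
    if "S \<subseteq> L" for c S
  proof -
    have "finite S"
      using that L(1) by (rule finite_subset)
    then show "continuous_map X euclideanreal (\<lambda>x. Min (insert c (s x ` S)))"
      using that
    proof (induction rule: finite_induct)
      case (insert a S)
      have "Min (insert c (s x ` insert a S)) = min (s x a) (Min (insert c (s x ` S)))" for x
        by (rule Min_insert_image[OF insert.hyps(1)])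
      then show ?case
        using insert s by (simp add: continuous_map_real_min)
    qed simp
    from \<open>finite S\<close> show "continuous_map X euclideanreal (\<lambda>x. Max (insert c (s x ` S)))"
      using that
    proof (induction rule: finite_induct)
      case (insert a S)
      have "Max (insert c (s x ` insert a S)) = max (s x a) (Max (insert c (s x ` S)))" for x
        by (rule Max_insert_image[OF insert.hyps(1)])
      then show ?case
        using insert s by (simp add: continuous_map_real_max)
    qed simp
  qed
  show ?thesis
    unfolding layer_def
    by (intro continuous_map_real_max continuous_map_diff mn mx) (use L in auto)
qed

text \<open>A face of the cube is encoded by the set of pairs \<open>(i, b)\<close> such that the coordinate \<open>i\<close>
  is fixed to \<open>1\<close> (if \<open>b\<close>) or to \<open>0\<close> (otherwise).\<close>

definition cube_subface :: "nat \<Rightarrow> (nat \<times> bool) set \<Rightarrow> (nat \<Rightarrow> real) set" where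
  "cube_subface q A = {x \<in> cube q. \<forall>(i, b)\<in>A. x i = (if b then 1 else 0)}"

text \<open>The weight of a literal is 1 on its facet of the cube and falls linearly to 0 at the
  midplane \<open>x i = 1/2\<close>. The layers of these weights are the barycentric coordinates in
  the subdivided cube.\<close>

definition cube_weight :: "(nat \<Rightarrow> real) \<Rightarrow> nat \<times> bool \<Rightarrow> real" where
  "cube_weight x = (\<lambda>(i, b). max 0 (if b then 2 * x i - 1 else 1 - 2 * x i))"

text \<open>For consistent \<open>A\<close> this is the barycentre of the face. The additive form is
  linear in the indicators of the two literals, so that \<open>sum_layer_mem\<close> applies to
  each.\<close>

definition face_centre :: "(nat \<times> bool) set \<Rightarrow> nat \<Rightarrow> real" where
  "face_centre A i = 1/2 + (if (i, True) \<in> A then 1/2 else 0) - (if (i, False) \<in> A then 1/2 else 0)"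

abbreviation cube_literals :: "nat \<Rightarrow> (nat \<times> bool) set" where
  "cube_literals q \<equiv> {..<q} \<times> UNIV"

abbreviation cube_layer :: "nat \<Rightarrow> (nat \<Rightarrow> real) \<Rightarrow> (nat \<times> bool) set \<Rightarrow> real" where
  "cube_layer q x A \<equiv> layer (cube_literals q) (cube_weight x) A"

definition consistent :: "(nat \<times> bool) set \<Rightarrow> bool" where
  "consistent A \<longleftrightarrow> (\<forall>i. \<not> ((i, True) \<in> A \<and> (i, False) \<in> A))"

lemma cube_weight_bounds:
  assumes "x \<in> cube q" "a \<in> cube_literals q"
  shows "0 \<le> cube_weight x a" "cube_weight x a \<le> 1"
  using assms by (auto simp: cube_weight_def cube_def)

text \<open>Expanding \<open>face_centre\<close> into indicators leaves half of 1 plus the weight of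
  \<open>(i, True)\<close> minus the weight of \<open>(i, False)\<close>, which is
  \<open>x i\<close> on either side of the midplane.\<close>

lemma cube_layer_barycentre:
  assumes x: "x \<in> cube q" and i: "i < q"
  shows "(\<Sum>A\<in>Pow (cube_literals q). cube_layer q x A * face_centre A i) = x i"
proof -
  let ?L = "cube_literals q"
  have fin: "finite ?L" by simp
  have S: "(\<Sum>A\<in>Pow ?L. if (i, b) \<in> A then cube_layer q x A else 0) = cube_weight x (i, b)" for b
    by (rule sum_layer_mem[OF fin]) (use i cube_weight_bounds[OF x, of "(i, b)"] in auto)
  have "(\<Sum>A\<in>Pow ?L. cube_layer q x A * face_centre A i)
      = (\<Sum>A\<in>Pow ?L. 1/2 * cube_layer q x A + 1/2 * (if (i, True) \<in> A then cube_layer q x A else 0)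
          - 1/2 * (if (i, False) \<in> A then cube_layer q x A else 0))"
    by (rule sum.cong) (auto simp: face_centre_def algebra_simps)
  also have "\<dots> = 1/2 + 1/2 * cube_weight x (i, True) - 1/2 * cube_weight x (i, False)"
    unfolding sum_subtractf sum.distrib sum_distrib_left[symmetric] S sum_layer[OF fin] by simp
  also have "\<dots> = x i"
    by (auto simp: cube_weight_def max_def field_simps)
  finally show ?thesis .
qed

text \<open>Sets with nonzero layer are superlevel sets of a single function, hence nested. Opposite
  literals never both have positive weight, and on a facet its literal has weight 1, above every
  level in \<open>[0, 1)\<close>.\<close>

lemma cube_layer_nonzero:
  assumes x: "x \<in> cube q" and A: "A \<subseteq> cube_literals q" "cube_layer q x A \<noteq> 0"
  shows "consistent A" and "A' \<subseteq> cube_literals q \<Longrightarrow> cube_layer q x A' \<noteq> 0 \<Longrightarrow> A \<subseteq> A' \<or> A' \<subseteq> A"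
    and "i < q \<Longrightarrow> x i = (if b then 1 else 0) \<Longrightarrow> (i, b) \<in> A"
proof -
  have fin: "finite (cube_literals q)" by simp
  note D = layer_nonzeroD[OF fin A]
  show "consistent A"
    unfolding consistent_def
  proof (intro allI notI, elim conjE)
    fix i assume "(i, True) \<in> A" "(i, False) \<in> A"
    from D(1)[OF this(1)] D(1)[OF this(2)] show False
      by (auto simp: cube_weight_def)
  qed
  show "A \<subseteq> A' \<or> A' \<subseteq> A" if A': "A' \<subseteq> cube_literals q" "cube_layer q x A' \<noteq> 0"
  proof (rule ccontr)
    assume "\<not> (A \<subseteq> A' \<or> A' \<subseteq> A)"
    then obtain a b where "a \<in> A" "a \<notin> A'" "b \<in> A'" "b \<notin> A" by blast
    then show False
      using D(3)[of a b] layer_nonzeroD(3)[OF fin A', of b a] A(1) A'(1) by force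
  qed
  show "(i, b) \<in> A" if "i < q" "x i = (if b then 1 else 0)"
  proof (rule ccontr)
    assume "(i, b) \<notin> A"
    then have "cube_weight x (i, b) < 1"
      using D(2) that(1) by blast
    then show False
      using that(2) by (simp add: cube_weight_def split: if_splits)
  qed
qed

section \<open>Gluing cubes along equal faces\<close>

lemma finite_subset_family_complex:
  assumes "finite W" "\<And>S. S \<in> K \<Longrightarrow> S \<subseteq> W" "\<And>S. S \<in> K \<Longrightarrow> S \<noteq> {}"
    and "\<And>S T. S \<in> K \<Longrightarrow> T \<subseteq> S \<Longrightarrow> T \<noteq> {} \<Longrightarrow> T \<in> K"
  shows "finite_complex K"
  unfolding finite_complex_def
proof (intro conjI ballI allI impI)
  show "finite K"
    by (rule finite_subset[of K "Pow W"]) (use assms(1,2) in auto)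
  fix S assume S: "S \<in> K"
  show "finite S"
    using finite_subset[OF assms(2)[OF S] assms(1)] .
  show "S \<noteq> {}"
    using assms(3)[OF S] .
  show "T \<in> K" if "T \<subseteq> S \<and> T \<noteq> {}" for T
    using assms(4)[OF S] that by blast
qed

text \<open>The vertices of the complex are the faces \<open>A\<close> of the cube
  together with the class of indices whose maps agree on \<open>A\<close>, and the simplices are
  flags of faces of one of the maps, as in the barycentric subdivision of the cube.\<close>

lemma glue_cubes:
  fixes c :: "'j \<Rightarrow> 'a \<times> (nat \<Rightarrow> real) \<Rightarrow> 'e"
  assumes J: "finite J"
    and c: "\<And>j. j \<in> J \<Longrightarrow> continuous_map (prod_topology P (cube_space q)) E (c j)"
  obtains K :: "((nat \<times> bool) set \<times> 'j set) set set" and \<kappa> G where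
    "finite_complex K"
    "\<And>j. j \<in> J \<Longrightarrow> continuous_map (cube_space q) (complex_realization K) (\<kappa> j)"
    "continuous_map (prod_topology P (complex_realization K)) E G"
    "\<And>j t x. j \<in> J \<Longrightarrow> t \<in> topspace P \<Longrightarrow> x \<in> cube q \<Longrightarrow> G (t, \<kappa> j x) = c j (t, x)"
    "\<And>j j' i \<epsilon> x. j \<in> J \<Longrightarrow> j' \<in> J \<Longrightarrow> i < q \<Longrightarrow> \<epsilon> \<in> {0, 1} \<Longrightarrow>
       \<forall>t\<in>topspace P. \<forall>y\<in>cube q. y i = \<epsilon> \<longrightarrow> c j (t, y) = c j' (t, y) \<Longrightarrow>
       x \<in> cube q \<Longrightarrow> x i = \<epsilon> \<Longrightarrow> \<kappa> j x = \<kappa> j' x"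
    "\<And>y. y \<in> topspace (complex_realization K) \<Longrightarrow>
       \<exists>j\<in>J. \<exists>x\<in>cube q. \<forall>t\<in>topspace P. G (t, y) = c j (t, x)"
proof -
  define L where "L = cube_literals q"
  have L: "finite L" by (simp add: L_def)
  define label where "label A j = {j' \<in> J. \<forall>t\<in>topspace P. \<forall>x\<in>cube_subface q A. c j (t, x) = c j' (t, x)}" for A j
  define V where "V j A = (A, label A j)" for j A
  define Con where "Con = {A. A \<subseteq> L \<and> consistent A}"
  have Con: "finite Con"
    by (rule finite_subset[of _ "Pow L"]) (use L in \<open>auto simp: Con_def\<close>)
  define W where "W = Con \<times> Pow J"
  have W: "finite W"
    using Con J by (simp add: W_def)
  have lJ: "label A j \<subseteq> J" for A j
    by (auto simp: label_def)
  have VW: "V j A \<in> W" if "A \<in> Con" for j A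
    using that lJ by (simp add: V_def W_def)
  have injV: "inj_on (V j) S" for j S
    by (auto simp: V_def inj_on_def)
  define flag where "flag \<F> \<longleftrightarrow> \<F> \<subseteq> Con \<and> \<F> \<noteq> {} \<and> (\<forall>A\<in>\<F>. \<forall>A'\<in>\<F>. A \<subseteq> A' \<or> A' \<subseteq> A)" for \<F>
  define K where "K = {V j ` \<F> |j \<F>. j \<in> J \<and> flag \<F>}"
  have flag_mono: "flag \<F>'" if "flag \<F>" "\<F>' \<subseteq> \<F>" "\<F>' \<noteq> {}" for \<F> \<F>'
    unfolding flag_def
  proof (intro conjI ballI)
    have "\<F> \<subseteq> Con"
      using that by (simp add: flag_def)
    with that(2) show "\<F>' \<subseteq> Con"
      by (rule subset_trans)
    show "\<F>' \<noteq> {}"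
      by (rule that(3))
    show "A \<subseteq> A' \<or> A' \<subseteq> A" if "A \<in> \<F>'" "A' \<in> \<F>'" for A A'
      using \<open>flag \<F>\<close> subsetD[OF \<open>\<F>' \<subseteq> \<F>\<close>] that by (simp add: flag_def)
  qed
  have KW: "S \<subseteq> W" if "S \<in> K" for S
    using that VW by (auto simp: K_def flag_def)
  have K: "finite_complex K"
  proof (rule finite_subset_family_complex[OF W KW])
    fix S assume "S \<in> K"
    then show "S \<noteq> {}"
      by (auto simp: K_def flag_def)
  next
    fix S T assume S: "S \<in> K" and T: "T \<subseteq> S" "T \<noteq> {}"
    then obtain j \<F> where F: "S = V j ` \<F>" "j \<in> J" "flag \<F>"
      by (auto simp: K_def)
    obtain \<F>' where F': "\<F>' \<subseteq> \<F>" "T = V j ` \<F>'"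
      using T(1) unfolding F(1) by (meson subset_imageE)
    then have "flag \<F>'"
      using flag_mono[OF F(3)] T(2) by blast
    then show "T \<in> K"
      using F(2) F'(2) by (auto simp: K_def)
  qed
  let ?R = "complex_realization K"
  have tR: "topspace ?R = {y. (\<forall>v. 0 \<le> y v) \<and> {v. y v \<noteq> 0} \<in> K \<and> (\<Sum>v\<in>W. y v) = 1}"
    by (rule topspace_complex_realization[OF W]) (use KW in blast)
  \<comment> \<open>\<open>valid y j\<close> says that every vertex supporting \<open>y\<close> is a
    vertex of the cube with index \<open>j\<close>. Then \<open>loc y\<close> is the position of
    \<open>y\<close> in that cube, and \<open>\<kappa> j\<close> is the inverse parametrization by
    layers.\<close>
  define valid where "valid y j \<longleftrightarrow> j \<in> J \<and> (\<forall>v. y v \<noteq> 0 \<longrightarrow> snd v = label (fst v) j)"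
    for y :: "(nat \<times> bool) set \<times> 'j set \<Rightarrow> real" and j
  define loc where "loc y = (\<lambda>i. if i < q then \<Sum>v\<in>W. y v * face_centre (fst v) i else 0)"
    for y :: "(nat \<times> bool) set \<times> 'j set \<Rightarrow> real"
  define G where "G = (\<lambda>(t, y). c (SOME j. valid y j) (t, loc y))"
  define \<kappa> where "\<kappa> j x = (\<lambda>v. if fst v \<subseteq> L \<and> snd v = label (fst v) j then cube_layer q x (fst v) else 0)" for j x
  have centre: "0 \<le> face_centre A i" "face_centre A i \<le> 1" for A i
    by (auto simp: face_centre_def)
  have valid_ex: "\<exists>j. valid y j" if "y \<in> topspace ?R" for y
  proof -
    have "{v. y v \<noteq> 0} \<in> K"
      using that by (simp add: tR)
    then obtain j \<F> where F: "{v. y v \<noteq> 0} = V j ` \<F>" "j \<in> J"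
      unfolding K_def by blast
    have "snd v = label (fst v) j" if "y v \<noteq> 0" for v
    proof -
      have "v \<in> V j ` \<F>"
        using that F(1) by blast
      then show ?thesis
        by (auto simp: V_def)
    qed
    then have "valid y j"
      using F(2) by (simp add: valid_def)
    then show ?thesis ..
  qed
  have loc_cube: "loc y \<in> cube q" if y: "y \<in> topspace ?R" for y
  proof -
    have y0: "0 \<le> y v" and sum1: "(\<Sum>v\<in>W. y v) = 1" for v
      using y unfolding tR by blast+
    have "(\<Sum>v\<in>W. y v * face_centre (fst v) i) \<le> (\<Sum>v\<in>W. y v * 1)" for i
      by (intro sum_mono mult_left_mono centre y0)
    moreover have "0 \<le> (\<Sum>v\<in>W. y v * face_centre (fst v) i)" for i
      by (intro sum_nonneg mult_nonneg_nonneg centre y0)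
    ultimately show ?thesis
      using sum1 by (simp add: cube_def loc_def)
  qed
  text \<open>All faces in the support of \<open>y\<close> lie in the largest one, \<open>A0\<close>, where the maps of valid indices agree.\<close>
  have well_def: "c j (t, loc y) = c j' (t, loc y)"
    if y: "y \<in> topspace ?R" and j: "valid y j" "valid y j'" and t: "t \<in> topspace P" for y j j' t
  proof -
    have supp: "{v. y v \<noteq> 0} \<in> K" and y1: "(\<Sum>v\<in>W. y v) = 1"
      using y by (simp_all add: tR)
    then obtain j0 \<F> where F: "{v. y v \<noteq> 0} = V j0 ` \<F>" "flag \<F>"
      unfolding K_def by blast
    then have FC: "\<F> \<subseteq> Con" "\<F> \<noteq> {}" and chain: "\<And>A A'. A \<in> \<F> \<Longrightarrow> A' \<in> \<F> \<Longrightarrow> A \<subseteq> A' \<or> A' \<subseteq> A"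
      by (simp_all add: flag_def)
    have "finite \<F>"
      using FC(1) Con by (rule finite_subset)
    have FL: "A \<subseteq> L" "consistent A" if "A \<in> \<F>" for A
      using subsetD[OF FC(1) that] by (simp_all add: Con_def)
    from \<open>finite \<F>\<close> FC(2) obtain A0 where A0: "A0 \<in> \<F>" "\<And>A. A \<in> \<F> \<Longrightarrow> card A0 \<le> card A"
      using arg_min_if_finite(1)[of \<F> card] arg_min_least[of \<F> _ card] by blast
    have A0_le: "A0 \<subseteq> A" if "A \<in> \<F>" for A
    proof -
      have "finite A0"
        using FL(1)[OF A0(1)] L by (rule finite_subset)
      then show ?thesis
        using chain[OF A0(1) that] A0(2)[OF that] by (metis card_seteq order_refl)
    qed
    have "loc y \<in> cube_subface q A0"
      unfolding cube_subface_def
    proof (intro CollectI conjI loc_cube[OF y] ballI, clarify)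
      fix i b assume ib: "(i, b) \<in> A0"
      have "i < q"
        using ib FL(1)[OF A0(1)] by (auto simp: L_def)
      have "y v * face_centre (fst v) i = y v * (if b then 1 else 0)" for v
      proof (cases "y v = 0")
        case False
        then obtain A where A: "A \<in> \<F>" "v = V j0 A"
          using F(1) by blast
        then have "(i, b) \<in> A" "consistent A"
          using subsetD[OF A0_le[OF A(1)] ib] FL(2) by simp_all
        then show ?thesis
          using A(2) by (cases b) (auto simp: V_def face_centre_def consistent_def)
      qed simp
      then have "(\<Sum>v\<in>W. y v * face_centre (fst v) i) = (\<Sum>v\<in>W. y v) * (if b then 1 else 0)"
        by (simp only: sum_distrib_right)
      then show "loc y i = (if b then 1 else 0)"
        using \<open>i < q\<close> y1 by (simp add: loc_def)
    qed
    moreover have "j' \<in> label A0 j"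
    proof -
      have "y (V j0 A0) \<noteq> 0"
        using F(1) A0(1) by blast
      then have "label A0 j0 = label A0 j" "label A0 j0 = label A0 j'"
        using j unfolding valid_def V_def by (metis fst_conv snd_conv)+
      moreover have "j' \<in> label A0 j'"
        using j(2) by (simp add: label_def valid_def)
      ultimately show ?thesis by simp
    qed
    ultimately show ?thesis
      using t by (auto simp: label_def)
  qed
  have G_eq: "G (t, y) = c j (t, loc y)" if "y \<in> topspace ?R" "valid y j" "t \<in> topspace P" for t y j
    unfolding G_def using well_def[OF that(1) someI[of "valid y", OF that(2)] that(2,3)] by simp
  \<comment> \<open>This is used twice: constant \<open>g\<close> shows that the weights of
    \<open>\<kappa> j x\<close> add up to 1, and \<open>g\<close> a coordinate of the face centres
    shows that \<open>loc\<close> inverts \<open>\<kappa> j\<close>.\<close>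
  have sum_V: "(\<Sum>v\<in>W. \<kappa> j x v * g (fst v)) = (\<Sum>A\<in>Pow L. cube_layer q x A * g A)"
    if j: "j \<in> J" and x: "x \<in> cube q" for j x g
  proof -
    have "(\<Sum>v\<in>W. \<kappa> j x v * g (fst v)) = (\<Sum>v\<in>V j ` Con. \<kappa> j x v * g (fst v))"
    proof (rule sum.mono_neutral_right[OF W])
      show "V j ` Con \<subseteq> W"
        using VW by blast
      show "\<forall>v\<in>W - V j ` Con. \<kappa> j x v * g (fst v) = 0"
      proof
        fix v assume v: "v \<in> W - V j ` Con"
        then have "fst v \<in> Con"
          by (auto simp: W_def)
        then have "v \<noteq> V j (fst v)"
          using v by blast
        then show "\<kappa> j x v * g (fst v) = 0"
          by (auto simp: \<kappa>_def V_def prod_eq_iff)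
      qed
    qed
    also have "\<dots> = (\<Sum>A\<in>Con. cube_layer q x A * g A)"
      unfolding sum.reindex[OF injV] by (rule sum.cong) (auto simp: V_def \<kappa>_def Con_def)
    also have "\<dots> = (\<Sum>A\<in>Pow L. cube_layer q x A * g A)"
    proof (rule sum.mono_neutral_left)
      show "\<forall>A\<in>Pow L - Con. cube_layer q x A * g A = 0"
        using cube_layer_nonzero(1)[OF x] by (auto simp: Con_def L_def)
    qed (use L in \<open>auto simp: Con_def\<close>)
    finally show ?thesis .
  qed
  have \<kappa>R: "\<kappa> j x \<in> topspace ?R" if j: "j \<in> J" and x: "x \<in> cube q" for j x
  proof -
    let ?F = "{A. A \<subseteq> L \<and> cube_layer q x A \<noteq> 0}"
    have 1: "(\<Sum>v\<in>W. \<kappa> j x v) = 1"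
      using sum_V[OF j x, of "\<lambda>_. 1"] sum_layer[OF L] by (simp add: L_def)
    have supp: "{v. \<kappa> j x v \<noteq> 0} = V j ` ?F"
      by (auto simp: \<kappa>_def V_def image_iff split: if_splits)
    have "?F \<noteq> {}"
    proof
      assume "?F = {}"
      then have "\<kappa> j x v = 0" for v
        using supp by auto
      then show False
        using 1 by simp
    qed
    moreover have "A \<subseteq> A' \<or> A' \<subseteq> A" if "A \<in> ?F" "A' \<in> ?F" for A A'
      using cube_layer_nonzero(2)[OF x, of A A'] that by (simp add: L_def)
    moreover have "?F \<subseteq> Con"
      using cube_layer_nonzero(1)[OF x] by (auto simp: Con_def L_def)
    ultimately have "flag ?F"
      unfolding flag_def by blast
    then have "{v. \<kappa> j x v \<noteq> 0} \<in> K"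
      unfolding supp K_def using j by blast
    moreover have "0 \<le> \<kappa> j x v" for v
      by (simp add: \<kappa>_def layer_nonneg)
    ultimately show ?thesis
      using 1 by (simp add: tR)
  qed
  have loc_\<kappa>: "loc (\<kappa> j x) = x" if j: "j \<in> J" and x: "x \<in> cube q" for j x
  proof
    fix i
    show "loc (\<kappa> j x) i = x i"
    proof (cases "i < q")
      case True
      then show ?thesis
        using sum_V[OF j x, of "\<lambda>A. face_centre A i"] cube_layer_barycentre[OF x True]
        by (simp add: loc_def L_def)
    next
      case False
      then show ?thesis
        using x by (simp add: loc_def cube_def)
    qed
  qed
  have valid_\<kappa>: "valid (\<kappa> j x) j" if "j \<in> J" for j x
    using that by (auto simp: valid_def \<kappa>_def)
  have cont_loc: "continuous_map ?R (cube_space q) loc"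
  proof -
    have "continuous_map ?R euclideanreal (\<lambda>y. loc y i)" for i
      by (cases "i < q")
         (auto simp: loc_def intro!: continuous_map_sum W continuous_map_real_mult continuous_map_realization_coordinate)
    then show ?thesis
      using loc_cube by (auto simp: continuous_map_in_subtopology continuous_map_componentwise_UNIV)
  qed
  have cont_\<kappa>: "continuous_map (cube_space q) ?R (\<kappa> j)" if j: "j \<in> J" for j
  proof (rule continuous_map_into_realization)
    fix v :: "(nat \<times> bool) set \<times> 'j set"
    have "continuous_map (cube_space q) euclideanreal (\<lambda>x. cube_weight x a)" for a
    proof (cases a)
      case (Pair i b)
      have "continuous_map (cube_space q) euclideanreal (\<lambda>x. x i)"
        by (rule continuous_map_coordinate)
      then show ?thesis
        unfolding Pair cube_weight_def
        by (cases b) (simp_all, (intro continuous_map_real_max continuous_map_diff continuous_map_real_mult_left; simp)+)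
    qed
    then have "continuous_map (cube_space q) euclideanreal (\<lambda>x. cube_layer q x (fst v))" if "fst v \<subseteq> L"
      using that by (intro continuous_map_layer) (auto simp: L_def)
    then show "continuous_map (cube_space q) euclideanreal (\<lambda>x. \<kappa> j x v)"
      by (cases "fst v \<subseteq> L \<and> snd v = label (fst v) j") (simp_all add: \<kappa>_def)
  next
    fix x assume "x \<in> topspace (cube_space q)"
    then show "\<kappa> j x \<in> topspace ?R"
      using \<kappa>R[OF j] by simp
  qed
  have cont_G: "continuous_map (prod_topology P ?R) E G"
  \<comment> \<open>Validity for a fixed index means that certain coordinates vanish, a closed
    condition; the finitely many closed sets obtained cover the realization.\<close>
  proof (rule pasting_lemma_closed[OF J])
    fix j assume j: "j \<in> J"
    let ?T = "topspace P \<times> {y \<in> topspace ?R. valid y j}"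
    have eq: "{y \<in> topspace ?R. valid y j}
        = topspace ?R \<inter> \<Inter>(insert (topspace ?R) ((\<lambda>v. {y \<in> topspace ?R. y v \<in> {0}}) ` {v. snd v \<noteq> label (fst v) j}))"
    proof (rule Set.set_eqI)
      fix y
      show "y \<in> {y \<in> topspace ?R. valid y j} \<longleftrightarrow> y \<in> topspace ?R
          \<inter> \<Inter>(insert (topspace ?R) ((\<lambda>v. {y \<in> topspace ?R. y v \<in> {0}}) ` {v. snd v \<noteq> label (fst v) j}))"
        unfolding valid_def using j by blast
    qed
    have "closedin ?R {y \<in> topspace ?R. valid y j}"
      unfolding eq
    proof (intro closedin_Int closedin_topspace closedin_Inter)
      fix S assume "S \<in> insert (topspace ?R) ((\<lambda>v. {y \<in> topspace ?R. y v \<in> {0}}) ` {v. snd v \<noteq> label (fst v) j})"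
      moreover have "closedin ?R {y \<in> topspace ?R. y v \<in> {0}}" for v
        by (rule closedin_continuous_map_preimage[OF continuous_map_realization_coordinate]) simp
      ultimately show "closedin ?R S"
        by auto
    qed simp
    then show "closedin (prod_topology P ?R) ?T"
      by (simp add: closedin_prod_Times_iff)
    have "continuous_map (prod_topology P ?R) (prod_topology P (cube_space q)) (\<lambda>z. (fst z, loc (snd z)))"
      using continuous_map_compose[OF continuous_map_snd cont_loc, unfolded o_def, of P]
      by (simp add: continuous_map_pairwise o_def continuous_map_fst)
    from continuous_map_compose[OF this c[OF j]]
    show "continuous_map (subtopology (prod_topology P ?R) ?T) E (\<lambda>z. c j (fst z, loc (snd z)))"
      by (intro continuous_map_from_subtopology) (simp add: o_def)
  next
    fix i j z
    assume "i \<in> J" "j \<in> J"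
      "z \<in> topspace (prod_topology P ?R) \<inter> (topspace P \<times> {y \<in> topspace ?R. valid y i})
        \<inter> (topspace P \<times> {y \<in> topspace ?R. valid y j})"
    then show "c i (fst z, loc (snd z)) = c j (fst z, loc (snd z))"
      by (intro well_def) auto
  next
    fix z assume z: "z \<in> topspace (prod_topology P ?R)"
    then obtain j where j: "valid (snd z) j"
      using valid_ex[of "snd z"] by (auto simp: mem_Times_iff)
    have "j \<in> J"
      using j by (simp add: valid_def)
    moreover have "z \<in> topspace P \<times> {y \<in> topspace ?R. valid y j}"
      using z j by (simp add: mem_Times_iff)
    moreover have "G z = c j (fst z, loc (snd z))"
      using G_eq[of "snd z" j "fst z"] z j by (simp add: mem_Times_iff)
    ultimately show "\<exists>j. j \<in> J \<and> z \<in> topspace P \<times> {y \<in> topspace ?R. valid y j} \<and> G z = c j (fst z, loc (snd z))"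
      by blast
  qed
  show thesis
  proof (rule that[OF K cont_\<kappa> cont_G])
    fix j t x assume j: "j \<in> J" and t: "t \<in> topspace P" and x: "x \<in> cube q"
    show "G (t, \<kappa> j x) = c j (t, x)"
      using G_eq[OF \<kappa>R[OF j x] valid_\<kappa>[OF j] t] by (simp only: loc_\<kappa>[OF j x])
  next
    fix j j' i and \<epsilon> :: real and x
    assume j: "j \<in> J" "j' \<in> J" and i: "i < q" and \<epsilon>: "\<epsilon> \<in> {0, 1}"
      and eq: "\<forall>t\<in>topspace P. \<forall>y\<in>cube q. y i = \<epsilon> \<longrightarrow> c j (t, y) = c j' (t, y)"
      and x: "x \<in> cube q" "x i = \<epsilon>"
    \<comment> \<open>On the facet \<open>x i = \<epsilon>\<close> every set of literals with
      nonzero layer contains the literal of that facet. Its face thus lies in the region where the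
      two maps agree, and the labels coincide.\<close>
    have lab: "label A j = label A j'" if "A \<subseteq> L" "cube_layer q x A \<noteq> 0" for A
    proof -
      obtain b :: bool where b: "\<epsilon> = (if b then 1 else 0)"
        using \<epsilon> by (metis (full_types) empty_iff insert_iff)
      have "(i, b) \<in> A"
        using cube_layer_nonzero(3)[OF x(1) _ that(2) i, of b] that(1) x(2) b by (simp add: L_def)
      then have "y i = \<epsilon>" if "y \<in> cube_subface q A" for y
        using that b by (auto simp: cube_subface_def)
      then have "c j (t, y) = c j' (t, y)" if "t \<in> topspace P" "y \<in> cube_subface q A" for t y
        using eq that by (simp add: cube_subface_def)
      then show ?thesis
        unfolding label_def by auto
    qed
    show "\<kappa> j x = \<kappa> j' x"
    proof
      fix v :: "(nat \<times> bool) set \<times> 'j set"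
      show "\<kappa> j x v = \<kappa> j' x v"
        using lab[of "fst v"] by (cases "fst v \<subseteq> L \<and> cube_layer q x (fst v) \<noteq> 0") (auto simp: \<kappa>_def)
    qed
  next
    fix y assume y: "y \<in> topspace ?R"
    then obtain j where j: "valid y j"
      using valid_ex by blast
    then show "\<exists>j\<in>J. \<exists>x\<in>cube q. \<forall>t\<in>topspace P. G (t, y) = c j (t, x)"
      using G_eq[OF y j] loc_cube[OF y] by (auto simp: valid_def)
  qed
qed

section \<open>Unipotence of the unit map on homology\<close>

text \<open>Of the path lifting only its unit map is retained. This form passes to every pullback,
  in particular to fibres and homotopy fibres.\<close>

definition locally_unital :: "'e topology \<Rightarrow> 'b topology \<Rightarrow> ('e \<Rightarrow> 'b) \<Rightarrow> ('e \<Rightarrow> 'e) \<Rightarrow> bool" where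
  "locally_unital E B p u \<longleftrightarrow> continuous_map E B p \<and> continuous_map E E u \<and>
     (\<forall>e\<in>topspace E. p (u e) = p e) \<and>
     (\<exists>F \<U>. fibrewise_filtration E p F \<and>
        (\<forall>k. (\<forall>U \<in> \<U> k. openin B U) \<and> \<Union>(\<U> k) = topspace B) \<and>
        (\<forall>k. \<forall>U \<in> \<U> k. fibrewise_homotopic p (subtopology E (F k \<inter> p -` U)) E id u))"

text \<open>The order matters: \<open>G\<close> is first deformed into a stage \<open>F k\<close>,
  and then the simplex is subdivided until \<open>a\<close> maps each piece into a member of
  \<open>\<U> k\<close>. Over a piece, the local homotopy is preceded by the deformation and
  followed by \<open>u\<close> applied to its reverse. The bound holds for all
  \<open>r \<ge> r0\<close> so that several complexes can share one \<open>r\<close>.\<close>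

lemma fibrewise_homotopic_on_small_simplices:
  fixes K :: "'v set set"
  assumes lu: "locally_unital E B p u" and K: "finite_complex K"
    and G: "continuous_map (prod_topology (simplex_space n) (complex_realization K)) E G"
    and a: "continuous_map (simplex_space n) B a"
    and pG: "\<And>t y. t \<in> standard_simplex n \<Longrightarrow> y \<in> topspace (complex_realization K) \<Longrightarrow> p (G (t, y)) = a t"
  shows "\<exists>r0. \<forall>r\<ge>r0. \<forall>l\<in>Poly_Mapping.keys (iterated_subdivision r n (id_simplex n)).
    fibrewise_homotopic p (prod_topology (simplex_space n) (complex_realization K)) E
      (\<lambda>(t, y). G (l t, y)) (\<lambda>(t, y). u (G (l t, y)))"
proof -
  let ?Z = "prod_topology (simplex_space n) (complex_realization K)"
  have u: "continuous_map E E u" "\<And>e. e \<in> topspace E \<Longrightarrow> p (u e) = p e"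
    using lu by (simp_all add: locally_unital_def)
  obtain F \<U> where F: "fibrewise_filtration E p F"
    and U: "\<forall>k. (\<forall>U \<in> \<U> k. openin B U) \<and> \<Union>(\<U> k) = topspace B"
    and hU: "\<forall>k. \<forall>U \<in> \<U> k. fibrewise_homotopic p (subtopology E (F k \<inter> p -` U)) E id u"
    using lu unfolding locally_unital_def by metis
  obtain k G' where G': "fibrewise_homotopic p ?Z E G G'" "G' ` topspace ?Z \<subseteq> F k"
    using deformable_simplex_times_realization[OF F K, of n] G unfolding deformable_def by blast
  have pG': "p (G' z) = p (G z)" if "z \<in> topspace ?Z" for z
    using G'(1) that unfolding fibrewise_homotopic_iff by (metis atLeastAtMost_iff order_refl zero_le_one)
  note cG' = fibrewise_homotopic_imp_continuous_maps(2)[OF G'(1)]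
  define \<C> where "\<C> = (\<lambda>V. {t \<in> topspace (simplex_space n). a t \<in> V}) ` \<U> k"
  have "\<And>C. C \<in> \<C> \<Longrightarrow> openin (simplex_space n) C"
    unfolding \<C>_def using openin_continuous_map_preimage[OF a] U by blast
  moreover have "topspace (simplex_space n) \<subseteq> \<Union>\<C>"
  proof
    fix t assume t: "t \<in> topspace (simplex_space n)"
    then have "a t \<in> \<Union>(\<U> k)"
      using continuous_map_funspace[OF a] U by blast
    then show "t \<in> \<Union>\<C>"
      using t by (auto simp: \<C>_def)
  qed
  ultimately obtain r0 where r0: "\<And>r l. r0 \<le> r \<Longrightarrow> l \<in> Poly_Mapping.keys (iterated_subdivision r n (id_simplex n))
      \<Longrightarrow> \<exists>C\<in>\<C>. l \<in> standard_simplex n \<rightarrow> C"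
    using sufficient_iterated_singular_subdivision_exists[OF _ _ singular_chain_id_simplex] by metis
  have "fibrewise_homotopic p ?Z E (\<lambda>(t, y). G (l t, y)) (\<lambda>(t, y). u (G (l t, y)))"
    if r: "r0 \<le> r" and l: "l \<in> Poly_Mapping.keys (iterated_subdivision r n (id_simplex n))" for r l
  proof -
    obtain V where V: "V \<in> \<U> k" "\<And>t. t \<in> standard_simplex n \<Longrightarrow> a (l t) \<in> V"
      using r0[OF r l] by (auto simp: \<C>_def)
    have l: "continuous_map (simplex_space n) (simplex_space n) l"
      using singular_chain_iterated_subdivision[OF singular_chain_id_simplex, of n r] l
      by (auto simp: singular_chain_def singular_simplex_def)
    define m where "m = (\<lambda>(t, y). (l t, y :: 'v \<Rightarrow> real))"
    have m: "continuous_map ?Z ?Z m"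
      unfolding m_def using continuous_map_compose[OF continuous_map_fst l]
      by (simp add: continuous_map_pairwise o_def case_prod_unfold continuous_map_snd)
    have mZ: "m z \<in> topspace ?Z" if "z \<in> topspace ?Z" for z
      using continuous_map_funspace[OF m] that by blast
    have "continuous_map ?Z (subtopology E (F k \<inter> p -` V)) (G' \<circ> m)"
    proof -
      have "(G' \<circ> m) z \<in> F k \<inter> p -` V" if z: "z \<in> topspace ?Z" for z
      proof -
        have "p (G' (m z)) = a (l (fst z))"
          using pG'[OF mZ[OF z]] pG[of "fst (m z)" "snd (m z)"] mZ[OF z]
          by (auto simp: m_def case_prod_unfold)
        then show ?thesis
          using G'(2) mZ[OF z] V(2)[of "fst z"] z by auto
      qed
      then show ?thesis
        using continuous_map_compose[OF m cG'] by (auto simp: continuous_map_in_subtopology)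
    qed
    from fibrewise_homotopic_compose_right[OF hU[rule_format, OF V(1)] this]
    have 1: "fibrewise_homotopic p ?Z E (G' \<circ> m) (u \<circ> (G' \<circ> m))"
      by simp
    have 2: "fibrewise_homotopic p ?Z E (G \<circ> m) (G' \<circ> m)"
      by (rule fibrewise_homotopic_compose_right[OF G'(1) m])
    have 3: "fibrewise_homotopic p ?Z E (u \<circ> (G' \<circ> m)) (u \<circ> (G \<circ> m))"
      by (rule fibrewise_homotopic_sym, rule fibrewise_homotopic_compose_left[OF 2 u])
    have "fibrewise_homotopic p ?Z E (G \<circ> m) (u \<circ> (G \<circ> m))"
      by (rule fibrewise_homotopic_trans[OF 2 fibrewise_homotopic_trans[OF 1 3]])
    then show ?thesis
      by (simp add: m_def o_def case_prod_unfold)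
  qed
  then show ?thesis by blast
qed

text \<open>By the last clause the homotopies of two cubes with a common face agree on it, so that faces
  which cancel in a chain still cancel after applying \<open>h\<close>.\<close>

definition cube_homotopies ::
  "'e topology \<Rightarrow> ('e \<Rightarrow> 'b) \<Rightarrow> ('e \<Rightarrow> 'e) \<Rightarrow> nat \<Rightarrow> nat \<Rightarrow> nat \<Rightarrow> ((nat \<Rightarrow> real) \<Rightarrow> (nat \<Rightarrow> real) \<Rightarrow> 'e) set \<Rightarrow>
    (((nat \<Rightarrow> real) \<Rightarrow> (nat \<Rightarrow> real) \<Rightarrow> 'e) \<Rightarrow> ((nat \<Rightarrow> real) \<Rightarrow> (nat \<Rightarrow> real)) \<Rightarrow> (nat \<Rightarrow> real) \<Rightarrow> (nat \<Rightarrow> real) \<Rightarrow> 'e) \<Rightarrow> bool" where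
  "cube_homotopies E p u n q r J h \<longleftrightarrow>
    (\<forall>f\<in>J. \<forall>l\<in>Poly_Mapping.keys (iterated_subdivision r n (id_simplex n)).
      singular_simplex n (cube_maps E p (Suc q)) (h f l) \<and>
      simplex_map n (\<lambda>\<phi>. cube_slice q (\<phi>, 0)) (h f l) = simplex_map n f l \<and>
      simplex_map n (\<lambda>\<phi>. cube_slice q (\<phi>, 1)) (h f l) = simplex_map n (cube_act q u) (simplex_map n f l) \<and>
      (\<forall>f'\<in>J. \<forall>j<q. \<forall>\<epsilon>\<in>{0, 1}.
        simplex_map n (cube_face q j \<epsilon>) f = simplex_map n (cube_face q j \<epsilon>) f' \<longrightarrow>
        simplex_map n (cube_face (Suc q) j \<epsilon>) (h f l) = simplex_map n (cube_face (Suc q) j \<epsilon>) (h f' l)))"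

lemma simplex_map_cube_face_eq:
  assumes "simplex_map n (cube_face q j \<epsilon>) f = simplex_map n (cube_face q j \<epsilon>) f'"
    and "t \<in> standard_simplex n" "x \<in> cube q" "x j = \<epsilon>"
  shows "f t x = f' t x"
proof -
  have "cube_face q j \<epsilon> (f t) = cube_face q j \<epsilon> (f' t)"
    using fun_cong[OF assms(1), of t] assms(2) by (simp add: simplex_map_def)
  from fun_cong[OF this, of x] show ?thesis
    using assms(3,4) by (simp add: cube_face_def)
qed

text \<open>The homotopies live on the glued complex and are pulled back along the parametrizations
  \<open>\<kappa> f\<close>, which coincide on common faces. The common base \<open>b\<close> makes
  the glued map lie over a map of the simplex, as the subdivision argument requires.\<close>

lemma cube_homotopies_same_base:
  assumes lu: "locally_unital E B p u" and J: "finite J"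
    and Js: "\<And>f. f \<in> J \<Longrightarrow> singular_simplex n (cube_maps E p q) f"
    and b: "\<And>f t. f \<in> J \<Longrightarrow> t \<in> standard_simplex n \<Longrightarrow> p (f t (\<lambda>_. 0)) = b t"
  shows "\<exists>r0. \<forall>r\<ge>r0. \<exists>h. cube_homotopies E p u n q r J h"
proof (cases "J = {}")
  case True
  then show ?thesis
    by (simp add: cube_homotopies_def)
next
  case False
  define c where "c f = (\<lambda>(t, x). f t x)" for f :: "(nat \<Rightarrow> real) \<Rightarrow> (nat \<Rightarrow> real) \<Rightarrow> 'a"
  have c: "continuous_map (prod_topology (simplex_space n) (cube_space q)) E (c f)" if "f \<in> J" for f
    unfolding c_def using Js[OF that] by (intro continuous_map_from_cube_maps[where p = p]) (simp add: singular_simplex_def)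
  have fX: "f t \<in> topspace (cube_maps E p q)" if "f \<in> J" "t \<in> standard_simplex n" for f t
    using Js[OF that(1)] that(2) by (auto simp: singular_simplex_def dest!: continuous_map_funspace)
  obtain K :: "((nat \<times> bool) set \<times> ((nat \<Rightarrow> real) \<Rightarrow> (nat \<Rightarrow> real) \<Rightarrow> 'a) set) set set" and \<kappa> G where
    K: "finite_complex K"
    and \<kappa>: "\<And>f. f \<in> J \<Longrightarrow> continuous_map (cube_space q) (complex_realization K) (\<kappa> f)"
    and G: "continuous_map (prod_topology (simplex_space n) (complex_realization K)) E G"
    and G\<kappa>: "\<And>f t x. f \<in> J \<Longrightarrow> t \<in> topspace (simplex_space n) \<Longrightarrow> x \<in> cube q \<Longrightarrow> G (t, \<kappa> f x) = c f (t, x)"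
    and \<kappa>_eq: "\<And>f f' i \<epsilon> x. f \<in> J \<Longrightarrow> f' \<in> J \<Longrightarrow> i < q \<Longrightarrow> \<epsilon> \<in> {0, 1} \<Longrightarrow>
       \<forall>t\<in>topspace (simplex_space n). \<forall>y\<in>cube q. y i = \<epsilon> \<longrightarrow> c f (t, y) = c f' (t, y) \<Longrightarrow>
       x \<in> cube q \<Longrightarrow> x i = \<epsilon> \<Longrightarrow> \<kappa> f x = \<kappa> f' x"
    and G_ex: "\<And>y. y \<in> topspace (complex_realization K) \<Longrightarrow>
       \<exists>f\<in>J. \<exists>x\<in>cube q. \<forall>t\<in>topspace (simplex_space n). G (t, y) = c f (t, x)"
    by (rule glue_cubes[where c = c, OF J c]) (assumption, rule that)
  have pf: "p (f t x) = b t" if "f \<in> J" "t \<in> standard_simplex n" "x \<in> cube q" for f t x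
    using cube_maps_fibrewise[OF fX[OF that(1,2)] that(3) zero_in_cube] b[OF that(1,2)] by simp
  have pG: "p (G (t, y)) = b t" if "t \<in> standard_simplex n" "y \<in> topspace (complex_realization K)" for t y
    using G_ex[OF that(2)] that(1) pf by (auto simp: c_def)
  have b: "continuous_map (simplex_space n) B b"
  proof -
    obtain f where f: "f \<in> J" using False by blast
    have "continuous_map (simplex_space n) (prod_topology (simplex_space n) (cube_space q)) (\<lambda>t. (t, \<lambda>_. 0))"
      by (simp add: continuous_map_pairwise o_def zero_in_cube)
    from continuous_map_compose[OF this c[OF f]]
    have "continuous_map (simplex_space n) E (\<lambda>t. f t (\<lambda>_. 0))"
      by (simp add: c_def o_def)
    moreover have "continuous_map E B p"
      using lu by (simp add: locally_unital_def)
    ultimately have "continuous_map (simplex_space n) B (p \<circ> (\<lambda>t. f t (\<lambda>_. 0)))"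
      by (rule continuous_map_compose)
    then show ?thesis
      by (rule continuous_map_eq) (use pf[OF f _ zero_in_cube] in auto)
  qed
  let ?Z = "prod_topology (simplex_space n) (complex_realization K)"
  obtain r0 where r0: "\<And>r l. r0 \<le> r \<Longrightarrow> l \<in> Poly_Mapping.keys (iterated_subdivision r n (id_simplex n)) \<Longrightarrow>
      fibrewise_homotopic p ?Z E (\<lambda>(t, y). G (l t, y)) (\<lambda>(t, y). u (G (l t, y)))"
    using fibrewise_homotopic_on_small_simplices[OF lu K G b pG] by blast
  have "\<exists>h. cube_homotopies E p u n q r J h" if r: "r0 \<le> r" for r
  proof -
    let ?S = "Poly_Mapping.keys (iterated_subdivision r n (id_simplex n))"
    have "\<forall>l\<in>?S. \<exists>H. continuous_map (prod_topology unit_interval ?Z) E H \<and>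
      (\<forall>z\<in>topspace ?Z. H (0, z) = G (l (fst z), snd z) \<and> H (1, z) = u (G (l (fst z), snd z)) \<and>
        (\<forall>s\<in>{0..1}. p (H (s, z)) = p (G (l (fst z), snd z))))"
      using r0[OF r] unfolding fibrewise_homotopic_iff case_prod_unfold by blast
    from bchoice[OF this] obtain H where HH: "\<forall>l\<in>?S. continuous_map (prod_topology unit_interval ?Z) E (H l) \<and>
      (\<forall>z\<in>topspace ?Z. H l (0, z) = G (l (fst z), snd z) \<and> H l (1, z) = u (G (l (fst z), snd z)) \<and>
        (\<forall>s\<in>{0..1}. p (H l (s, z)) = p (G (l (fst z), snd z))))" ..
    have H: "\<And>l. l \<in> ?S \<Longrightarrow> continuous_map (prod_topology unit_interval ?Z) E (H l)"
      and H0: "\<And>l z. l \<in> ?S \<Longrightarrow> z \<in> topspace ?Z \<Longrightarrow> H l (0, z) = G (l (fst z), snd z)"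
      and H1: "\<And>l z. l \<in> ?S \<Longrightarrow> z \<in> topspace ?Z \<Longrightarrow> H l (1, z) = u (G (l (fst z), snd z))"
      and pH: "\<And>l z s. l \<in> ?S \<Longrightarrow> z \<in> topspace ?Z \<Longrightarrow> s \<in> {0..1} \<Longrightarrow> p (H l (s, z)) = p (G (l (fst z), snd z))"
      using HH by blast+
    \<comment> \<open>The new coordinate \<open>x q\<close> is the homotopy parameter, and
      \<open>x(q := 0)\<close> is the point of the original cube.\<close>
    define h where "h f l = (\<lambda>t\<in>standard_simplex n. \<lambda>x\<in>cube (Suc q). H l (x q, (t, \<kappa> f (x(q := 0)))))" for f l
    have x0: "x(q := 0) \<in> cube q" "0 \<le> x q \<and> x q \<le> 1" if "x \<in> cube (Suc q)" for x
      using that by (auto simp: cube_def)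
    have \<kappa>R: "\<kappa> f x \<in> topspace (complex_realization K)" if "f \<in> J" "x \<in> cube q" for f x
      using continuous_map_funspace[OF \<kappa>[OF that(1)]] that(2) by auto
    have lS: "l t \<in> standard_simplex n" if "l \<in> ?S" "t \<in> standard_simplex n" for l t
    proof -
      have "continuous_map (simplex_space n) (simplex_space n) l"
        using singular_chain_iterated_subdivision[OF singular_chain_id_simplex, of n r] that(1)
        by (auto simp: singular_chain_def singular_simplex_def)
      from Pi_mem[OF continuous_map_funspace[OF this], of t] show ?thesis
        using that(2) by simp
    qed
    have hs: "singular_simplex n (cube_maps E p (Suc q)) (h f l)" if f: "f \<in> J" and l: "l \<in> ?S" for f l
    proof -
      let ?P = "prod_topology (simplex_space n) (cube_space (Suc q))"
      have 1: "continuous_map ?P unit_interval (\<lambda>z. snd z q)"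
        using continuous_map_compose[OF continuous_map_snd continuous_map_coordinate, unfolded o_def, of "simplex_space n" "cube (Suc q)" q]
        by (auto simp: continuous_map_in_subtopology cube_def)
      have "continuous_map (cube_space (Suc q)) (cube_space q) (\<lambda>x. x(q := 0))"
        using x0(1) by (auto simp: continuous_map_in_subtopology continuous_map_componentwise_UNIV fun_upd_def
            intro: continuous_map_coordinate)
      from continuous_map_compose[OF continuous_map_compose[OF continuous_map_snd this] \<kappa>[OF f]]
      have 2: "continuous_map ?P (complex_realization K) (\<lambda>z. \<kappa> f ((snd z)(q := 0)))"
        by (simp add: o_def)
      have "continuous_map ?P (prod_topology unit_interval ?Z) (\<lambda>z. (snd z q, (fst z, \<kappa> f ((snd z)(q := 0)))))"
        using 1 2 by (simp add: continuous_map_pairwise o_def continuous_map_fst)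
      from continuous_map_compose[OF this H[OF l]]
      have 3: "continuous_map ?P E (\<lambda>z. H l (snd z q, (fst z, \<kappa> f ((snd z)(q := 0)))))"
        by (simp add: o_def)
      have "continuous_map (simplex_space n) (cube_maps E p (Suc q))
          (\<lambda>t. \<lambda>x\<in>cube (Suc q). (\<lambda>z. H l (snd z q, (fst z, \<kappa> f ((snd z)(q := 0))))) (t, x))"
      proof (rule continuous_map_into_cube_maps[OF 3])
        fix t x y assume t: "t \<in> topspace (simplex_space n)" and xy: "x \<in> cube (Suc q)" "y \<in> cube (Suc q)"
        have "p (H l (x q, (t, \<kappa> f (x(q := 0))))) = b (l t)" if x: "x \<in> cube (Suc q)" for x
          using pH[OF l, of "(t, \<kappa> f (x(q := 0)))" "x q"] pG[OF lS[OF l, of t] \<kappa>R[OF f x0(1)[OF x]]] t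
            \<kappa>R[OF f x0(1)[OF x]] x0(2)[OF x] by simp
        then show "p (H l (snd (t, x) q, (fst (t, x), \<kappa> f ((snd (t, x))(q := 0)))))
            = p (H l (snd (t, y) q, (fst (t, y), \<kappa> f ((snd (t, y))(q := 0)))))"
          using xy by simp
      qed
      then have "continuous_map (simplex_space n) (cube_maps E p (Suc q)) (h f l)"
        by (rule continuous_map_eq) (simp add: h_def)
      then show ?thesis
        by (simp add: singular_simplex_def h_def)
    qed
    have slice: "cube_slice q (h f l t, s) = (\<lambda>x\<in>cube q. H l (s, (t, \<kappa> f x)))"
      if "t \<in> standard_simplex n" "s \<in> {0..1}" for f l t s
    proof
      fix x
      show "cube_slice q (h f l t, s) x = (\<lambda>x\<in>cube q. H l (s, (t, \<kappa> f x))) x"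
      proof (cases "x \<in> cube q")
        case True
        then have "x(q := 0) = x"
          by (auto simp: cube_def)
        then show ?thesis
          using True that cube_upd[OF True that(2)] by (simp add: cube_slice_def h_def)
      qed (simp add: cube_slice_def)
    qed
    have f_ext: "f t = (\<lambda>x\<in>cube q. f t x)" if "f \<in> J" "t \<in> standard_simplex n" for f t
      using fX[OF that] by (auto simp: topspace_cube_maps extensional_restrict)
    have s0: "simplex_map n (\<lambda>\<phi>. cube_slice q (\<phi>, 0)) (h f l) = simplex_map n f l" if f: "f \<in> J" and l: "l \<in> ?S" for f l
      unfolding simplex_map_def
    proof (rule restrict_ext)
      fix t assume t: "t \<in> standard_simplex n"
      have "cube_slice q (h f l t, 0) = (\<lambda>x\<in>cube q. f (l t) x)"
        unfolding slice[OF t, of 0 f l, simplified]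
        by (rule restrict_ext) (use H0[OF l] \<kappa>R[OF f] G\<kappa>[OF f] lS[OF l t] t in \<open>simp add: c_def\<close>)
      then show "((\<lambda>\<phi>. cube_slice q (\<phi>, 0)) \<circ> h f l) t = (f \<circ> l) t"
        using f_ext[OF f lS[OF l t]] by simp
    qed
    have s1: "simplex_map n (\<lambda>\<phi>. cube_slice q (\<phi>, 1)) (h f l) = simplex_map n (cube_act q u) (simplex_map n f l)"
      if f: "f \<in> J" and l: "l \<in> ?S" for f l
      unfolding simplex_map_def
    proof (rule restrict_ext)
      fix t assume t: "t \<in> standard_simplex n"
      have "cube_slice q (h f l t, 1) = (\<lambda>x\<in>cube q. u (f (l t) x))"
        unfolding slice[OF t, of 1 f l, simplified]
        by (rule restrict_ext) (use H1[OF l] \<kappa>R[OF f] G\<kappa>[OF f] lS[OF l t] t in \<open>simp add: c_def\<close>)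
      then show "((\<lambda>\<phi>. cube_slice q (\<phi>, 1)) \<circ> h f l) t = (cube_act q u \<circ> restrict (f \<circ> l) (standard_simplex n)) t"
        using t by (simp add: cube_act_def)
    qed
    have face: "simplex_map n (cube_face (Suc q) j \<epsilon>) (h f l) = simplex_map n (cube_face (Suc q) j \<epsilon>) (h f' l)"
      if f: "f \<in> J" "f' \<in> J" and j: "j < q" "\<epsilon> \<in> {0, 1}"
        and eq: "simplex_map n (cube_face q j \<epsilon>) f = simplex_map n (cube_face q j \<epsilon>) f'" for f f' l j \<epsilon>
      unfolding simplex_map_def
    proof (rule restrict_ext)
      fix t assume t: "t \<in> standard_simplex n"
      have "\<kappa> f (x(q := 0)) = \<kappa> f' (x(q := 0))" if "x \<in> cube (Suc q)" "x j = \<epsilon>" for x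
      proof (rule \<kappa>_eq[OF f j])
        show "\<forall>t\<in>topspace (simplex_space n). \<forall>y\<in>cube q. y j = \<epsilon> \<longrightarrow> c f (t, y) = c f' (t, y)"
          using simplex_map_cube_face_eq[OF eq] by (simp add: c_def)
      qed (use that j x0 in auto)
      then show "(cube_face (Suc q) j \<epsilon> \<circ> h f l) t = (cube_face (Suc q) j \<epsilon> \<circ> h f' l) t"
        unfolding o_def cube_face_def using t by (intro restrict_ext) (simp add: h_def)
    qed
    have "cube_homotopies E p u n q r J h"
      unfolding cube_homotopies_def by (intro ballI conjI allI impI hs s0 s1 face)
    then show ?thesis by blast
  qed
  then show ?thesis by blast
qed

text \<open>Finitely many base simplices occur, so a maximum gives one \<open>r\<close> for all.
  Choices over different bases need no matching, since families with a common face have the same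
  base.\<close>

lemma cube_homotopies_exist:
  assumes lu: "locally_unital E B p u" and J: "finite J"
    and Js: "\<And>f. f \<in> J \<Longrightarrow> singular_simplex n (cube_maps E p q) f"
  shows "\<exists>r h. cube_homotopies E p u n q r J h"
proof -
  define base where "base f = (\<lambda>t\<in>standard_simplex n. p (f t (\<lambda>_. 0)))" for f :: "(nat \<Rightarrow> real) \<Rightarrow> (nat \<Rightarrow> real) \<Rightarrow> 'a"
  have base: "base f t = p (f t (\<lambda>_. 0))" if "t \<in> standard_simplex n" for f t
    using that by (simp add: base_def)
  have "\<exists>r0. \<forall>r\<ge>r0. \<exists>h. cube_homotopies E p u n q r {f \<in> J. base f = b} h" for b
    by (rule cube_homotopies_same_base[OF lu, where b = b]) (use J Js base in auto)
  then have "\<forall>b. \<exists>r0. \<forall>r\<ge>r0. \<exists>h. cube_homotopies E p u n q r {f \<in> J. base f = b} h" ..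
  from choice[OF this] obtain r0 where r0: "\<forall>b. \<forall>r\<ge>r0 b. \<exists>h. cube_homotopies E p u n q r {f \<in> J. base f = b} h" ..
  \<comment> \<open>\<open>insert 0\<close> keeps the maximum defined for empty
    \<open>J\<close>.\<close>
  define r where "r = Max (insert 0 (r0 ` base ` J))"
  have "r0 (base f) \<le> r" if "f \<in> J" for f
    unfolding r_def using that J by (intro Max_ge) auto
  then have "\<forall>b\<in>base ` J. \<exists>h. cube_homotopies E p u n q r {f \<in> J. base f = b} h"
    using r0 by blast
  from bchoice[OF this] obtain h where h: "\<forall>b\<in>base ` J. cube_homotopies E p u n q r {f \<in> J. base f = b} (h b)" ..
  have same: "base f = base f'"
    if f: "f \<in> J" "f' \<in> J" and j: "j < q" "\<epsilon> \<in> {0, 1}"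
      and eq: "simplex_map n (cube_face q j \<epsilon>) f = simplex_map n (cube_face q j \<epsilon>) f'" for f f' j and \<epsilon> :: real
  proof -
    \<comment> \<open>A point of the common face: \<open>f\<close> and \<open>f'\<close> agree
      there, and each cube stays in the fibre of that point.\<close>
    define x where "x = (\<lambda>i. if i = j then \<epsilon> else 0)"
    have x: "x \<in> cube q" "x j = \<epsilon>"
      using j by (auto simp: x_def cube_def)
    have "p (f t (\<lambda>_. 0)) = p (f' t (\<lambda>_. 0))" if t: "t \<in> standard_simplex n" for t
    proof -
      have "f t \<in> topspace (cube_maps E p q)" "f' t \<in> topspace (cube_maps E p q)"
        using Js[OF f(1)] Js[OF f(2)] t by (auto simp: singular_simplex_def dest!: continuous_map_funspace)
      then have "p (f t (\<lambda>_. 0)) = p (f t x)" "p (f' t (\<lambda>_. 0)) = p (f' t x)"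
        using x(1) zero_in_cube by (blast intro: cube_maps_fibrewise)+
      then show ?thesis
        using simplex_map_cube_face_eq[OF eq t x] by simp
    qed
    then show ?thesis
      unfolding base_def by (intro restrict_ext)
  qed
  have "cube_homotopies E p u n q r J (\<lambda>f. h (base f) f)"
    unfolding cube_homotopies_def
  proof (intro ballI conjI allI impI)
    fix f l assume f: "f \<in> J" and l: "l \<in> Poly_Mapping.keys (iterated_subdivision r n (id_simplex n))"
    then have f': "f \<in> {f' \<in> J. base f' = base f}" by simp
    note hf = h[rule_format, OF imageI[OF f], unfolded cube_homotopies_def, rule_format, OF f' l]
    show "singular_simplex n (cube_maps E p (Suc q)) (h (base f) f l)"
      "simplex_map n (\<lambda>\<phi>. cube_slice q (\<phi>, 0)) (h (base f) f l) = simplex_map n f l"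
      "simplex_map n (\<lambda>\<phi>. cube_slice q (\<phi>, 1)) (h (base f) f l) = simplex_map n (cube_act q u) (simplex_map n f l)"
      using hf by blast+
    fix f' j and \<epsilon> :: real
    assume "f' \<in> J" "j < q" "\<epsilon> \<in> {0, 1}" "simplex_map n (cube_face q j \<epsilon>) f = simplex_map n (cube_face q j \<epsilon>) f'"
    moreover from this have "base f = base f'"
      using same f by blast
    ultimately show "simplex_map n (cube_face (Suc q) j \<epsilon>) (h (base f) f l)
        = simplex_map n (cube_face (Suc q) j \<epsilon>) (h (base f') f' l)"
      using conjunct2[OF conjunct2[OF conjunct2[OF hf]], rule_format, of f' j \<epsilon>] by simp
  qed
  then show ?thesis by blast
qed

section \<open>Assembling the chain of homotopies; induction on the base degree\<close>

lemma frag_extend_extend: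
  "frag_extend g (frag_extend f c) = frag_extend (\<lambda>x. frag_extend g (f x)) c"
  using subset_UNIV by (induction c rule: frag_induction) (simp_all add: frag_extend_diff)

lemma chain_map_extend:
  "chain_map n g (frag_extend f c) = frag_extend (\<lambda>x. chain_map n g (f x)) c"
  unfolding chain_map_def by (rule frag_extend_extend)

text \<open>By naturality the pieces of every simplex are indexed by the same pieces of the model
  simplex, which allows homotopies \<open>h f l\<close> with independent indices.\<close>

lemma iterated_subdivision_extend:
  assumes "singular_chain n X w"
  shows "iterated_subdivision r n w = frag_extend (\<lambda>f. chain_map n f (iterated_subdivision r n (id_simplex n))) w"
  using assms unfolding singular_chain_def
proof (induction w rule: frag_induction)
  case (one f)
  then have "chain_map n f (id_simplex n) = frag_of f"
    by (simp add: chain_map_id_simplex)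
  then show ?case
    using iterated_subdivision_chain_map[OF singular_chain_id_simplex, of r n f] by simp
next
  case (diff a b)
  then show ?case
    using singular_subdivision_power_diff[where n = r and p = n and a = a and b = b] by (simp add: frag_extend_diff)
qed simp

text \<open>The induction is on \<open>n\<close> with \<open>q\<close> free, because each step
  trades one base dimension for one cube dimension.\<close>

lemma unipotent_cycle_cube_total:
  assumes lu: "locally_unital E B p u"
  shows "singular_chain n (cube_maps E p q) w \<Longrightarrow> chain_boundary n w = 0 \<Longrightarrow> cube_normalized q n w \<Longrightarrow>
    unipotent_cycle E u (n + q) (cube_total q n w)"
proof (induction n arbitrary: q w rule: less_induct)
  case (less n)
  let ?J = "Poly_Mapping.keys w"
  have Js: "singular_simplex n (cube_maps E p q) f" if "f \<in> ?J" for f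
    using less.prems(1) that by (auto simp: singular_chain_def)
  obtain r h where h: "cube_homotopies E p u n q r ?J h"
    using cube_homotopies_exist[OF lu finite_keys Js] by blast
  note h = h[unfolded cube_homotopies_def, rule_format]
  define S where "S = iterated_subdivision r n (id_simplex n)"
  \<comment> \<open>Each simplex \<open>f\<close> of \<open>w\<close> contributes a homotopy for
    every piece \<open>l\<close> of the model, with the multiplicities of both chains.\<close>
  define W where "W = frag_extend (\<lambda>f. frag_extend (\<lambda>l. frag_of (h f l)) S) w"
  have mapW: "chain_map n g W = frag_extend (\<lambda>f. frag_extend (\<lambda>l. frag_of (simplex_map n g (h f l))) S) w" for g :: "((nat \<Rightarrow> real) \<Rightarrow> 'a) \<Rightarrow> (nat \<Rightarrow> real) \<Rightarrow> 'a"
    by (simp add: W_def chain_map_def frag_extend_extend)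
  have sub: "iterated_subdivision r n w = frag_extend (\<lambda>f. chain_map n f S) w"
    unfolding S_def by (rule iterated_subdivision_extend[OF less.prems(1)])
  show ?case
  proof (rule unipotent_cycle_cube_total_step[OF less.prems])
    show "singular_chain n (cube_maps E p (Suc q)) W"
      unfolding W_def using h by (intro singular_chain_extend) (simp add: singular_chain_of S_def)
    show "continuous_map E E u"
      using lu by (simp add: locally_unital_def)
    show "chain_map n (\<lambda>\<phi>. cube_slice q (\<phi>, 0)) W = iterated_subdivision r n w"
    proof -
      have "frag_extend (\<lambda>l. frag_of (simplex_map n (\<lambda>\<phi>. cube_slice q (\<phi>, 0)) (h f l))) S = chain_map n f S"
        if "f \<in> ?J" for f
        unfolding chain_map_def using h[OF that] by (intro frag_extend_eq) (simp add: S_def)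
      then show ?thesis
        unfolding mapW sub by (rule frag_extend_eq)
    qed
    show "chain_map n (\<lambda>\<phi>. cube_slice q (\<phi>, 1)) W = chain_map n (cube_act q u) (iterated_subdivision r n w)"
    proof -
      have "frag_extend (\<lambda>l. frag_of (simplex_map n (\<lambda>\<phi>. cube_slice q (\<phi>, 1)) (h f l))) S
          = chain_map n (cube_act q u) (chain_map n f S)" if "f \<in> ?J" for f
      proof -
        have "frag_extend (\<lambda>l. frag_of (simplex_map n (\<lambda>\<phi>. cube_slice q (\<phi>, 1)) (h f l))) S
            = chain_map n (cube_act q u \<circ> f) S"
          unfolding chain_map_def simplex_map_compose
          using h[OF that] by (intro frag_extend_eq) (simp add: S_def)
        then show ?thesis
          by (simp only: chain_map_comp)
      qed
      then show ?thesis
        unfolding mapW sub chain_map_extend by (rule frag_extend_eq)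
    qed
    show "chain_map n (cube_face (Suc q) j \<epsilon>) W = 0" if j: "j < q" "\<epsilon> \<in> {0, 1}" for j \<epsilon>
    proof -
      \<comment> \<open>The contribution of \<open>f\<close> to this face depends on
        \<open>f\<close> only through the face \<open>d f\<close>. The face of \<open>W\<close> is
        thus a linear function \<open>\<Psi>\<close> of the corresponding face of \<open>w\<close>,
        which is zero.\<close>
      define \<Phi> where "\<Phi> f = frag_extend (\<lambda>l. frag_of (simplex_map n (cube_face (Suc q) j \<epsilon>) (h f l))) S" for f
      define d where "d f = simplex_map n (cube_face q j \<epsilon>) f" for f :: "(nat \<Rightarrow> real) \<Rightarrow> (nat \<Rightarrow> real) \<Rightarrow> 'a"
      define \<Psi> where "\<Psi> g = \<Phi> (SOME f. f \<in> ?J \<and> d f = g)" for g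
      have "\<Phi> f = \<Psi> (d f)" if f: "f \<in> ?J" for f
      proof -
        define f' where "f' = (SOME f'. f' \<in> ?J \<and> d f' = d f)"
        have f': "f' \<in> ?J" "d f = d f'"
          unfolding f'_def using someI[of "\<lambda>f'. f' \<in> ?J \<and> d f' = d f" f] f by auto
        have "\<Phi> f = \<Phi> f'"
          unfolding \<Phi>_def
        proof (rule frag_extend_eq)
          fix l assume "l \<in> Poly_Mapping.keys S"
          then show "frag_of (simplex_map n (cube_face (Suc q) j \<epsilon>) (h f l))
              = frag_of (simplex_map n (cube_face (Suc q) j \<epsilon>) (h f' l))"
            using h[OF f, of l] f' j unfolding d_def S_def by metis
        qed
        then show ?thesis
          by (simp add: \<Psi>_def f'_def)
      qed
      then have "chain_map n (cube_face (Suc q) j \<epsilon>) W = frag_extend (\<lambda>f. \<Psi> (d f)) w"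
        unfolding mapW by (intro frag_extend_eq) (simp add: \<Phi>_def)
      also have "\<dots> = frag_extend \<Psi> (chain_map n (cube_face q j \<epsilon>) w)"
        by (simp add: chain_map_def frag_extend_extend d_def)
      also have "\<dots> = 0"
        by (simp add: cube_normalizedD[OF less.prems(3) j])
      finally show ?thesis .
    qed
    show "unipotent_cycle E u (n + q) (cube_total (Suc q) (n - Suc 0) w')"
      if "0 < n" "singular_chain (n - Suc 0) (cube_maps E p (Suc q)) w'"
        "chain_boundary (n - Suc 0) w' = 0" "cube_normalized (Suc q) (n - Suc 0) w'" for w'
      using less.IH[OF _ that(2-4)] that(1) by simp
  qed
qed

text \<open>A cycle of \<open>E\<close> is a cycle of 0-cubes, for which normalization is
  vacuous.\<close>

theorem unipotent_cycle_of_locally_unital: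
  assumes lu: "locally_unital E B p u" and z: "singular_relcycle m E {} z"
  shows "unipotent_cycle E u m z"
proof -
  let ?k = "\<lambda>e. \<lambda>x\<in>cube 0. e"
  define w where "w = chain_map m ?k z"
  have zc: "singular_chain m E z" "chain_boundary m z = 0"
    using z by (auto simp: singular_cycle)
  have "continuous_map E (cube_maps E p 0) (\<lambda>e. \<lambda>x\<in>cube 0. fst (e, x))"
    by (rule continuous_map_into_cube_maps[OF continuous_map_fst]) simp
  then have k: "continuous_map E (cube_maps E p 0) ?k"
    by simp
  have "unipotent_cycle E u (m + 0) (cube_total 0 m w)"
  proof (rule unipotent_cycle_cube_total[OF lu])
    show "singular_chain m (cube_maps E p 0) w"
      unfolding w_def by (rule singular_chain_chain_map[OF zc(1) k])
    show "chain_boundary m w = 0"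
      unfolding w_def using chain_boundary_chain_map[OF zc(1)] zc(2) by simp
    show "cube_normalized 0 m w"
      by (simp add: cube_normalized_def)
  qed
  moreover have "cube_total 0 m w = z"
    unfolding w_def cube_total.simps chain_map_comp
    by (rule chain_map_id_gen[OF zc(1)]) (simp add: zero_in_cube)
  ultimately show ?thesis by simp
qed

section \<open>Pullbacks and homotopy fibres\<close>

text \<open>On homology \<open>R\<close> after \<open>j\<close> is \<open>u\<close>, which is
  injective, and \<open>j\<close> after \<open>R\<close> is \<open>v\<close>, which is surjective;
  both follow from unipotence.\<close>

lemma hom_induced_iso_of_unipotent:
  assumes j: "continuous_map X Y j" and R: "continuous_map Y X R"
    and u: "continuous_map X X u" and v: "continuous_map Y Y v"
    and Rj: "\<And>x. x \<in> topspace X \<Longrightarrow> R (j x) = u x"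
    and jR: "homotopic_with (\<lambda>_. True) Y Y (j \<circ> R) v"
    and uX: "\<And>m z. singular_relcycle m X {} z \<Longrightarrow> unipotent_cycle X u m z"
    and vY: "\<And>m z. singular_relcycle m Y {} z \<Longrightarrow> unipotent_cycle Y v m z"
  shows "hom_induced n X {} Y {} j \<in> iso (homology_group n X) (homology_group n Y)"
proof (cases "n < 0")
  \<comment> \<open>Homology is indexed by integers, and in negative degrees both groups are
    trivial.\<close>
  case True
  then have "bij_betw (hom_induced n X {} Y {} j) (carrier (homology_group n X)) (carrier (homology_group n Y))"
    by (simp add: hom_induced_trivial relative_homology_group_def singleton_group_def bij_betw_def)
  then show ?thesis
    using hom_induced_hom by (auto simp: iso_def)
next
  case False
  then obtain m :: nat where n: "n = int m"
    by (metis int_nat_eq not_less)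
  let ?f = "hom_induced (int m) X {} Y {} j"
  have f: "?f (homologous_rel_set m X {} c) = homologous_rel_set m Y {} (chain_map m j c)"
    if "singular_relcycle m X {} c" for c
    by (rule hom_induced_chain_map[OF j _ that]) simp
  have inj: "inj_on ?f (carrier (homology_group (int m) X))"
  proof (rule inj_onI)
    fix A B assume "A \<in> carrier (homology_group (int m) X)" "B \<in> carrier (homology_group (int m) X)" and eq: "?f A = ?f B"
    then obtain a b where a: "singular_relcycle m X {} a" "A = homologous_rel_set m X {} a"
      and b: "singular_relcycle m X {} b" "B = homologous_rel_set m X {} b"
      by (auto simp: carrier_relative_homology_group)
    have ab: "singular_relcycle m X {} (a - b)"
      using a b by (simp add: singular_relcycle_diff)
    have "homologous_rel m Y {} (chain_map m j a) (chain_map m j b)"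
      using eq f a b by (simp add: homologous_rel_set_eq)
    then have "singular_relboundary m Y {} (chain_map m j (a - b))"
      by (simp add: homologous_rel_def chain_map_diff)
    then have "singular_relboundary m X {} (chain_map m R (chain_map m j (a - b)))"
      by (rule singular_relboundary_chain_map[OF _ R]) simp
    moreover have "chain_map m R (chain_map m j (a - b)) = chain_map m u (a - b)"
      unfolding chain_map_comp using ab Rj by (intro chain_map_eq[of m X]) (auto simp: singular_cycle)
    ultimately have "singular_relboundary m X {} (a - b)"
      using unipotent_cycle_injective[OF uX[OF ab] u] by simp
    then have "homologous_rel m X {} a b"
      by (simp add: homologous_rel_def)
    then show "A = B"
      unfolding a(2) b(2) homologous_rel_set_eq .
  qed
  have "B \<in> ?f ` carrier (homology_group (int m) X)" if B: "B \<in> carrier (homology_group (int m) Y)" for B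
  proof -
    obtain b where b: "singular_relcycle m Y {} b" "B = homologous_rel_set m Y {} b"
      using B by (auto simp: carrier_relative_homology_group)
    obtain y where y: "singular_relcycle m Y {} y" "homologous_rel m Y {} b (chain_map m v y)"
      using unipotent_cycle_surjective[OF vY[OF b(1)] v] by blast
    have "homologous_rel m Y {} (chain_map m (j \<circ> R) y) (chain_map m v y)"
      by (rule homotopic_imp_homologous_rel_chain_maps[OF homotopic_with_mono[OF jR] y(1)]) simp
    then have "homologous_rel m Y {} (chain_map m j (chain_map m R y)) b"
      using y(2) by (metis chain_map_comp homologous_rel_sym homologous_rel_trans)
    then have 1: "homologous_rel_set m Y {} (chain_map m j (chain_map m R y)) = B"
      unfolding b(2) homologous_rel_set_eq .
    have 2: "singular_relcycle m X {} (chain_map m R y)"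
      by (rule singular_relcycle_chain_map[OF y(1) R]) simp
    have "homologous_rel_set m X {} (chain_map m R y) \<in> carrier (homology_group (int m) X)"
      using 2 by (simp add: carrier_relative_homology_group)
    then show ?thesis
      by (rule rev_image_eqI) (simp only: f[OF 2] 1)
  qed
  then have "bij_betw ?f (carrier (homology_group (int m) X)) (carrier (homology_group (int m) Y))"
    using inj hom_induced_carrier by (auto simp: bij_betw_def)
  then show ?thesis
    using hom_induced_hom by (auto simp: iso_def n)
qed

lemma topspace_fibre_product:
  "topspace (fibre_product X Y f g) = {(x, y). x \<in> topspace X \<and> y \<in> topspace Y \<and> f x = g y}"
  by (auto simp: fibre_product_def)

lemma continuous_map_into_fibre_product:
  assumes "continuous_map Z X a" "continuous_map Z Y b" "\<And>z. z \<in> topspace Z \<Longrightarrow> f (a z) = g (b z)"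
  shows "continuous_map Z (fibre_product X Y f g) (\<lambda>z. (a z, b z))"
  using assms by (auto simp: fibre_product_def continuous_map_in_subtopology continuous_map_pairwise o_def)

lemma continuous_map_fibre_product_projections:
  "continuous_map (fibre_product X Y f g) X fst" "continuous_map (fibre_product X Y f g) Y snd"
  unfolding fibre_product_def
  by (intro continuous_map_from_subtopology continuous_map_fst continuous_map_snd)+

lemma locally_unitalI:
  assumes "continuous_map E B p" "continuous_map E E u" "\<And>e. e \<in> topspace E \<Longrightarrow> p (u e) = p e"
    and "fibrewise_filtration E p F"
    and "\<forall>k. (\<forall>U \<in> \<U> k. openin B U) \<and> \<Union>(\<U> k) = topspace B"
    and "\<forall>k. \<forall>U \<in> \<U> k. fibrewise_homotopic p (subtopology E (F k \<inter> p -` U)) E id u"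
  shows "locally_unital E B p u"
  unfolding locally_unital_def
proof (intro conjI ballI)
  show "\<exists>F \<U>. fibrewise_filtration E p F \<and>
        (\<forall>k. (\<forall>U \<in> \<U> k. openin B U) \<and> \<Union>(\<U> k) = topspace B) \<and>
        (\<forall>k. \<forall>U \<in> \<U> k. fibrewise_homotopic p (subtopology E (F k \<inter> p -` U)) E id u)"
    by (intro exI[of _ F] exI[of _ \<U>] conjI assms(4-6))
qed (use assms(1-3) in auto)

text \<open>\<open>G\<close> is the pullback of \<open>p\<close> along \<open>\<phi>\<close>, presented by \<open>m\<close>.\<close>

lemma locally_unital_pullback:
  assumes lu: "locally_unital E B p u"
    and q: "continuous_map G X q" and \<phi>: "continuous_map X B \<phi>"
    and e: "continuous_map G E e" and v: "continuous_map G G v"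
    and pe: "\<And>g. g \<in> topspace G \<Longrightarrow> p (e g) = \<phi> (q g)"
    and ev: "\<And>g. g \<in> topspace G \<Longrightarrow> e (v g) = u (e g)"
    and qv: "\<And>g. g \<in> topspace G \<Longrightarrow> q (v g) = q g"
    and m: "continuous_map (fibre_product X E \<phi> p) G m"
    and qm: "\<And>x y. (x, y) \<in> topspace (fibre_product X E \<phi> p) \<Longrightarrow> q (m (x, y)) = x"
    and em: "\<And>x y. (x, y) \<in> topspace (fibre_product X E \<phi> p) \<Longrightarrow> e (m (x, y)) = y"
    and mg: "\<And>g. g \<in> topspace G \<Longrightarrow> m (q g, e g) = g"
  shows "locally_unital G X q v"
proof -
  have u: "continuous_map E E u" "\<And>e. e \<in> topspace E \<Longrightarrow> p (u e) = p e"
    using lu by (simp_all add: locally_unital_def)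
  obtain F \<U> where F: "fibrewise_filtration E p F"
    and U: "\<forall>k. (\<forall>U \<in> \<U> k. openin B U) \<and> \<Union>(\<U> k) = topspace B"
    and hU: "\<forall>k. \<forall>U \<in> \<U> k. fibrewise_homotopic p (subtopology E (F k \<inter> p -` U)) E id u"
    using lu unfolding locally_unital_def by metis
  \<comment> \<open>A fibrewise homotopy of the \<open>E\<close>-component lifts to \<open>G\<close>
    by holding the \<open>X\<close>-component fixed.\<close>
  have lift: "fibrewise_homotopic q Z G f (\<lambda>z. m (q (f z), g z))"
    if f: "continuous_map Z G f" and g: "fibrewise_homotopic p Z E (e \<circ> f) g" for Z :: "'z topology" and f g
  proof -
    obtain H where H: "continuous_map (prod_topology unit_interval Z) E H"
      and H01: "\<And>z. z \<in> topspace Z \<Longrightarrow> H (0, z) = e (f z) \<and> H (1, z) = g z"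
      and pH: "\<And>z t. z \<in> topspace Z \<Longrightarrow> t \<in> {0..1} \<Longrightarrow> p (H (t, z)) = p (e (f z))"
      using g unfolding fibrewise_homotopic_iff by auto
    have fG: "f z \<in> topspace G" if "z \<in> topspace Z" for z
      using continuous_map_funspace[OF f] that by blast
    have HE: "H (t, z) \<in> topspace E" if "z \<in> topspace Z" "t \<in> {0..1}" for t z
      using continuous_map_funspace[OF H] that by auto
    have pq: "p (H (t, z)) = \<phi> (q (f z))" if "z \<in> topspace Z" "t \<in> {0..1}" for t z
      using pH[OF that] pe[OF fG[OF that(1)]] by simp
    have fp: "(q (f z), H (t, z)) \<in> topspace (fibre_product X E \<phi> p)" if "z \<in> topspace Z" "t \<in> {0..1}" for t z
      using HE[OF that] pq[OF that] fG[OF that(1)] continuous_map_funspace[OF q]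
      by (auto simp: topspace_fibre_product)
    have "continuous_map (prod_topology unit_interval Z) X (\<lambda>w. q (f (snd w)))"
      using continuous_map_compose[OF continuous_map_snd continuous_map_compose[OF f q]] by (simp add: o_def)
    from continuous_map_into_fibre_product[OF this H, of \<phi> p]
    have "continuous_map (prod_topology unit_interval Z) (fibre_product X E \<phi> p) (\<lambda>w. (q (f (snd w)), H w))"
      using pq by auto
    from continuous_map_compose[OF this m]
    have "continuous_map (prod_topology unit_interval Z) G (\<lambda>w. m (q (f (snd w)), H w))"
      by (simp add: o_def)
    then show ?thesis
      unfolding fibrewise_homotopic_iff
    proof (intro exI conjI ballI)
      fix z assume z: "z \<in> topspace Z"
      show "m (q (f (snd (0, z))), H (0, z)) = f z" "m (q (f (snd (1, z))), H (1, z)) = m (q (f z), g z)"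
        using H01[OF z] mg[OF fG[OF z]] by simp_all
      fix t :: real assume "t \<in> {0..1}"
      then show "q (m (q (f (snd (t, z))), H (t, z))) = q (f z)"
        using qm[OF fp[OF z]] by simp
    qed
  qed
  define F' where "F' k = {g \<in> topspace G. e g \<in> F k}" for k
  define \<U>' where "\<U>' k = (\<lambda>U. {x \<in> topspace X. \<phi> x \<in> U}) ` \<U> k" for k
  have "fibrewise_filtration G q F'"
    unfolding fibrewise_filtration_def
  proof (intro conjI allI impI)
    show "F' k \<subseteq> topspace G" "F' k \<subseteq> F' (Suc k)" for k
      using F by (auto simp: F'_def fibrewise_filtration_def)
    fix K f assume Kf: "finite_simplicial_complex K \<and> continuous_map (realization K) G f"
    then have "continuous_map (realization K) E (e \<circ> f)"
      using continuous_map_compose[OF _ e] by blast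
    then obtain k g where g: "fibrewise_homotopic p (realization K) E (e \<circ> f) g" "g ` topspace (realization K) \<subseteq> F k"
      using F Kf unfolding fibrewise_filtration_def by blast
    let ?g = "\<lambda>z. m (q (f z), g z)"
    have h: "fibrewise_homotopic q (realization K) G f ?g"
      using lift g(1) Kf by blast
    have "?g z \<in> F' k" if z: "z \<in> topspace (realization K)" for z
    proof -
      have fz: "f z \<in> topspace G"
        using Kf continuous_map_funspace z by blast
      have "g z \<in> topspace E"
        using continuous_map_funspace[OF fibrewise_homotopic_imp_continuous_maps(2)[OF g(1)]] z by blast
      moreover have "p (g z) = p (e (f z))"
        using g(1) z unfolding fibrewise_homotopic_iff by (metis atLeastAtMost_iff comp_apply order_refl zero_le_one)
      ultimately have fp: "(q (f z), g z) \<in> topspace (fibre_product X E \<phi> p)"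
        using pe[OF fz] fz continuous_map_funspace[OF q] by (auto simp: topspace_fibre_product)
      then have "?g z \<in> topspace G"
        using continuous_map_funspace[OF m] by blast
      then show ?thesis
        using em[OF fp] g(2) z by (auto simp: F'_def)
    qed
    then show "\<exists>k g. fibrewise_homotopic q (realization K) G f g \<and> g ` topspace (realization K) \<subseteq> F' k"
      using h by blast
  qed
  moreover have "\<forall>k. (\<forall>U\<in>\<U>' k. openin X U) \<and> \<Union>(\<U>' k) = topspace X"
  proof (intro allI conjI ballI)
    fix k U assume "U \<in> \<U>' k"
    then show "openin X U"
      using openin_continuous_map_preimage[OF \<phi>] U by (auto simp: \<U>'_def)
  next
    fix k
    have "\<phi> x \<in> \<Union>(\<U> k)" if "x \<in> topspace X" for x
      using continuous_map_funspace[OF \<phi>] that U by blast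
    then show "\<Union>(\<U>' k) = topspace X"
      by (auto simp: \<U>'_def)
  qed
  moreover have "\<forall>k. \<forall>U\<in>\<U>' k. fibrewise_homotopic q (subtopology G (F' k \<inter> q -` U)) G id v"
  proof (intro allI ballI)
    fix k U' assume "U' \<in> \<U>' k"
    then obtain U where U: "U \<in> \<U> k" "U' = {x \<in> topspace X. \<phi> x \<in> U}"
      by (auto simp: \<U>'_def)
    let ?Z = "subtopology G (F' k \<inter> q -` U')"
    have "continuous_map ?Z E e"
      by (rule continuous_map_from_subtopology[OF e])
    then have "continuous_map ?Z (subtopology E (F k \<inter> p -` U)) e"
      using pe U(2) by (auto simp: continuous_map_in_subtopology F'_def)
    from fibrewise_homotopic_compose_right[OF hU[rule_format, OF U(1)] this]
    have "fibrewise_homotopic p ?Z E (e \<circ> id) (u \<circ> e)"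
      by simp
    then have "fibrewise_homotopic q ?Z G id (\<lambda>z. m (q (id z), (u \<circ> e) z))"
      by (intro lift continuous_map_from_subtopology continuous_map_id)
    then show "fibrewise_homotopic q ?Z G id v"
    proof (rule fibrewise_homotopic_cong)
      fix z assume "z \<in> topspace ?Z"
      then have z: "z \<in> topspace G" by simp
      then have "v z \<in> topspace G"
        using continuous_map_funspace[OF v] by blast
      from mg[OF this] show "v z = m (q (id z), (u \<circ> e) z)"
        using ev[OF z] qv[OF z] by simp
    qed simp
  qed
  ultimately show ?thesis
    by (rule locally_unitalI[OF q v, rotated]) (rule qv)
qed

section \<open>Paths, the unit map, and comparison of fibre with homotopy fibre\<close>

lemma continuous_map_reparametrize:
  assumes g: "continuous_map Z (path_space B) g"
    and \<rho>: "continuous_map (prod_topology Z unit_interval) unit_interval \<rho>"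
  shows "continuous_map Z (path_space B) (\<lambda>z. \<lambda>t\<in>{0..1}. g z (\<rho> (z, t)))"
proof -
  let ?P = "prod_topology Z unit_interval"
  have "continuous_map ?P (prod_topology Z unit_interval) (\<lambda>w. (fst w, \<rho> w))"
    using \<rho> by (simp add: continuous_map_pairwise o_def continuous_map_fst)
  moreover have "compact_space unit_interval" "Hausdorff_space unit_interval"
    by (simp_all add: compact_space_subtopology Hausdorff_space_subtopology)
  ultimately have "continuous_map ?P B ((\<lambda>(z, t). g z t) \<circ> (\<lambda>w. (fst w, \<rho> w)))"
    by (intro continuous_map_compose[OF _ continuous_map_uncurry[OF g]])
  from continuous_map_curry[OF this] show ?thesis
    by simp
qed

lemma continuous_map_const_path:
  assumes "continuous_map E B p"
  shows "continuous_map E (path_space B) (\<lambda>e. const_path (p e))"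
  using continuous_map_curry[of E unit_interval B "\<lambda>w. p (fst w)"]
    continuous_map_compose[OF continuous_map_fst assms, of unit_interval]
  by (simp add: o_def const_path_def)

lemma unit_map_path_lifting:
  assumes p: "continuous_map E B p" and l: "path_lifting_map E B p l"
  shows "continuous_map E E (unit_map p l)" and "e \<in> topspace E \<Longrightarrow> p (unit_map p l e) = p e"
proof -
  have "continuous_map E (fibre_product E (path_space B) p (\<lambda>\<gamma>. \<gamma> 0)) (\<lambda>e. (e, const_path (p e)))"
    by (intro continuous_map_into_fibre_product continuous_map_const_path p) (simp_all add: const_path_def)
  from continuous_map_compose[OF this, of E l] show "continuous_map E E (unit_map p l)"
    using l by (simp add: path_lifting_map_def unit_map_def[abs_def] o_def)
  show "p (unit_map p l e) = p e" if e: "e \<in> topspace E"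
  proof -
    have "const_path (p e) \<in> topspace (path_space B)"
      using continuous_map_funspace[OF continuous_map_const_path[OF p]] e by blast
    then show ?thesis
      using l e unfolding path_lifting_map_def unit_map_def by (simp add: const_path_def)
  qed
qed

theorem homology_fibration_of_locally_unital:
  assumes l: "path_lifting_map E B p l" and lu: "locally_unital E B p (unit_map p l)"
  shows "homology_fibration E B p"
  unfolding homology_fibration_def
proof (intro conjI ballI allI)
  show p: "continuous_map E B p"
    using lu by (simp add: locally_unital_def)
  fix b n assume b: "b \<in> topspace B"
  let ?u = "unit_map p l"
  note u = unit_map_path_lifting[OF p l]
  let ?L = "fibre_product E (path_space B) p (\<lambda>\<gamma>. \<gamma> 0)"
  have cl: "continuous_map ?L E l"
    and pl: "\<And>\<gamma> e. \<gamma> \<in> topspace (path_space B) \<Longrightarrow> e \<in> topspace E \<Longrightarrow> p e = \<gamma> 0 \<Longrightarrow> p (l (e, \<gamma>)) = \<gamma> 1"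
    using l by (auto simp: path_lifting_map_def)
  let ?F = "fib E p b" and ?H = "hofib E B p b"
  let ?P = "subtopology (path_space B) {\<gamma>. \<gamma> 0 = b}"
  let ?j = "\<lambda>e. (e, const_path b)"
  have F: "topspace ?F = {e \<in> topspace E. p e = b}"
    by (auto simp: fib_def)
  have FE: "continuous_map ?F E id"
    unfolding fib_def by (intro continuous_map_from_subtopology) simp
  have H: "topspace ?H = {(e, \<gamma>). e \<in> topspace E \<and> \<gamma> \<in> topspace (path_space B) \<and> \<gamma> 0 = b \<and> p e = \<gamma> 1}"
    by (auto simp: hofib_def topspace_fibre_product)
  have HE: "continuous_map ?H E fst" and HP: "continuous_map ?H ?P snd"
    unfolding hofib_def by (rule continuous_map_fibre_product_projections)+
  have HP': "continuous_map ?H (path_space B) snd"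
    using HP by (simp add: continuous_map_in_subtopology)
  \<comment> \<open>The classifying map is the inclusion of \<open>b\<close>. The first coordinate
    of the fibre product is forced to be \<open>b\<close>, so \<open>snd\<close> presents the
    fibre.\<close>
  have luF: "locally_unital ?F (subtopology B {b}) p ?u"
  proof (rule locally_unital_pullback[OF lu, where e = id and \<phi> = id and m = snd])
    show "continuous_map ?F (subtopology B {b}) p"
      using p by (auto simp: fib_def continuous_map_in_subtopology intro: continuous_map_from_subtopology)
    show "continuous_map ?F ?F ?u"
      using u by (auto simp: fib_def continuous_map_in_subtopology intro: continuous_map_from_subtopology)
    show "continuous_map (fibre_product (subtopology B {b}) E id p) ?F snd"
      unfolding fib_def continuous_map_in_subtopology
      by (intro conjI continuous_map_fibre_product_projections) (auto simp: topspace_fibre_product)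
  qed (use u FE in \<open>auto simp: F topspace_fibre_product\<close>)
  let ?v = "\<lambda>w. (?u (fst w), snd w)"
  have ev1: "continuous_map ?P B (\<lambda>\<gamma>. \<gamma> 1)"
  proof -
    have "continuous_map (path_space B) (prod_topology (path_space B) unit_interval) (\<lambda>\<gamma>. (\<gamma>, 1))"
      by (simp add: continuous_map_pairwise o_def)
    from continuous_map_compose[OF this continuous_map_eval]
    have "continuous_map (path_space B) B (\<lambda>\<gamma>. \<gamma> 1)"
      by (simp add: o_def compact_space_subtopology Hausdorff_space_subtopology)
    then show ?thesis
      by (rule continuous_map_from_subtopology)
  qed
  have v: "continuous_map ?H ?H ?v"
    unfolding hofib_def
    by (intro continuous_map_into_fibre_product)
       (use continuous_map_compose[OF HE u(1)] HP u(2) in \<open>auto simp: hofib_def o_def topspace_fibre_product\<close>)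
  \<comment> \<open>The base is now the space of paths starting at \<open>b\<close>, mapped to
    \<open>B\<close> by evaluation at 1; \<open>m\<close> only exchanges the two
    coordinates.\<close>
  have luH: "locally_unital ?H ?P snd ?v"
  proof (rule locally_unital_pullback[OF lu HP ev1 HE v, where m = "\<lambda>w. (snd w, fst w)"])
    show "continuous_map (fibre_product ?P E (\<lambda>\<gamma>. \<gamma> 1) p) ?H (\<lambda>w. (snd w, fst w))"
      unfolding hofib_def
      by (intro continuous_map_into_fibre_product continuous_map_fibre_product_projections)
         (auto simp: topspace_fibre_product)
  qed (auto simp: H)
  have const_b: "const_path b \<in> topspace ?P"
    using b by (auto simp: const_path_def intro!: continuous_map_const[THEN iffD2] intro: continuous_map_eq[of _ _ "\<lambda>_. b"])
  have j: "continuous_map ?F ?H ?j"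
    unfolding hofib_def using const_b FE
    by (intro continuous_map_into_fibre_product) (auto simp: F const_path_def id_def)
  let ?Z = "prod_topology unit_interval ?H"
  \<comment> \<open>A point of \<open>?Z\<close> is a time \<open>s\<close> with
    \<open>(e, \<gamma>)\<close>, where \<open>\<gamma>\<close> runs from \<open>b\<close> to
    \<open>p e\<close>. \<open>?backward\<close> follows \<open>\<gamma>\<close> from
    \<open>p e\<close> back to \<open>\<gamma> s\<close>, and \<open>?forward\<close> follows it
    from \<open>b\<close> to \<open>\<gamma> s\<close>. Lifting the first and keeping the second
    gives \<open>R\<close> followed by \<open>?j\<close> at \<open>s = 0\<close>, and
    \<open>?v\<close> at \<open>s = 1\<close>.\<close>
  let ?backward = "\<lambda>z. \<lambda>t\<in>{0..1}. snd (snd z) (1 - t * (1 - fst z))"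
  let ?forward = "\<lambda>z. \<lambda>t\<in>{0..1}. snd (snd z) (fst z * t)"
  have Zs: "continuous_map ?Z (path_space B) (\<lambda>z. snd (snd z))"
    using continuous_map_compose[OF continuous_map_snd HP'] by (simp add: o_def)
  have cs: "continuous_map (prod_topology ?Z unit_interval) euclideanreal (\<lambda>w. fst (fst w))"
    using continuous_map_compose[OF continuous_map_fst continuous_map_fst]
    by (auto simp: o_def intro: continuous_map_into_fulltopology)
  have ct: "continuous_map (prod_topology ?Z unit_interval) euclideanreal snd"
    using continuous_map_snd by (auto intro: continuous_map_into_fulltopology)
  have backward: "continuous_map ?Z (path_space B) ?backward"
  proof -
    have "continuous_map (prod_topology ?Z unit_interval) euclideanreal (\<lambda>w. 1 - snd w * (1 - fst (fst w)))"
      by (intro continuous_map_diff continuous_map_real_mult cs ct) simp_all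
    then have "continuous_map (prod_topology ?Z unit_interval) unit_interval (\<lambda>w. 1 - snd w * (1 - fst (fst w)))"
      by (auto simp: continuous_map_in_subtopology mult_le_one)
    from continuous_map_reparametrize[OF Zs this] show ?thesis
      by simp
  qed
  have forward: "continuous_map ?Z (path_space B) ?forward"
  proof -
    have "continuous_map (prod_topology ?Z unit_interval) euclideanreal (\<lambda>w. fst (fst w) * snd w)"
      by (intro continuous_map_real_mult cs ct)
    then have "continuous_map (prod_topology ?Z unit_interval) unit_interval (\<lambda>w. fst (fst w) * snd w)"
      by (auto simp: continuous_map_in_subtopology mult_le_one)
    from continuous_map_reparametrize[OF Zs this] show ?thesis
      by simp
  qed
  have ZE: "continuous_map ?Z E (\<lambda>z. fst (snd z))"
    using continuous_map_compose[OF continuous_map_snd HE] by (simp add: o_def)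
  have "continuous_map ?Z ?L (\<lambda>z. (fst (snd z), ?backward z))"
    by (rule continuous_map_into_fibre_product[OF ZE backward]) (auto simp: H)
  from continuous_map_compose[OF this cl]
  have lb: "continuous_map ?Z E (\<lambda>z. l (fst (snd z), ?backward z))"
    by (simp add: o_def)
  have plb: "p (l (fst (snd z), ?backward z)) = snd (snd z) (fst z)" if z: "z \<in> topspace ?Z" for z
  proof -
    have "?backward z \<in> topspace (path_space B)"
      using continuous_map_funspace[OF backward] z by blast
    from pl[OF this, of "fst (snd z)"] show ?thesis
      using z by (auto simp: H)
  qed
  have hom: "continuous_map ?Z ?H (\<lambda>z. (l (fst (snd z), ?backward z), ?forward z))"
    unfolding hofib_def
  proof (rule continuous_map_into_fibre_product)
    show "continuous_map (prod_topology unit_interval (fibre_product E ?P p (\<lambda>\<gamma>. \<gamma> 1))) E (\<lambda>z. l (fst (snd z), ?backward z))"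
      using lb by (simp add: hofib_def)
    show "continuous_map (prod_topology unit_interval (fibre_product E ?P p (\<lambda>\<gamma>. \<gamma> 1))) ?P ?forward"
      using forward by (auto simp: continuous_map_in_subtopology hofib_def topspace_fibre_product)
    show "p (l (fst (snd z), ?backward z)) = ?forward z 1"
      if "z \<in> topspace (prod_topology unit_interval (fibre_product E ?P p (\<lambda>\<gamma>. \<gamma> 1)))" for z
      using plb[of z] that by (simp add: hofib_def)
  qed
  define R where "R w = l (fst w, \<lambda>t\<in>{0..1}. snd w (1 - t))" for w
  have R: "continuous_map ?H ?F R"
  proof -
    have i: "continuous_map ?H ?Z (\<lambda>w. (0, w))"
      by (simp add: continuous_map_pairwise o_def)
    from continuous_map_compose[OF i lb] have "continuous_map ?H E R"
      by (simp add: o_def R_def[abs_def])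
    moreover have "p (R w) = b" if "w \<in> topspace ?H" for w
      using plb[of "(0, w)"] that by (auto simp: R_def H)
    ultimately show ?thesis
      by (auto simp: fib_def continuous_map_in_subtopology)
  qed
  have Rj: "R (?j e) = ?u e" if "e \<in> topspace ?F" for e
  proof -
    have "(\<lambda>t\<in>{0..1}. const_path b (1 - t)) = const_path b"
      by (auto simp: const_path_def fun_eq_iff)
    then show ?thesis
      using that by (simp add: R_def unit_map_def F)
  qed
  have "homotopic_with (\<lambda>_. True) ?H ?H (?j \<circ> R) ?v"
  proof (subst homotopic_with, simp, intro exI conjI allI ballI)
    show "continuous_map ?Z ?H (\<lambda>z. (l (fst (snd z), ?backward z), ?forward z))"
      by (rule hom)
    fix w assume w: "w \<in> topspace ?H"
    show "(l (fst (snd (0, w)), ?backward (0, w)), ?forward (0, w)) = (?j \<circ> R) w"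
      using w by (auto simp: R_def H const_path_def)
    have "?backward (1, w) = const_path (p (fst w))" "?forward (1, w) = snd w"
      using w by (auto simp: H const_path_def fun_eq_iff extensional_def)
    then show "(l (fst (snd (1, w)), ?backward (1, w)), ?forward (1, w)) = ?v w"
      by (simp add: unit_map_def)
  qed simp
  then show "hom_induced n ?F {} ?H {} ?j \<in> iso (homology_group n ?F) (homology_group n ?H)"
    using hom_induced_iso_of_unipotent[OF j R _ v Rj _ unipotent_cycle_of_locally_unital[OF luF] unipotent_cycle_of_locally_unital[OF luH]] luF
    by (simp add: locally_unital_def)
qed

text \<open>Both path lifting and local unitality pass to the pullback along
  \<open>\<sigma>\<close>, so the fibration theorem is applied over the disc.\<close>

theorem theorem9:
  fixes E :: "'e topology" and B :: "'b topology" and p :: "'e \<Rightarrow> 'b"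
    and l :: "'e \<times> (real \<Rightarrow> 'b) \<Rightarrow> 'e"
  assumes "continuous_map E B p"
    and "path_lifting_map E B p l"
    and "sequentially_homotopy_unital E B p l"
  shows "universal_homology_fibration E B p"
  unfolding universal_homology_fibration_def
proof (intro conjI allI impI)
  show p: "continuous_map E B p" by fact
  obtain F \<U> where "fibrewise_filtration E p F"
    "\<forall>k. (\<forall>U \<in> \<U> k. openin B U) \<and> \<Union>(\<U> k) = topspace B"
    "\<forall>k. \<forall>U \<in> \<U> k. fibrewise_homotopic p (subtopology E (F k \<inter> p -` U)) E id (unit_map p l)"
    using assms(3) unfolding sequentially_homotopy_unital_def by metis
  then have lu: "locally_unital E B p (unit_map p l)"
    by (rule locally_unitalI[OF p unit_map_path_lifting(1)[OF p assms(2)], rotated])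
       (rule unit_map_path_lifting(2)[OF p assms(2)])
  fix n \<sigma> assume \<sigma>: "continuous_map (ndisc n) B \<sigma>"
  let ?D = "ndisc n" and ?Y = "fibre_product (ndisc n) E \<sigma> p"
  let ?\<sigma> = "\<lambda>\<gamma>. \<lambda>t\<in>{0..1}. \<sigma> (\<gamma> t)"
  \<comment> \<open>The disc coordinate moves to the end of the path, while the
    \<open>E\<close>-coordinate is moved by lifting the image path in \<open>B\<close>.\<close>
  define l' where "l' w = (snd w 1, l (snd (fst w), ?\<sigma> (snd w)))"
    for w :: "((nat \<Rightarrow> real) \<times> 'e) \<times> (real \<Rightarrow> nat \<Rightarrow> real)"
  have Y: "topspace ?Y = {(x, e). x \<in> topspace ?D \<and> e \<in> topspace E \<and> \<sigma> x = p e}"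
    by (rule topspace_fibre_product)
  note fstY = continuous_map_fibre_product_projections(1)[of ?D E \<sigma> p]
  note sndY = continuous_map_fibre_product_projections(2)[of ?D E \<sigma> p]
  let ?L = "fibre_product ?Y (path_space ?D) fst (\<lambda>\<gamma>. \<gamma> 0)"
  have pl: "p (l (e, \<gamma>)) = \<gamma> 1" if "\<gamma> \<in> topspace (path_space B)" "e \<in> topspace E" "p e = \<gamma> 0" for \<gamma> e
    using assms(2) that by (simp add: path_lifting_map_def)
  have c\<sigma>: "continuous_map (path_space ?D) (path_space B) ?\<sigma>"
  proof -
    have "continuous_map (prod_topology (path_space ?D) unit_interval) ?D (\<lambda>(\<gamma>, t). \<gamma> t)"
      by (rule continuous_map_eval) (simp_all add: compact_space_subtopology Hausdorff_space_subtopology)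
    from continuous_map_curry[OF continuous_map_compose[OF this \<sigma>]] show ?thesis
      by simp
  qed
  have \<sigma>P: "?\<sigma> \<gamma> \<in> topspace (path_space B)" if "\<gamma> \<in> topspace (path_space ?D)" for \<gamma>
    using continuous_map_funspace[OF c\<sigma>] that by blast
  have cl': "continuous_map ?L ?Y l'"
  proof -
    note fstL = continuous_map_fibre_product_projections(1)[of ?Y "path_space ?D" fst "\<lambda>\<gamma>. \<gamma> 0"]
    note sndL = continuous_map_fibre_product_projections(2)[of ?Y "path_space ?D" fst "\<lambda>\<gamma>. \<gamma> 0"]
    have "continuous_map ?L (prod_topology (path_space ?D) unit_interval) (\<lambda>w. (snd w, 1))"
      using sndL by (simp add: continuous_map_pairwise o_def)
    from continuous_map_compose[OF this continuous_map_eval]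
    have 1: "continuous_map ?L ?D (\<lambda>w. snd w 1)"
      by (simp add: o_def compact_space_subtopology Hausdorff_space_subtopology)
    have "continuous_map ?L (fibre_product E (path_space B) p (\<lambda>\<gamma>. \<gamma> 0)) (\<lambda>w. (snd (fst w), ?\<sigma> (snd w)))"
      using continuous_map_compose[OF fstL sndY] continuous_map_compose[OF sndL c\<sigma>]
      by (intro continuous_map_into_fibre_product) (auto simp: o_def topspace_fibre_product)
    from continuous_map_compose[OF this, of E l]
    have 2: "continuous_map ?L E (\<lambda>w. l (snd (fst w), ?\<sigma> (snd w)))"
      using assms(2) by (simp add: path_lifting_map_def o_def)
    show ?thesis
      unfolding l'_def
    proof (rule continuous_map_into_fibre_product[OF 1 2])
      fix w assume w: "w \<in> topspace ?L"
      then show "\<sigma> (snd w 1) = p (l (snd (fst w), ?\<sigma> (snd w)))"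
        using pl[OF \<sigma>P, of "snd w" "snd (fst w)"] by (auto simp: topspace_fibre_product)
    qed
  qed
  have l': "path_lifting_map ?Y ?D fst l'"
    using cl' by (simp add: path_lifting_map_def l'_def)
  have "?\<sigma> (const_path x) = const_path (\<sigma> x)" for x
    by (auto simp: const_path_def fun_eq_iff)
  then have unit': "unit_map fst l' w = (fst w, unit_map p l (snd w))" if "w \<in> topspace ?Y" for w
    using that by (auto simp: unit_map_def l'_def Y const_path_def)
  \<comment> \<open>\<open>?Y\<close> is literally the fibre product, so it is presented by the
    identity.\<close>
  have "locally_unital ?Y ?D fst (unit_map fst l')"
    by (rule locally_unital_pullback[OF lu fstY \<sigma> sndY unit_map_path_lifting(1)[OF fstY l'], where m = id])
       (auto simp: unit' Y)
  then show "homology_fibration ?Y ?D fst"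
    by (rule homology_fibration_of_locally_unital[OF l'])
qed

end
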